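(* Let $k$ be a field and let $\mathcal{Y}=\operatorname{colim}_{c\in\mathcal{C}}Y_c$ be an AP pseudo-ind-scheme over $k$, with its given presentation (where each $Y_c$ is an ind-scheme). Then the map of presheaves $$\operatorname{colim}_{c\in\mathcal{C}}Y_c^{\mathrm{red}}\longrightarrow\operatorname{colim}_{c\in\mathcal{C}}Y_c=\mathcal{Y}$$ is an ind-closed embedding, and it coincides with the inclusion $\mathcal{Y}^{\mathrm{red}}\hookrightarrow\mathcal{Y}$ of the reduction of $\mathcal{Y}$.
   Context: Presheaf means functor $(\mathsf{Sch}^{\mathrm{aff}}_k)^{\mathrm{op}}\to\mathsf{Set}$; all colimits are computed in presheaves. Ind-scheme: a presheaf admitting a presentation $\operatorname{colim}_{i\in\mathcal I}Y_i$ with $\mathcal I$ essentially countable and filtered, each $Y_i$ a $k$-scheme, all transition maps closed embeddings. Ind-closed embedding: a map $\mathcal{Y}\to S$ from a presheaf to a scheme is an ind-closed embedding if $\mathcal{Y}$ is an ind-scheme for which some (equivalently, any) presentation $\operatorname{colim}_i Y_i$ has each $Y_i\to S$ a closed embedding. A map $\mathcal{Y}_1\to\mathcal{Y}_2$ of presheaves is an ind-closed embedding if for every affine $k$-scheme $S$ and every map $S\to\mathcal{Y}_2$, the base change $S\times_{\mathcal{Y}_2}\mathcal{Y}_1\to S$ is one. Amalgamation property (AP): a category $\mathcal{C}$ satisfies AP if every span $c_2\leftarrow c_0\to c_1$ can be completed to a commutative square by maps $c_1\to c_3\leftarrow c_2$. AP pseudo-ind-scheme: a presheaf $\mathcal{Y}$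 with a presentation $\mathcal{Y}=\operatorname{colim}_{c\in\mathcal{C}}Y_c$ where $\mathcal{C}$ is essentially countable and satisfies AP, and $c\mapsto Y_c$ is a functor to ind-schemes sending all arrows of $\mathcal{C}$ to ind-closed embeddings. Reduction: for any presheaf $\mathcal{Y}$, $\mathcal{Y}^{\mathrm{red}}\hookrightarrow\mathcal{Y}$ is the sub-presheaf such that, for $S$ affine, $\mathcal{Y}^{\mathrm{red}}(S)\subset\mathcal{Y}(S)$ consists of all maps $S\to\mathcal{Y}$ which factor as $S\to T\to\mathcal{Y}$ for some reduced $k$-scheme $T$ (not necessarily affine). This applies in particular to each $Y_c$. *)

theory Defs
  imports "HOL-Algebra.Ideal" "HOL-Algebra.Module"
begin

text \<open>
  Affine schemes over the field \<open>K\<close> are commutative \<open>K\<close>-algebras with the arrows reversed.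
  The type \<open>'u\<close> plays the role of the universe: it contains the carriers of all test algebras.
  The values of presheaves are subsets of a type \<open>'v\<close>.  A scheme is identified with its functor of
  points.
\<close>

definition aff :: "'k ring \<Rightarrow> ('k, 'u) module set" where
  "aff K = {A. algebra K A}"

text \<open>Homomorphisms are extensional, so that they are equal iff they agree on the carrier.\<close>

definition alg_hom :: "'k ring \<Rightarrow> ('k, 'u) module \<Rightarrow> ('k, 'u) module \<Rightarrow> ('u \<Rightarrow> 'u) set" where
  "alg_hom K A B = {f \<in> ring_hom A B \<inter> extensional (carrier A).
     \<forall>a\<in>carrier K. \<forall>x\<in>carrier A. f (a \<odot>\<^bsub>A\<^esub> x) = a \<odot>\<^bsub>B\<^esub> f x}"


section \<open>Presheaves on affine schemes\<close>

text \<open>\<open>pts F A\<close> is the set \<open>F(Spec A)\<close>; for \<open>f : A \<rightarrow> B\<close>, \<open>pull F A B f\<close> is the restriction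
  \<open>F(Spec A) \<rightarrow> F(Spec B)\<close> along \<open>Spec f\<close>.\<close>

record ('k, 'u, 'v) psh =
  pts :: "('k, 'u) module \<Rightarrow> 'v set"
  pull :: "('k, 'u) module \<Rightarrow> ('k, 'u) module \<Rightarrow> ('u \<Rightarrow> 'u) \<Rightarrow> 'v \<Rightarrow> 'v"

type_synonym ('k, 'u, 'v, 'w) psh_trans = "('k, 'u) module \<Rightarrow> 'v \<Rightarrow> 'w"

definition presheaf :: "'k ring \<Rightarrow> ('k, 'u, 'v) psh \<Rightarrow> bool" where
  "presheaf K F \<longleftrightarrow>
     (\<forall>A\<in>aff K. \<forall>B\<in>aff K. \<forall>f\<in>alg_hom K A B. pull F A B f \<in> pts F A \<rightarrow> pts F B) \<and>
     (\<forall>A\<in>aff K. \<forall>x\<in>pts F A. pull F A A (\<lambda>a\<in>carrier A. a) x = x) \<and>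
     (\<forall>A\<in>aff K. \<forall>B\<in>aff K. \<forall>C\<in>aff K. \<forall>f\<in>alg_hom K A B. \<forall>g\<in>alg_hom K B C. \<forall>x\<in>pts F A.
        pull F A C (compose (carrier A) g f) x = pull F B C g (pull F A B f x))"

definition psh_map ::
    "'k ring \<Rightarrow> ('k, 'u, 'v) psh \<Rightarrow> ('k, 'u, 'w) psh \<Rightarrow> ('k, 'u, 'v, 'w) psh_trans \<Rightarrow> bool" where
  "psh_map K F G \<alpha> \<longleftrightarrow> presheaf K F \<and> presheaf K G \<and>
     (\<forall>A\<in>aff K. \<alpha> A \<in> pts F A \<rightarrow> pts G A) \<and>
     (\<forall>A\<in>aff K. \<forall>B\<in>aff K. \<forall>f\<in>alg_hom K A B. \<forall>x\<in>pts F A.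
        \<alpha> B (pull F A B f x) = pull G A B f (\<alpha> A x))"

definition psh_iso ::
    "'k ring \<Rightarrow> ('k, 'u, 'v) psh \<Rightarrow> ('k, 'u, 'w) psh \<Rightarrow> ('k, 'u, 'v, 'w) psh_trans \<Rightarrow> bool" where
  "psh_iso K F G \<alpha> \<longleftrightarrow> psh_map K F G \<alpha> \<and> (\<forall>A\<in>aff K. bij_betw (\<alpha> A) (pts F A) (pts G A))"

definition psh_comp ::
    "('k, 'u, 'w, 'x) psh_trans \<Rightarrow> ('k, 'u, 'v, 'w) psh_trans \<Rightarrow> ('k, 'u, 'v, 'x) psh_trans" where
  "psh_comp \<beta> \<alpha> = (\<lambda>A x. \<beta> A (\<alpha> A x))"

definition psh_eq_on ::
    "'k ring \<Rightarrow> ('k, 'u, 'v) psh \<Rightarrow> ('k, 'u, 'v, 'w) psh_trans \<Rightarrow> ('k, 'u, 'v, 'w) psh_trans \<Rightarrow> bool"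
  where "psh_eq_on K F \<alpha> \<beta> \<longleftrightarrow> (\<forall>A\<in>aff K. \<forall>x\<in>pts F A. \<alpha> A x = \<beta> A x)"

text \<open>The inclusion of a sub-presheaf is the identity on elements.\<close>

definition psh_incl :: "('k, 'u, 'v, 'v) psh_trans" where
  "psh_incl = (\<lambda>A x. x)"

definition Spec :: "'k ring \<Rightarrow> ('k, 'u) module \<Rightarrow> ('k, 'u, 'u \<Rightarrow> 'u) psh" where
  "Spec K A = \<lparr>pts = alg_hom K A, pull = (\<lambda>B C f g. compose (carrier A) f g)\<rparr>"

definition Spec_map :: "('k, 'u) module \<Rightarrow> ('u \<Rightarrow> 'u) \<Rightarrow> ('k, 'u, 'u \<Rightarrow> 'u, 'u \<Rightarrow> 'u) psh_trans" where
  "Spec_map A \<phi> = (\<lambda>C g. compose (carrier A) g \<phi>)"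

definition fibre_prod ::
    "('k, 'u, 'v) psh \<Rightarrow> ('k, 'u, 'w) psh \<Rightarrow> ('k, 'u, 'v, 'x) psh_trans \<Rightarrow> ('k, 'u, 'w, 'x) psh_trans
     \<Rightarrow> ('k, 'u, 'v \<times> 'w) psh" where
  "fibre_prod F G \<alpha> \<beta> =
     \<lparr>pts = (\<lambda>A. {(x, y). x \<in> pts F A \<and> y \<in> pts G A \<and> \<alpha> A x = \<beta> A y}),
      pull = (\<lambda>A B f. map_prod (pull F A B f) (pull G A B f))\<rparr>"

abbreviation fibre_fst :: "('k, 'u, 'v \<times> 'w, 'v) psh_trans" where
  "fibre_fst \<equiv> (\<lambda>A. fst)"


section \<open>Schemes\<close>

definition localization_map ::
    "'k ring \<Rightarrow> ('k, 'u) module \<Rightarrow> 'u \<Rightarrow> ('k, 'u) module \<Rightarrow> ('u \<Rightarrow> 'u) \<Rightarrow> bool" where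
  "localization_map K A a B h \<longleftrightarrow> h \<in> alg_hom K A B \<and> h a \<in> Units B \<and>
     (\<forall>b\<in>carrier B. \<exists>x\<in>carrier A. \<exists>n::nat. b \<otimes>\<^bsub>B\<^esub> (h a [^]\<^bsub>B\<^esub> n) = h x) \<and>
     (\<forall>x\<in>carrier A. h x = \<zero>\<^bsub>B\<^esub> \<longrightarrow> (\<exists>n::nat. (a [^]\<^bsub>A\<^esub> n) \<otimes>\<^bsub>A\<^esub> x = \<zero>\<^bsub>A\<^esub>))"

text \<open>The sheaf condition for the covers of \<open>Spec A\<close> by the basic opens \<open>D(a)\<close>, with \<open>a\<close> in a finite
  set generating the unit ideal.\<close>

definition zariski_sheaf :: "'k ring \<Rightarrow> ('k, 'u, 'v) psh \<Rightarrow> bool" where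
  "zariski_sheaf K F \<longleftrightarrow> presheaf K F \<and>
     (\<forall>A\<in>aff K. \<forall>T B h s.
        finite T \<and> T \<subseteq> carrier A \<and> Idl\<^bsub>A\<^esub> T = carrier A \<and>
        (\<forall>a\<in>T. B a \<in> aff K \<and> localization_map K A a (B a) (h a) \<and> s a \<in> pts F (B a)) \<and>
        (\<forall>a\<in>T. \<forall>b\<in>T. \<forall>C\<in>aff K. \<forall>p\<in>alg_hom K (B a) C. \<forall>q\<in>alg_hom K (B b) C.
           compose (carrier A) p (h a) = compose (carrier A) q (h b) \<longrightarrow>
           pull F (B a) C p (s a) = pull F (B b) C q (s b))
        \<longrightarrow> (\<exists>!x. x \<in> pts F A \<and> (\<forall>a\<in>T. pull F A (B a) (h a) x = s a)))"

text \<open>The open subscheme of \<open>Spec A\<close> complementary to the zero locus of \<open>I\<close> has as \<open>B\<close>-points the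
  maps \<open>f : A \<rightarrow> B\<close> with \<open>f(I)B = B\<close>.\<close>

definition open_emb ::
    "'k ring \<Rightarrow> ('k, 'u, 'v) psh \<Rightarrow> ('k, 'u, 'w) psh \<Rightarrow> ('k, 'u, 'v, 'w) psh_trans \<Rightarrow> bool" where
  "open_emb K U F j \<longleftrightarrow> psh_map K U F j \<and>
     (\<forall>A\<in>aff K. inj_on (j A) (pts U A)) \<and>
     (\<forall>A\<in>aff K. \<forall>x\<in>pts F A. \<exists>I. ideal I A \<and>
        (\<forall>B\<in>aff K. \<forall>f\<in>alg_hom K A B.
           pull F A B f x \<in> j B ` pts U B \<longleftrightarrow> Idl\<^bsub>B\<^esub> (f ` I) = carrier B))"

text \<open>A scheme is a Zariski sheaf covered by affine open subfunctors; that a family of open subfunctors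
  covers is tested on points with values in fields.\<close>

definition scheme :: "'k ring \<Rightarrow> ('k, 'u, 'v) psh \<Rightarrow> bool" where
  "scheme K X \<longleftrightarrow> zariski_sheaf K X \<and>
     (\<forall>L\<in>aff K. field L \<longrightarrow> (\<forall>x\<in>pts X L.
        \<exists>A\<in>aff K. \<exists>j. open_emb K (Spec K A) X j \<and> x \<in> j L ` pts (Spec K A) L))"

definition reduced_ring :: "('a, 'm) ring_scheme \<Rightarrow> bool" where
  "reduced_ring A \<longleftrightarrow>
     (\<forall>a\<in>carrier A. \<forall>n::nat. a [^]\<^bsub>A\<^esub> n = \<zero>\<^bsub>A\<^esub> \<longrightarrow> a = \<zero>\<^bsub>A\<^esub>)"

definition reduced_scheme :: "'k ring \<Rightarrow> ('k, 'u, 'v) psh \<Rightarrow> bool" where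
  "reduced_scheme K X \<longleftrightarrow> scheme K X \<and>
     (\<forall>A\<in>aff K. \<forall>j. open_emb K (Spec K A) X j \<longrightarrow> reduced_ring A)"

text \<open>A map of schemes is a closed embedding if its base change to any affine \<open>Spec A\<close> is, up to
  isomorphism over \<open>Spec A\<close>, of the form \<open>Spec B \<rightarrow> Spec A\<close> for a surjection \<open>A \<rightarrow> B\<close>.\<close>

definition closed_emb ::
    "'k ring \<Rightarrow> ('k, 'u, 'v) psh \<Rightarrow> ('k, 'u, 'w) psh \<Rightarrow> ('k, 'u, 'v, 'w) psh_trans \<Rightarrow> bool" where
  "closed_emb K Z S f \<longleftrightarrow> scheme K Z \<and> scheme K S \<and> psh_map K Z S f \<and>
     (\<forall>A\<in>aff K. \<forall>s. psh_map K (Spec K A) S s \<longrightarrow>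
        (\<exists>B\<in>aff K. \<exists>\<phi>\<in>alg_hom K A B. \<exists>\<theta>.
           \<phi> ` carrier A = carrier B \<and>
           psh_iso K (Spec K B) (fibre_prod (Spec K A) Z s f) \<theta> \<and>
           psh_eq_on K (Spec K B) (psh_comp fibre_fst \<theta>) (Spec_map A \<phi>)))"


section \<open>Index categories\<close>

record ('o, 'm) cat =
  Ob :: "'o set"
  Ar :: "'m set"
  Dom :: "'m \<Rightarrow> 'o"
  Cod :: "'m \<Rightarrow> 'o"
  Ident :: "'o \<Rightarrow> 'm"
  Cmp :: "'m \<Rightarrow> 'm \<Rightarrow> 'm"

definition Hom :: "('o, 'm) cat \<Rightarrow> 'o \<Rightarrow> 'o \<Rightarrow> 'm set" where
  "Hom C a b = {f \<in> Ar C. Dom C f = a \<and> Cod C f = b}"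

definition category :: "('o, 'm) cat \<Rightarrow> bool" where
  "category C \<longleftrightarrow>
     (\<forall>f\<in>Ar C. Dom C f \<in> Ob C \<and> Cod C f \<in> Ob C) \<and>
     (\<forall>a\<in>Ob C. Ident C a \<in> Hom C a a) \<and>
     (\<forall>f\<in>Ar C. \<forall>g\<in>Ar C. Dom C g = Cod C f \<longrightarrow> Cmp C g f \<in> Hom C (Dom C f) (Cod C g)) \<and>
     (\<forall>f\<in>Ar C. Cmp C f (Ident C (Dom C f)) = f \<and> Cmp C (Ident C (Cod C f)) f = f) \<and>
     (\<forall>f\<in>Ar C. \<forall>g\<in>Ar C. \<forall>h\<in>Ar C. Dom C g = Cod C f \<and> Dom C h = Cod C g \<longrightarrow>
        Cmp C h (Cmp C g f) = Cmp C (Cmp C h g) f)"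

definition cat_functor ::
    "('o, 'm) cat \<Rightarrow> ('p, 'n) cat \<Rightarrow> ('o \<Rightarrow> 'p) \<Rightarrow> ('m \<Rightarrow> 'n) \<Rightarrow> bool" where
  "cat_functor C D Fo Fa \<longleftrightarrow> category C \<and> category D \<and>
     Fo \<in> Ob C \<rightarrow> Ob D \<and>
     (\<forall>f\<in>Ar C. Fa f \<in> Hom D (Fo (Dom C f)) (Fo (Cod C f))) \<and>
     (\<forall>a\<in>Ob C. Fa (Ident C a) = Ident D (Fo a)) \<and>
     (\<forall>f\<in>Ar C. \<forall>g\<in>Ar C. Dom C g = Cod C f \<longrightarrow> Fa (Cmp C g f) = Cmp D (Fa g) (Fa f))"

definition cat_isomorphic :: "('o, 'm) cat \<Rightarrow> 'o \<Rightarrow> 'o \<Rightarrow> bool" where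
  "cat_isomorphic C a b \<longleftrightarrow>
     (\<exists>f\<in>Hom C a b. \<exists>g\<in>Hom C b a. Cmp C g f = Ident C a \<and> Cmp C f g = Ident C b)"

definition cat_equivalence ::
    "('o, 'm) cat \<Rightarrow> ('p, 'n) cat \<Rightarrow> ('o \<Rightarrow> 'p) \<Rightarrow> ('m \<Rightarrow> 'n) \<Rightarrow> bool" where
  "cat_equivalence C D Fo Fa \<longleftrightarrow> cat_functor C D Fo Fa \<and>
     (\<forall>a\<in>Ob C. \<forall>b\<in>Ob C. bij_betw Fa (Hom C a b) (Hom D (Fo a) (Fo b))) \<and>
     (\<forall>d\<in>Ob D. \<exists>c\<in>Ob C. cat_isomorphic D (Fo c) d)"

text \<open>Every category with countably many objects and arrows is isomorphic to one with objects and arrows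
  in \<open>nat\<close>.\<close>

definition ess_countable :: "('o, 'm) cat \<Rightarrow> bool" where
  "ess_countable C \<longleftrightarrow> category C \<and> (\<exists>(D :: (nat, nat) cat) Fo Fa. cat_equivalence D C Fo Fa)"

definition filtered :: "('o, 'm) cat \<Rightarrow> bool" where
  "filtered C \<longleftrightarrow> category C \<and> Ob C \<noteq> {} \<and>
     (\<forall>a\<in>Ob C. \<forall>b\<in>Ob C. \<exists>c\<in>Ob C. Hom C a c \<noteq> {} \<and> Hom C b c \<noteq> {}) \<and>
     (\<forall>a\<in>Ob C. \<forall>b\<in>Ob C. \<forall>f\<in>Hom C a b. \<forall>g\<in>Hom C a b.
        \<exists>c\<in>Ob C. \<exists>h\<in>Hom C b c. Cmp C h f = Cmp C h g)"

definition amalgamation :: "('o, 'm) cat \<Rightarrow> bool" where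
  "amalgamation C \<longleftrightarrow> category C \<and>
     (\<forall>f1\<in>Ar C. \<forall>f2\<in>Ar C. Dom C f1 = Dom C f2 \<longrightarrow>
        (\<exists>c3\<in>Ob C. \<exists>g1\<in>Hom C (Cod C f1) c3. \<exists>g2\<in>Hom C (Cod C f2) c3. Cmp C g1 f1 = Cmp C g2 f2))"


section \<open>Colimits of presheaves\<close>

definition psh_diagram ::
    "'k ring \<Rightarrow> ('o, 'm) cat \<Rightarrow> ('o \<Rightarrow> ('k, 'u, 'v) psh) \<Rightarrow> ('m \<Rightarrow> ('k, 'u, 'v, 'v) psh_trans) \<Rightarrow> bool"
  where
  "psh_diagram K C Y t \<longleftrightarrow> category C \<and>
     (\<forall>c\<in>Ob C. presheaf K (Y c)) \<and>
     (\<forall>f\<in>Ar C. psh_map K (Y (Dom C f)) (Y (Cod C f)) (t f)) \<and>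
     (\<forall>c\<in>Ob C. psh_eq_on K (Y c) (t (Ident C c)) psh_incl) \<and>
     (\<forall>f\<in>Ar C. \<forall>g\<in>Ar C. Dom C g = Cod C f \<longrightarrow>
        psh_eq_on K (Y (Dom C f)) (t (Cmp C g f)) (psh_comp (t g) (t f)))"

text \<open>The colimit is computed objectwise, as the quotient of the disjoint union by the equivalence
  relation generated by \<open>(a, y) \<sim> (b, t f y)\<close> for \<open>f : a \<rightarrow> b\<close>.\<close>

definition colim_sum ::
    "('o, 'm) cat \<Rightarrow> ('o \<Rightarrow> ('k, 'u, 'v) psh) \<Rightarrow> ('k, 'u) module \<Rightarrow> ('o \<times> 'v) set" where
  "colim_sum C Y A = (SIGMA c:Ob C. pts (Y c) A)"

definition colim_gen ::
    "('o, 'm) cat \<Rightarrow> ('o \<Rightarrow> ('k, 'u, 'v) psh) \<Rightarrow> ('m \<Rightarrow> ('k, 'u, 'v, 'v) psh_trans)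
     \<Rightarrow> ('k, 'u) module \<Rightarrow> ('o \<times> 'v) rel" where
  "colim_gen C Y t A =
     {((Dom C f, y), (Cod C f, t f A y)) | f y. f \<in> Ar C \<and> y \<in> pts (Y (Dom C f)) A}"

definition colim_rel ::
    "('o, 'm) cat \<Rightarrow> ('o \<Rightarrow> ('k, 'u, 'v) psh) \<Rightarrow> ('m \<Rightarrow> ('k, 'u, 'v, 'v) psh_trans)
     \<Rightarrow> ('k, 'u) module \<Rightarrow> ('o \<times> 'v) rel" where
  "colim_rel C Y t A = (colim_gen C Y t A \<union> (colim_gen C Y t A)\<inverse>)\<^sup>*"

definition psh_colim ::
    "('o, 'm) cat \<Rightarrow> ('o \<Rightarrow> ('k, 'u, 'v) psh) \<Rightarrow> ('m \<Rightarrow> ('k, 'u, 'v, 'v) psh_trans)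
     \<Rightarrow> ('k, 'u, ('o \<times> 'v) set) psh" where
  "psh_colim C Y t =
     \<lparr>pts = (\<lambda>A. colim_sum C Y A // colim_rel C Y t A),
      pull = (\<lambda>A B f X. colim_rel C Y t B `` ((\<lambda>(c, y). (c, pull (Y c) A B f y)) ` X))\<rparr>"

text \<open>The map of colimits induced by a map \<open>\<sigma>\<close> to the diagram \<open>(Y, t)\<close>.\<close>

definition colim_map ::
    "('o, 'm) cat \<Rightarrow> ('o \<Rightarrow> ('k, 'u, 'w) psh) \<Rightarrow> ('m \<Rightarrow> ('k, 'u, 'w, 'w) psh_trans)
     \<Rightarrow> ('o \<Rightarrow> ('k, 'u, 'v, 'w) psh_trans)
     \<Rightarrow> ('k, 'u, ('o \<times> 'v) set, ('o \<times> 'w) set) psh_trans" where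
  "colim_map C Y t \<sigma> = (\<lambda>A X. colim_rel C Y t A `` ((\<lambda>(c, y). (c, \<sigma> c A y)) ` X))"

definition cocone ::
    "'k ring \<Rightarrow> ('o, 'm) cat \<Rightarrow> ('o \<Rightarrow> ('k, 'u, 'v) psh) \<Rightarrow> ('m \<Rightarrow> ('k, 'u, 'v, 'v) psh_trans)
     \<Rightarrow> ('k, 'u, 'w) psh \<Rightarrow> ('o \<Rightarrow> ('k, 'u, 'v, 'w) psh_trans) \<Rightarrow> bool" where
  "cocone K C Y t X \<iota> \<longleftrightarrow>
     (\<forall>c\<in>Ob C. psh_map K (Y c) X (\<iota> c)) \<and>
     (\<forall>f\<in>Ar C. psh_eq_on K (Y (Dom C f)) (psh_comp (\<iota> (Cod C f)) (t f)) (\<iota> (Dom C f)))"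

text \<open>The map out of the colimit induced by a cocone, which is constant on every class.\<close>

definition colim_desc ::
    "('o \<Rightarrow> ('k, 'u, 'v, 'w) psh_trans) \<Rightarrow> ('k, 'u, ('o \<times> 'v) set, 'w) psh_trans" where
  "colim_desc \<iota> = (\<lambda>A X. the_elem ((\<lambda>(c, y). \<iota> c A y) ` X))"

definition presentation ::
    "'k ring \<Rightarrow> ('o, 'm) cat \<Rightarrow> ('o \<Rightarrow> ('k, 'u, 'v) psh) \<Rightarrow> ('m \<Rightarrow> ('k, 'u, 'v, 'v) psh_trans)
     \<Rightarrow> ('k, 'u, 'w) psh \<Rightarrow> ('o \<Rightarrow> ('k, 'u, 'v, 'w) psh_trans) \<Rightarrow> bool" where
  "presentation K C Y t X \<iota> \<longleftrightarrow>
     psh_diagram K C Y t \<and> cocone K C Y t X \<iota> \<and> psh_iso K (psh_colim C Y t) X (colim_desc \<iota>)"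


section \<open>Ind-schemes and AP pseudo-ind-schemes\<close>

definition ind_presentation ::
    "'k ring \<Rightarrow> ('o, 'm) cat \<Rightarrow> ('o \<Rightarrow> ('k, 'u, 'v) psh) \<Rightarrow> ('m \<Rightarrow> ('k, 'u, 'v, 'v) psh_trans)
     \<Rightarrow> ('k, 'u, 'w) psh \<Rightarrow> ('o \<Rightarrow> ('k, 'u, 'v, 'w) psh_trans) \<Rightarrow> bool" where
  "ind_presentation K C Y t X \<iota> \<longleftrightarrow>
     presentation K C Y t X \<iota> \<and> ess_countable C \<and> filtered C \<and>
     (\<forall>c\<in>Ob C. scheme K (Y c)) \<and>
     (\<forall>f\<in>Ar C. closed_emb K (Y (Dom C f)) (Y (Cod C f)) (t f))"

text \<open>The types over which the following two definitions quantify entail no loss of generality: an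
  essentially countable index category can be replaced by an equivalent one with objects and arrows in
  \<open>nat\<close>; and as the transition maps are injective and the index category is filtered, the terms of the
  presentation inject into the colimit, hence can be taken with values in the same type \<open>'v\<close>.\<close>

definition ind_scheme :: "'k ring \<Rightarrow> ('k, 'u, 'v) psh \<Rightarrow> bool" where
  "ind_scheme K X \<longleftrightarrow>
     (\<exists>(C :: (nat, nat) cat) (Y :: nat \<Rightarrow> ('k, 'u, 'v) psh) t \<iota>. ind_presentation K C Y t X \<iota>)"

definition ind_closed_emb_scheme ::
    "'k ring \<Rightarrow> ('k, 'u, 'v) psh \<Rightarrow> ('k, 'u, 'w) psh \<Rightarrow> ('k, 'u, 'v, 'w) psh_trans \<Rightarrow> bool" where
  "ind_closed_emb_scheme K X S f \<longleftrightarrow> scheme K S \<and> psh_map K X S f \<and>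
     (\<exists>(C :: (nat, nat) cat) (Y :: nat \<Rightarrow> ('k, 'u, 'v) psh) t \<iota>.
        ind_presentation K C Y t X \<iota> \<and>
        (\<forall>c\<in>Ob C. closed_emb K (Y c) S (psh_comp f (\<iota> c))))"

definition ind_closed_emb ::
    "'k ring \<Rightarrow> ('k, 'u, 'v) psh \<Rightarrow> ('k, 'u, 'w) psh \<Rightarrow> ('k, 'u, 'v, 'w) psh_trans \<Rightarrow> bool" where
  "ind_closed_emb K X Y f \<longleftrightarrow> psh_map K X Y f \<and>
     (\<forall>A\<in>aff K. \<forall>s. psh_map K (Spec K A) Y s \<longrightarrow>
        ind_closed_emb_scheme K (fibre_prod (Spec K A) X s f) (Spec K A) fibre_fst)"

definition ap_pseudo_ind_scheme ::
    "'k ring \<Rightarrow> ('o, 'm) cat \<Rightarrow> ('o \<Rightarrow> ('k, 'u, 'v) psh) \<Rightarrow> ('m \<Rightarrow> ('k, 'u, 'v, 'v) psh_trans)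
     \<Rightarrow> ('k, 'u, 'w) psh \<Rightarrow> ('o \<Rightarrow> ('k, 'u, 'v, 'w) psh_trans) \<Rightarrow> bool" where
  "ap_pseudo_ind_scheme K C Y t X \<iota> \<longleftrightarrow>
     presentation K C Y t X \<iota> \<and> ess_countable C \<and> amalgamation C \<and>
     (\<forall>c\<in>Ob C. ind_scheme K (Y c)) \<and>
     (\<forall>f\<in>Ar C. ind_closed_emb K (Y (Dom C f)) (Y (Cod C f)) (t f))"

text \<open>By the Yoneda lemma, \<open>x \<in> pts X A\<close> is a map \<open>Spec A \<rightarrow> X\<close>; it factors through \<open>g : T \<rightarrow> X\<close> iff
  it is the image under \<open>g\<close> of a point of \<open>pts T A\<close>.  The type in which \<open>T\<close> takes its values is large
  enough: \<open>T\<close> can be replaced by a quasi-compact open subscheme through which \<open>Spec A\<close> still maps,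
  and if \<open>'u\<close> is infinite the point sets of such a scheme inject into \<open>'u \<Rightarrow> 'u\<close>.\<close>

definition reduction :: "'k ring \<Rightarrow> ('k, 'u, 'v) psh \<Rightarrow> ('k, 'u, 'v) psh" where
  "reduction K X =
     \<lparr>pts = (\<lambda>A. {x \<in> pts X A. \<exists>(T :: ('k, 'u, 'v + ('u \<Rightarrow> 'u)) psh) g.
                     reduced_scheme K T \<and> psh_map K T X g \<and> x \<in> g A ` pts T A}),
      pull = pull X\<rparr>"

end

theory Submission
  imports Defs "HOL-Library.Nat_Bijection"
begin

text \<open>
  Call a point of a presheaf locally reduced if, on a Zariski cover of its source by basic opens, it
  factors through reduced affine schemes.  For a scheme \<open>X\<close>, these points form a closed subscheme of
  \<open>X\<close>, which is reduced: in a chart \<open>Spec R\<close>, it is cut out by the nilradical of \<open>R\<close>.  A Zariski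
  cover can be taken finite, so
      if \<open>Z = colim Y\<^sub>c\<close> is a colimit along a category with amalgamation, a
  point of \<open>Y\<^sub>c\<close> becomes locally reduced in \<open>Z\<close> iff some arrow \<open>f : c \<rightarrow> e\<close> makes it locally reduced
  in \<open>Y\<^sub>e\<close>.

  Filtered categories have amalgamation, so this applies to a presentation of an ind-scheme
      by schemes
  and shows that its reduction consists of the locally reduced points; then it applies to \<open>Z\<close>
      and shows
  that the reduction of \<open>Z\<close> is the colimit of the \<open>Y\<^sub>c\<^sup>r\<^sup>e\<^sup>d\<close>.  For \<open>S = Spec A\<close>
      and a point \<open>y\<close> of \<open>Y\<^sub>c\<close>
  over \<open>S\<close>, the base change of the reduction to \<open>S\<close> is the union of the closed subschemes on which
  \<open>f y\<close> is reduced, for \<open>f : c \<rightarrow> e\<close>.  Amalgamation makes this union directed and essential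
  countability makes it countable, hence it is the union of an increasing sequence.
\<close>

section \<open>Algebras and their homomorphisms\<close>

text \<open>A map from a reduced scheme \<open>T\<close> into a colimit of presheaves need not
  factor through one term: \<open>T\<close> may fail to be quasi-compact, and different charts of
  \<open>T\<close> may land in different terms. The proof therefore never factors \<open>T\<close>
  itself; it keeps the trace that \<open>T\<close> leaves on a single affine point, namely a cover
  by basic opens with a reduced affine scheme behind each piece. In the other direction some
  \<open>T\<close> has to be produced, and gluing one by hand is avoided: the reduced points of a
  single scheme of the presentation already form one. Closedness is the second obstacle. Being
  reduced on some cover is an existential condition, so an ideal cutting it out is not apparent. On
  a scheme it is traded for a condition on all charts, namely that nilradicals are killed, and the
  ideal is assembled from finitely many charts. All quotients and localizations must again be test
  algebras, so their carriers have to fit in the type \<open>'u\<close>; here the infinity of the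
  universe enters, through an injective coding of pairs.\<close>

lemma aff_cring: "A \<in> aff K \<Longrightarrow> cring A"
  by (simp add: aff_def algebra.M_cring)

lemma aff_ring: "A \<in> aff K \<Longrightarrow> ring A"
  by (simp add: aff_cring cring.axioms(1))

lemma alg_hom_ring_hom: "f \<in> alg_hom K A B \<Longrightarrow> f \<in> ring_hom A B"
  by (simp add: alg_hom_def)

lemma alg_hom_closed [intro]: "f \<in> alg_hom K A B \<Longrightarrow> x \<in> carrier A \<Longrightarrow> f x \<in> carrier B"
  by (auto simp: alg_hom_def ring_hom_closed)

lemma alg_hom_mult:
  "f \<in> alg_hom K A B \<Longrightarrow> x \<in> carrier A \<Longrightarrow> y \<in> carrier A \<Longrightarrow> f (x \<otimes>\<^bsub>A\<^esub> y) = f x \<otimes>\<^bsub>B\<^esub> f y"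
  by (simp add: alg_hom_def ring_hom_mult)

lemma alg_hom_add:
  "f \<in> alg_hom K A B \<Longrightarrow> x \<in> carrier A \<Longrightarrow> y \<in> carrier A \<Longrightarrow> f (x \<oplus>\<^bsub>A\<^esub> y) = f x \<oplus>\<^bsub>B\<^esub> f y"
  by (simp add: alg_hom_def ring_hom_add)

lemma alg_hom_one: "f \<in> alg_hom K A B \<Longrightarrow> f \<one>\<^bsub>A\<^esub> = \<one>\<^bsub>B\<^esub>"
  by (simp add: alg_hom_def ring_hom_one)

lemma alg_hom_smult:
  "f \<in> alg_hom K A B \<Longrightarrow> a \<in> carrier K \<Longrightarrow> x \<in> carrier A \<Longrightarrow> f (a \<odot>\<^bsub>A\<^esub> x) = a \<odot>\<^bsub>B\<^esub> f x"
  by (simp add: alg_hom_def)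

lemma alg_hom_extensional: "f \<in> alg_hom K A B \<Longrightarrow> f \<in> extensional (carrier A)"
  by (simp add: alg_hom_def)

lemma alg_homI:
  assumes "\<And>x. x \<in> carrier A \<Longrightarrow> f x \<in> carrier B"
    and "\<And>x y. x \<in> carrier A \<Longrightarrow> y \<in> carrier A \<Longrightarrow> f (x \<otimes>\<^bsub>A\<^esub> y) = f x \<otimes>\<^bsub>B\<^esub> f y"
    and "\<And>x y. x \<in> carrier A \<Longrightarrow> y \<in> carrier A \<Longrightarrow> f (x \<oplus>\<^bsub>A\<^esub> y) = f x \<oplus>\<^bsub>B\<^esub> f y"
    and "f \<one>\<^bsub>A\<^esub> = \<one>\<^bsub>B\<^esub>"
    and "\<And>a x. a \<in> carrier K \<Longrightarrow> x \<in> carrier A \<Longrightarrow> f (a \<odot>\<^bsub>A\<^esub> x) = a \<odot>\<^bsub>B\<^esub> f x"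
    and "f \<in> extensional (carrier A)"
  shows "f \<in> alg_hom K A B"
  using assms by (auto simp: alg_hom_def intro!: ring_hom_memI)

lemma alg_hom_eqI:
  assumes "f \<in> alg_hom K A B" "g \<in> alg_hom K A C" "\<And>x. x \<in> carrier A \<Longrightarrow> f x = g x"
  shows "f = g"
  using assms by (meson alg_hom_extensional extensionalityI)

lemma alg_hom_ring_hom_cring:
  assumes "A \<in> aff K" "B \<in> aff K" "f \<in> alg_hom K A B"
  shows "ring_hom_cring A B f"
  using assms by (simp add: ring_hom_cring_def ring_hom_cring_axioms_def aff_cring alg_hom_ring_hom)

lemma alg_hom_zero:
  assumes "A \<in> aff K" "B \<in> aff K" "f \<in> alg_hom K A B"
  shows "f \<zero>\<^bsub>A\<^esub> = \<zero>\<^bsub>B\<^esub>"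
  using alg_hom_ring_hom_cring[OF assms] by (simp add: ring_hom_cring.hom_zero)

lemma alg_hom_minus:
  assumes "A \<in> aff K" "B \<in> aff K" "f \<in> alg_hom K A B" "x \<in> carrier A" "y \<in> carrier A"
  shows "f (x \<ominus>\<^bsub>A\<^esub> y) = f x \<ominus>\<^bsub>B\<^esub> f y"
proof -
  interpret ring_hom_cring A B f using assms by (simp add: alg_hom_ring_hom_cring)
  show ?thesis using assms(4,5) by (simp add: R.minus_eq S.minus_eq)
qed

lemma alg_hom_pow:
  assumes "A \<in> aff K" "B \<in> aff K" "f \<in> alg_hom K A B" "x \<in> carrier A"
  shows "f (x [^]\<^bsub>A\<^esub> (n::nat)) = f x [^]\<^bsub>B\<^esub> n"
proof -
  interpret ring_hom_cring A B f using assms by (simp add: alg_hom_ring_hom_cring)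
  show ?thesis by (induction n) (use assms(4) in auto)
qed

lemma alg_hom_comp [intro]:
  assumes "A \<in> aff K" "f \<in> alg_hom K A B" "g \<in> alg_hom K B C"
  shows "compose (carrier A) g f \<in> alg_hom K A C"
proof -
  interpret algebra K A using assms(1) by (simp add: aff_def)
  note f = alg_hom_closed[OF assms(2)] alg_hom_mult[OF assms(2)] alg_hom_add[OF assms(2)]
    alg_hom_one[OF assms(2)] alg_hom_smult[OF assms(2)]
  note g = alg_hom_closed[OF assms(3)] alg_hom_mult[OF assms(3)] alg_hom_add[OF assms(3)]
    alg_hom_one[OF assms(3)] alg_hom_smult[OF assms(3)]
  show ?thesis by (rule alg_homI) (simp_all add: compose_def f g)
qed

lemma alg_hom_id [intro]: "A \<in> aff K \<Longrightarrow> (\<lambda>a\<in>carrier A. a) \<in> alg_hom K A A"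
proof -
  assume A: "A \<in> aff K"
  interpret algebra K A using A by (simp add: aff_def)
  show ?thesis by (rule alg_homI) auto
qed

lemma alg_hom_comp_id:
  assumes "f \<in> alg_hom K A B"
  shows "compose (carrier A) f (\<lambda>a\<in>carrier A. a) = f" "compose (carrier A) (\<lambda>a\<in>carrier B. a) f = f"
  using assms alg_hom_closed[OF assms] alg_hom_extensional[OF assms]
  by (auto simp: compose_def fun_eq_iff extensional_def)

lemma alg_hom_comp_assoc:
  assumes "f \<in> alg_hom K A B"
  shows "compose (carrier A) h (compose (carrier A) g f) =
      compose (carrier A) (compose (carrier B) h g) f"
  using alg_hom_closed[OF assms] by (auto simp: compose_def fun_eq_iff)

lemma alg_hom_Units:
  assumes "A \<in> aff K" "B \<in> aff K" "f \<in> alg_hom K A B" "x \<in> Units A"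
  shows "f x \<in> Units B"
proof -
  interpret ring_hom_cring A B f using assms by (simp add: alg_hom_ring_hom_cring)
  obtain y where y: "y \<in> carrier A" "x \<otimes>\<^bsub>A\<^esub> y = \<one>\<^bsub>A\<^esub>" "y \<otimes>\<^bsub>A\<^esub> x = \<one>\<^bsub>A\<^esub>" "x \<in> carrier A"
    using assms(4) by (auto simp: Units_def)
  have "f x \<otimes>\<^bsub>B\<^esub> f y = \<one>\<^bsub>B\<^esub>" "f y \<otimes>\<^bsub>B\<^esub> f x = \<one>\<^bsub>B\<^esub>"
    using hom_mult[of x y] hom_mult[of y x] y by simp_all
  then show ?thesis using y by (auto simp: Units_def)
qed

subsection \<open>Ideals\<close>

lemma ideal_sub: "ideal I A \<Longrightarrow> I \<subseteq> carrier A"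
  by (simp add: additive_subgroup.a_subset ideal.axioms(1))

lemma ideal_zero: "ideal I A \<Longrightarrow> \<zero>\<^bsub>A\<^esub> \<in> I"
  by (simp add: additive_subgroup.zero_closed ideal.axioms(1))

lemma ideal_add: "ideal I A \<Longrightarrow> x \<in> I \<Longrightarrow> y \<in> I \<Longrightarrow> x \<oplus>\<^bsub>A\<^esub> y \<in> I"
  by (simp add: additive_subgroup.a_closed ideal.axioms(1))

lemma cring_idealI:
  assumes "cring A" "I \<subseteq> carrier A" "\<zero>\<^bsub>A\<^esub> \<in> I"
    and "\<And>x y. x \<in> I \<Longrightarrow> y \<in> I \<Longrightarrow> x \<oplus>\<^bsub>A\<^esub> y \<in> I"
    and mult: "\<And>r x. r \<in> carrier A \<Longrightarrow> x \<in> I \<Longrightarrow> r \<otimes>\<^bsub>A\<^esub> x \<in> I"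
  shows "ideal I A"
proof -
  interpret cring A by fact
  show ?thesis
  proof (rule idealI[OF ring_axioms])
    have "\<ominus>\<^bsub>A\<^esub> x \<in> I" if "x \<in> I" for x
      using mult[of "\<ominus>\<^bsub>A\<^esub> \<one>\<^bsub>A\<^esub>" x] that assms(2) by (simp add: subsetD l_minus)
    then show "subgroup I (add_monoid A)"
      by (intro add.subgroupI) (use assms in \<open>auto simp: a_inv_def[symmetric]\<close>)
    show "x \<otimes>\<^bsub>A\<^esub> a \<in> I" "a \<otimes>\<^bsub>A\<^esub> x \<in> I" if "a \<in> I" "x \<in> carrier A" for a x
      using mult[OF that(2,1)] that assms(2) m_comm[of a x] by auto
  qed
qed

lemma directed_Union_ideal:
  assumes "cring A" "\<C> \<noteq> {}" "\<And>I. I \<in> \<C> \<Longrightarrow> ideal I A"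
    and "\<And>I J. I \<in> \<C> \<Longrightarrow> J \<in> \<C> \<Longrightarrow> \<exists>L\<in>\<C>. I \<subseteq> L \<and> J \<subseteq> L"
  shows "ideal (\<Union>\<C>) A"
proof (rule cring_idealI[OF assms(1)])
  show "\<Union>\<C> \<subseteq> carrier A" by (intro Union_least ideal_sub assms(3))
  obtain I where I: "I \<in> \<C>" using assms(2) by blast
  then show "\<zero>\<^bsub>A\<^esub> \<in> \<Union>\<C>" using ideal_zero[OF assms(3)[OF I]] by blast
next
  fix x y assume "x \<in> \<Union>\<C>" "y \<in> \<Union>\<C>"
  then obtain I J where IJ: "I \<in> \<C>" "x \<in> I" "J \<in> \<C>" "y \<in> J" by blast
  then obtain L where L: "L \<in> \<C>" "I \<subseteq> L" "J \<subseteq> L" using assms(4) by blast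
  then show "x \<oplus>\<^bsub>A\<^esub> y \<in> \<Union>\<C>" using ideal_add[OF assms(3)[OF L(1)], of x y] IJ by blast
next
  fix r x assume "r \<in> carrier A" "x \<in> \<Union>\<C>"
  then obtain I where I: "I \<in> \<C>" "x \<in> I" by blast
  then show "r \<otimes>\<^bsub>A\<^esub> x \<in> \<Union>\<C>"
    using ideal.I_l_closed[OF assms(3)[OF I(1)] I(2) \<open>r \<in> carrier A\<close>] by blast
qed

lemma vimage_ideal:
  assumes "A \<in> aff K" "B \<in> aff K" "f \<in> alg_hom K A B" "ideal J B"
  shows "ideal {x \<in> carrier A. f x \<in> J} A"
proof -
  interpret ring_hom_cring A B f using assms by (simp add: alg_hom_ring_hom_cring)
  show ?thesis
    by (rule cring_idealI) (auto simp: R.cring_axioms ideal_zero ideal_add ideal.I_l_closed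
        assms(4))
qed

lemma kernel_ideal:
  assumes "A \<in> aff K" "B \<in> aff K" "f \<in> alg_hom K A B"
  shows "ideal {x \<in> carrier A. f x = \<zero>\<^bsub>B\<^esub>} A"
  using vimage_ideal[OF assms ring.zeroideal[OF aff_ring[OF assms(2)]]] by simp

lemma Idl_kernel:
  assumes "A \<in> aff K" "B \<in> aff K" "f \<in> alg_hom K A B" "S \<subseteq> carrier A"
  shows "(\<forall>x\<in>Idl\<^bsub>A\<^esub> S. f x = \<zero>\<^bsub>B\<^esub>) \<longleftrightarrow> (\<forall>x\<in>S. f x = \<zero>\<^bsub>B\<^esub>)"
proof
  assume "\<forall>x\<in>S. f x = \<zero>\<^bsub>B\<^esub>"
  then have "S \<subseteq> {x \<in> carrier A. f x = \<zero>\<^bsub>B\<^esub>}" using assms(4) by auto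
  from ring.genideal_minimal[OF aff_ring[OF assms(1)] kernel_ideal[OF assms(1-3)] this]
  show "\<forall>x\<in>Idl\<^bsub>A\<^esub> S. f x = \<zero>\<^bsub>B\<^esub>" by auto
next
  assume "\<forall>x\<in>Idl\<^bsub>A\<^esub> S. f x = \<zero>\<^bsub>B\<^esub>"
  then show "\<forall>x\<in>S. f x = \<zero>\<^bsub>B\<^esub>" using ring.genideal_self[OF aff_ring[OF assms(1)] assms(4)] by auto
qed

lemma Idl_UNIV_image:
  assumes "A \<in> aff K" "B \<in> aff K" "f \<in> alg_hom K A B" "S \<subseteq> carrier A" "Idl\<^bsub>A\<^esub> S = carrier A"
  shows "Idl\<^bsub>B\<^esub> (f ` S) = carrier B"
proof -
  have fS: "f ` S \<subseteq> carrier B" using assms(3,4) by blast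
  have id: "ideal (Idl\<^bsub>B\<^esub> (f ` S)) B" using ring.genideal_ideal[OF aff_ring[OF assms(2)] fS] .
  have "S \<subseteq> {x \<in> carrier A. f x \<in> Idl\<^bsub>B\<^esub> (f ` S)}"
    using ring.genideal_self[OF aff_ring[OF assms(2)] fS] assms(4) by blast
  from ring.genideal_minimal[OF aff_ring[OF assms(1)] vimage_ideal[OF assms(1-3) id] this]
  have "\<one>\<^bsub>B\<^esub> \<in> Idl\<^bsub>B\<^esub> (f ` S)"
    using assms(5) alg_hom_one[OF assms(3)] ring.ring_simprules(6)[OF aff_ring[OF assms(1)]] by auto
  then show ?thesis by (rule ideal.one_imp_carrier[OF id])
qed

lemma Idl_UNIV_mono:
  assumes "A \<in> aff K" "S \<subseteq> T" "T \<subseteq> carrier A" "Idl\<^bsub>A\<^esub> S = carrier A"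
  shows "Idl\<^bsub>A\<^esub> T = carrier A"
proof -
  have "Idl\<^bsub>A\<^esub> S \<subseteq> Idl\<^bsub>A\<^esub> T" using ring.subset_Idl_subset[OF aff_ring[OF assms(1)] assms(3,2)] .
  then show ?thesis
      using assms(4) ideal_sub[OF ring.genideal_ideal[OF aff_ring[OF assms(1)] assms(3)]] by blast
qed

section \<open>Maximal ideals and quasi-compactness of the spectrum\<close>

lemma maximal_ideal_exists:
  assumes "cring A" "ideal I A" "I \<noteq> carrier A"
  obtains M where "maximalideal M A" "I \<subseteq> M"
proof -
  interpret cring A by fact
  \<comment> \<open>Properness is expressed by the absence of \<open>\<one>\<close>, which passes at
    once to the union of a chain.\<close>
  let ?S = "{J. ideal J A \<and> I \<subseteq> J \<and> \<one>\<^bsub>A\<^esub> \<notin> J}"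
  have I: "I \<in> ?S" using assms ideal.one_imp_carrier by blast
  have "\<exists>M\<in>?S. \<forall>X\<in>?S. M \<subseteq> X \<longrightarrow> X = M"
  proof (rule subset_Zorn_nonempty)
    show "?S \<noteq> {}" using I by blast
    fix \<C> assume ne: "\<C> \<noteq> {}" and ch: "subset.chain ?S \<C>"
    have sub: "\<C> \<subseteq> ?S" using ch by (simp add: subset.chain_def)
    have "ideal (\<Union>\<C>) A"
    proof (rule directed_Union_ideal[OF assms(1) ne])
      show "ideal J A" if "J \<in> \<C>" for J using that sub by blast
      show "\<exists>L\<in>\<C>. J \<subseteq> L \<and> J' \<subseteq> L" if "J \<in> \<C>" "J' \<in> \<C>" for J J'
        using subset.chain_total[OF ch that] that by blast
    qed
    then show "\<Union>\<C> \<in> ?S" using sub ne by blast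
  qed
  then obtain M where M: "M \<in> ?S" and max: "\<forall>X\<in>?S. M \<subseteq> X \<longrightarrow> X = M" by (rule bexE)
  have "maximalideal M A"
  proof (rule maximalidealI)
    show "ideal M A" using M by simp
    have "\<one>\<^bsub>A\<^esub> \<notin> M" using M by simp
    then show "carrier A \<noteq> M" using one_closed by metis
    fix J assume J: "ideal J A" "M \<subseteq> J" "J \<subseteq> carrier A"
    show "J = M \<or> J = carrier A"
    proof (cases "\<one>\<^bsub>A\<^esub> \<in> J")
      case True
      then show ?thesis using ideal.one_imp_carrier[OF J(1)] by blast
    next
      case False
      then have "J \<in> ?S" using J M by blast
      then show ?thesis using max J by blast
    qed
  qed
  with M that show thesis by blast
qed

text \<open>The basic opens of \<open>S\<close> cover the spectrum as soon as they cover its closed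
  points, because a proper ideal lies in a maximal one.\<close>

lemma Idl_UNIV_iff:
  assumes "A \<in> aff K" "S \<subseteq> carrier A"
  shows "Idl\<^bsub>A\<^esub> S = carrier A \<longleftrightarrow> (\<forall>M. maximalideal M A \<longrightarrow> \<not> S \<subseteq> M)"
proof
  assume *: "Idl\<^bsub>A\<^esub> S = carrier A"
  show "\<forall>M. maximalideal M A \<longrightarrow> \<not> S \<subseteq> M"
  proof (intro allI impI notI)
    fix M assume M: "maximalideal M A" "S \<subseteq> M"
    interpret maximalideal M A by fact
    show False using ring.genideal_minimal[OF aff_ring[OF assms(1)] is_ideal M(2)] * I_notcarr
        ideal_sub[OF is_ideal] by blast
  qed
next
  assume *: "\<forall>M. maximalideal M A \<longrightarrow> \<not> S \<subseteq> M"
  show "Idl\<^bsub>A\<^esub> S = carrier A"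
  proof (rule ccontr)
    assume "Idl\<^bsub>A\<^esub> S \<noteq> carrier A"
    then obtain M where "maximalideal M A" "Idl\<^bsub>A\<^esub> S \<subseteq> M"
      using maximal_ideal_exists[OF aff_cring[OF assms(1)] ring.genideal_ideal[OF
          aff_ring[OF assms(1)] assms(2)]] by blast
    then show False using * ring.genideal_self[OF aff_ring[OF assms(1)] assms(2)] by blast
  qed
qed

text \<open>Powers of the elements of a cover cover as well: a maximal ideal above \<open>J\<close>
  is prime, so it would contain every \<open>a\<close> in \<open>S\<close>. Local-to-global
  arguments apply this to an ideal of good multipliers, for which each localization supplies only a
  power of \<open>a\<close>.\<close>

lemma ideal_UNIV_of_powers:
  assumes "A \<in> aff K" "ideal J A" "S \<subseteq> carrier A" "Idl\<^bsub>A\<^esub> S = carrier A"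
    and "\<And>a. a \<in> S \<Longrightarrow> \<exists>n::nat. a [^]\<^bsub>A\<^esub> n \<in> J"
  shows "J = carrier A"
proof (rule ccontr)
  assume "J \<noteq> carrier A"
  then obtain M where M: "maximalideal M A" "J \<subseteq> M"
    using maximal_ideal_exists[OF aff_cring[OF assms(1)] assms(2)] by blast
  interpret cring A using assms by (simp add: aff_cring)
  interpret M: primeideal M A using maximalideal_prime M(1) .
  have pw: "a \<in> M" if "a \<in> carrier A" "a [^]\<^bsub>A\<^esub> (n::nat) \<in> M" for a n
    using that
  proof (induction n)
    case 0
    then show ?case using M.I_notcarr M.one_imp_carrier by simp
  next
    case (Suc n)
    then show ?case using M.I_prime[of "a [^]\<^bsub>A\<^esub> n" a] by auto
  qed
  have "S \<subseteq> M" using assms(3,5) pw M(2) by blast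
  then show False using Idl_UNIV_iff[OF assms(1,3)] assms(4) M(1) by blast
qed

text \<open>Quasi-compactness: the ideals generated by finite subsets of \<open>S\<close> form a
  directed family whose union is an ideal containing \<open>S\<close>, so \<open>\<one>\<close>
  already lies in one of them.\<close>

lemma Idl_UNIV_finite:
  assumes "A \<in> aff K" "S \<subseteq> carrier A" "Idl\<^bsub>A\<^esub> S = carrier A"
  obtains T where "finite T" "T \<subseteq> S" "Idl\<^bsub>A\<^esub> T = carrier A"
proof -
  interpret cring A using assms by (simp add: aff_cring)
  let ?F = "{T. finite T \<and> T \<subseteq> S}"
  let ?J = "\<Union>T\<in>?F. Idl\<^bsub>A\<^esub> T"
  have id: "ideal (Idl\<^bsub>A\<^esub> T) A" if "T \<in> ?F" for T using that assms(2) genideal_ideal by auto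
  have "ideal ?J A"
  proof (rule directed_Union_ideal[OF cring_axioms])
    show "(\<lambda>T. Idl\<^bsub>A\<^esub> T) ` ?F \<noteq> {}" by blast
    fix I J assume "I \<in> (\<lambda>T. Idl\<^bsub>A\<^esub> T) ` ?F" "J \<in> (\<lambda>T. Idl\<^bsub>A\<^esub> T) ` ?F"
    then obtain T T' where T: "T \<in> ?F" "T' \<in> ?F" "I = Idl\<^bsub>A\<^esub> T" "J = Idl\<^bsub>A\<^esub> T'" by blast
    then have "T \<union> T' \<in> ?F" by blast
    moreover have "I \<subseteq> Idl\<^bsub>A\<^esub> (T \<union> T')" "J \<subseteq> Idl\<^bsub>A\<^esub> (T \<union> T')"
      unfolding T(3,4) using T(1,2) assms(2) by (auto intro!: subset_Idl_subset del: subsetI)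
    ultimately show "\<exists>L\<in>(\<lambda>T. Idl\<^bsub>A\<^esub> T) ` ?F. I \<subseteq> L \<and> J \<subseteq> L" by blast
  qed (use id in blast)
  moreover have "S \<subseteq> ?J"
  proof
    fix x assume "x \<in> S"
    then have "{x} \<in> ?F" "x \<in> Idl\<^bsub>A\<^esub> {x}" using genideal_self[of "{x}"] assms(2) by auto
    then show "x \<in> ?J" by blast
  qed
  ultimately have "Idl\<^bsub>A\<^esub> S \<subseteq> ?J" by (rule genideal_minimal)
  moreover have "\<one>\<^bsub>A\<^esub> \<in> Idl\<^bsub>A\<^esub> S" using assms(3) by simp
  ultimately have "\<one>\<^bsub>A\<^esub> \<in> ?J" by (rule subsetD)
  then obtain T where T: "T \<in> ?F" "\<one>\<^bsub>A\<^esub> \<in> Idl\<^bsub>A\<^esub> T" by blast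
  show thesis using that[OF _ _ ideal.one_imp_carrier[OF id[OF T(1)] T(2)]] T(1) by blast
qed

section \<open>Quotients and localizations\<close>

text \<open>Fractions are classes of pairs, while the ring of fractions must have its carrier in
  \<open>'u\<close>; the coding of pairs makes room for it.\<close>

lemma infinite_square_inj:
  assumes "infinite (UNIV :: 'u set)"
  obtains enc :: "'u \<times> 'u \<Rightarrow> 'u" where "inj enc"
proof -
  from card_of_Times_same_infinite[OF assms, folded card_of_ordIso]
  obtain f :: "'u \<times> 'u \<Rightarrow> 'u" where "bij_betw f (UNIV \<times> UNIV) UNIV" by blast
  then show thesis using that by (auto simp: bij_betw_def)
qed

text \<open>\<open>fraction_map\<close> describes the localization of \<open>A/I\<close> at the multiplicative set \<open>S\<close>.\<close>

definition fraction_map ::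
    "'k ring \<Rightarrow> ('k, 'u) module \<Rightarrow> 'u set \<Rightarrow> 'u set \<Rightarrow> ('k, 'u) module \<Rightarrow> ('u \<Rightarrow> 'u) \<Rightarrow> bool" where
  "fraction_map K A S I B h \<longleftrightarrow> h \<in> alg_hom K A B \<and> (\<forall>s\<in>S. h s \<in> Units B) \<and>
     (\<forall>b\<in>carrier B. \<exists>x\<in>carrier A. \<exists>s\<in>S. b \<otimes>\<^bsub>B\<^esub> h s = h x) \<and>
     (\<forall>x\<in>carrier A. h x = \<zero>\<^bsub>B\<^esub> \<longleftrightarrow> (\<exists>s\<in>S. s \<otimes>\<^bsub>A\<^esub> x \<in> I))"

text \<open>One construction serves two purposes: \<open>I\<close> zero and \<open>S\<close> the
  powers of \<open>a\<close> give the localization at \<open>a\<close>, and \<open>S\<close> reduced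
  to \<open>\<one>\<close> gives the quotient by \<open>I\<close>.\<close>

locale fractions = A: algebra K A for K :: "'k ring" and A :: "('k, 'u) module" (structure) +
  fixes S I :: "'u set" and enc :: "'u \<times> 'u \<Rightarrow> 'u"
  assumes S: "S \<subseteq> carrier A" "\<one> \<in> S" "\<And>s t. s \<in> S \<Longrightarrow> t \<in> S \<Longrightarrow> s \<otimes> t \<in> S"
    and I: "ideal I A"
    and enc: "inj enc"
begin

text \<open>Equality of \<open>fst z / snd z\<close> and \<open>fst w / snd w\<close> modulo
  \<open>I\<close>. The factor \<open>s\<close> accounts for elements of \<open>S\<close> that are
  zero divisors modulo \<open>I\<close>.\<close>

definition fr_eq :: "'u \<times> 'u \<Rightarrow> 'u \<times> 'u \<Rightarrow> bool" where
  "fr_eq z w \<longleftrightarrow> (\<exists>s\<in>S. s \<otimes> (snd w \<otimes> fst z \<ominus> snd z \<otimes> fst w) \<in> I)"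

abbreviation num_den where "num_den \<equiv> carrier A \<times> S"

lemma S_closed: "s \<in> S \<Longrightarrow> s \<in> carrier A"
  using S(1) by blast

lemma fr_eq_refl: "z \<in> num_den \<Longrightarrow> fr_eq z z"
  unfolding fr_eq_def using S(2) S_closed ideal_zero[OF I]
  by (auto simp: A.M.minus_eq A.M.r_neg intro!: bexI[of _ "\<one>"])

lemma fr_eq_sym:
  assumes "z \<in> num_den" "w \<in> num_den" "fr_eq z w"
  shows "fr_eq w z"
proof -
  obtain x p y q where zw: "z = (x, p)" "w = (y, q)" "x \<in> carrier A" "y \<in> carrier A" "p \<in> S" "q \<in> S"
    using assms(1,2) by auto
  obtain s where s: "s \<in> S" "s \<otimes> (q \<otimes> x \<ominus> p \<otimes> y) \<in> I"
    using assms(3) by (auto simp: fr_eq_def zw)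
  have "s \<otimes> (p \<otimes> y \<ominus> q \<otimes> x) = (\<ominus> \<one>) \<otimes> (s \<otimes> (q \<otimes> x \<ominus> p \<otimes> y))"
    using zw s(1) S_closed by algebra
  then have "s \<otimes> (p \<otimes> y \<ominus> q \<otimes> x) \<in> I"
    using ideal.I_l_closed[OF I s(2), of "\<ominus> \<one>"] by simp
  then show ?thesis using s(1) by (auto simp: fr_eq_def zw)
qed

lemma fr_eq_trans:
  assumes "z \<in> num_den" "w \<in> num_den" "v \<in> num_den" "fr_eq z w" "fr_eq w v"
  shows "fr_eq z v"
proof -
  obtain x p y q u r where e: "z = (x, p)" "w = (y, q)" "v = (u, r)"
    and c: "x \<in> carrier A" "y \<in> carrier A" "u \<in> carrier A" and S': "p \<in> S" "q \<in> S" "r \<in> S"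
    using assms(1,2,3) by auto
  obtain s where s: "s \<in> S" "s \<otimes> (q \<otimes> x \<ominus> p \<otimes> y) \<in> I"
    using assms(4) by (auto simp: fr_eq_def e)
  obtain t where t: "t \<in> S" "t \<otimes> (r \<otimes> y \<ominus> q \<otimes> u) \<in> I"
    using assms(5) by (auto simp: fr_eq_def e)
  note cs = c S'[THEN S_closed] S_closed[OF s(1)] S_closed[OF t(1)]
  \<comment> \<open>The denominator \<open>q\<close> of the middle fraction joins the multiplier,
    since it need not be cancellable.\<close>
  have "(s \<otimes> t \<otimes> q) \<otimes> (r \<otimes> x \<ominus> p \<otimes> u) =
     (t \<otimes> r) \<otimes> (s \<otimes> (q \<otimes> x \<ominus> p \<otimes> y)) \<oplus>
     (s \<otimes> p) \<otimes> (t \<otimes> (r \<otimes> y \<ominus> q \<otimes> u))"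
    using cs by algebra
  also have "\<dots> \<in> I"
    by (rule ideal_add[OF I ideal.I_l_closed[OF I s(2)] ideal.I_l_closed[OF I t(2)]])
        (use cs in auto)
  finally show ?thesis using S(3) s(1) t(1) S' by (auto simp: fr_eq_def e)
qed

text \<open>A class is named by the code of a representative chosen from it. Equivalent pairs
  satisfy the same predicate, so the choice agrees on them.\<close>

definition frac :: "'u \<times> 'u \<Rightarrow> 'u" where
  "frac z = enc (SOME w. w \<in> num_den \<and> fr_eq z w)"

definition rep :: "'u \<Rightarrow> 'u \<times> 'u" where
  "rep u = (SOME z. z \<in> num_den \<and> frac z = u)"

lemma frac_eq_iff:
  assumes "z \<in> num_den" "w \<in> num_den"
  shows "frac z = frac w \<longleftrightarrow> fr_eq z w"
proof
  assume *: "frac z = frac w"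
  have ex: "\<exists>v. v \<in> num_den \<and> fr_eq z v" if "z \<in> num_den" for z using that fr_eq_refl by blast
  have "(SOME v. v \<in> num_den \<and> fr_eq z v) = (SOME v. v \<in> num_den \<and> fr_eq w v)"
    using * enc by (simp add: frac_def inj_eq)
  with someI_ex[OF ex[OF assms(1)]] someI_ex[OF ex[OF assms(2)]]
  obtain v where v: "v \<in> num_den" "fr_eq z v" "fr_eq w v" by auto
  show "fr_eq z w" using fr_eq_trans[OF assms(1) v(1) assms(2) v(2) fr_eq_sym[OF assms(2) v(1,3)]] .
next
  assume "fr_eq z w"
  then have "v \<in> num_den \<and> fr_eq z v \<longleftrightarrow> v \<in> num_den \<and> fr_eq w v" for v
    using fr_eq_sym fr_eq_trans assms by meson
  then show "frac z = frac w" by (simp add: frac_def)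
qed

lemma rep: "u \<in> frac ` num_den \<Longrightarrow> rep u \<in> num_den \<and> frac (rep u) = u"
  unfolding rep_def by (rule someI_ex) blast

lemma rep_frac: "z \<in> num_den \<Longrightarrow> rep (frac z) \<in> num_den \<and> fr_eq (rep (frac z)) z"
  using rep[of "frac z"] frac_eq_iff[of "rep (frac z)" z] by (auto dest: imageI)

lemma frac_eqI:
  assumes "x \<in> carrier A" "y \<in> carrier A" "p \<in> S" "q \<in> S" "q \<otimes> x = p \<otimes> y"
  shows "frac (x, p) = frac (y, q)"
proof -
  have "q \<otimes> x \<ominus> p \<otimes> y = \<zero>"
    using assms S_closed by (simp add: A.M.minus_eq A.M.r_neg)
  then have "fr_eq (x, p) (y, q)"
    unfolding fr_eq_def using S(2) ideal_zero[OF I] by (auto intro!: bexI[of _ "\<one>"])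
  then show ?thesis using frac_eq_iff assms by simp
qed

text \<open>The operations are computed on chosen representatives; their independence of the choice
  is the content of \<open>fr_mult\<close>, \<open>fr_add\<close> and
  \<open>fr_smult\<close>.\<close>

definition fr_ring :: "('k, 'u) module" where
  "fr_ring =
    \<lparr>carrier = frac ` num_den,
     mult = (\<lambda>u v. frac (fst (rep u) \<otimes> fst (rep v), snd (rep u) \<otimes> snd (rep v))),
     one = frac (\<one>, \<one>),
     zero = frac (\<zero>, \<one>),
     add = (\<lambda>u v. frac (snd (rep v) \<otimes> fst (rep u) \<oplus> snd (rep u) \<otimes> fst (rep v),
                        snd (rep u) \<otimes> snd (rep v))),
     smult = (\<lambda>c u. frac (c \<odot> fst (rep u), snd (rep u)))\<rparr>"

lemma fr_carrier: "carrier fr_ring = frac ` num_den"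
  and fr_one: "\<one>\<^bsub>fr_ring\<^esub> = frac (\<one>, \<one>)"
  and fr_zero: "\<zero>\<^bsub>fr_ring\<^esub> = frac (\<zero>, \<one>)"
  by (simp_all add: fr_ring_def)

lemma fr_mult:
  assumes "x \<in> carrier A" "p \<in> S" "y \<in> carrier A" "q \<in> S"
  shows "frac (x, p) \<otimes>\<^bsub>fr_ring\<^esub> frac (y, q) = frac (x \<otimes> y, p \<otimes> q)"
proof -
  obtain x' p' where 1: "rep (frac (x, p)) = (x', p')" "x' \<in> carrier A" "p' \<in> S"
      "fr_eq (x', p') (x, p)"
    using rep_frac[of "(x, p)"] assms by (cases "rep (frac (x, p))") auto
  obtain y' q' where 2: "rep (frac (y, q)) = (y', q')" "y' \<in> carrier A" "q' \<in> S"
      "fr_eq (y', q') (y, q)"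
    using rep_frac[of "(y, q)"] assms by (cases "rep (frac (y, q))") auto
  obtain s where s: "s \<in> S" "s \<otimes> (p \<otimes> x' \<ominus> p' \<otimes> x) \<in> I"
    using 1(4) by (auto simp: fr_eq_def)
  obtain t where t: "t \<in> S" "t \<otimes> (q \<otimes> y' \<ominus> q' \<otimes> y) \<in> I"
    using 2(4) by (auto simp: fr_eq_def)
  note c = assms(1,3) 1(2) 2(2) S_closed[OF assms(2)] S_closed[OF assms(4)] S_closed[OF 1(3)]
      S_closed[OF 2(3)]
    S_closed[OF s(1)] S_closed[OF t(1)]
  \<comment> \<open>The two fractions are exchanged for equivalent ones one at a time: each summand
    on the right is a multiple of one of the two given elements of \<open>I\<close>.\<close>
  have "(s \<otimes> t) \<otimes> ((p \<otimes> q) \<otimes> (x' \<otimes> y') \<ominus> (p' \<otimes> q') \<otimes> (x \<otimes> y)) =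
     (t \<otimes> q \<otimes> y') \<otimes> (s \<otimes> (p \<otimes> x' \<ominus> p' \<otimes> x)) \<oplus>
     (s \<otimes> p' \<otimes> x) \<otimes> (t \<otimes> (q \<otimes> y' \<ominus> q' \<otimes> y))"
    using c by algebra
  also have "\<dots> \<in> I"
    by (rule ideal_add[OF I ideal.I_l_closed[OF I s(2)] ideal.I_l_closed[OF I t(2)]])
        (use c in auto)
  finally have "fr_eq (x' \<otimes> y', p' \<otimes> q') (x \<otimes> y, p \<otimes> q)"
    using S(3) s(1) t(1) by (auto simp: fr_eq_def)
  then show ?thesis using c S(3) assms 1 2 frac_eq_iff by (simp add: fr_ring_def)
qed

lemma fr_add:
  assumes "x \<in> carrier A" "p \<in> S" "y \<in> carrier A" "q \<in> S"
  shows "frac (x, p) \<oplus>\<^bsub>fr_ring\<^esub> frac (y, q) = frac (q \<otimes> x \<oplus> p \<otimes> y, p \<otimes> q)"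
proof -
  obtain x' p' where 1: "rep (frac (x, p)) = (x', p')" "x' \<in> carrier A" "p' \<in> S"
      "fr_eq (x', p') (x, p)"
    using rep_frac[of "(x, p)"] assms by (cases "rep (frac (x, p))") auto
  obtain y' q' where 2: "rep (frac (y, q)) = (y', q')" "y' \<in> carrier A" "q' \<in> S"
      "fr_eq (y', q') (y, q)"
    using rep_frac[of "(y, q)"] assms by (cases "rep (frac (y, q))") auto
  obtain s where s: "s \<in> S" "s \<otimes> (p \<otimes> x' \<ominus> p' \<otimes> x) \<in> I"
    using 1(4) by (auto simp: fr_eq_def)
  obtain t where t: "t \<in> S" "t \<otimes> (q \<otimes> y' \<ominus> q' \<otimes> y) \<in> I"
    using 2(4) by (auto simp: fr_eq_def)
  note c = assms(1,3) 1(2) 2(2) S_closed[OF assms(2)] S_closed[OF assms(4)] S_closed[OF 1(3)]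
      S_closed[OF 2(3)]
    S_closed[OF s(1)] S_closed[OF t(1)]
  have "(s \<otimes> t) \<otimes> ((p \<otimes> q) \<otimes> (q' \<otimes> x' \<oplus> p' \<otimes> y') \<ominus> (p' \<otimes> q') \<otimes> (q \<otimes> x \<oplus> p \<otimes> y)) =
     (t \<otimes> q \<otimes> q') \<otimes> (s \<otimes> (p \<otimes> x' \<ominus> p' \<otimes> x)) \<oplus>
     (s \<otimes> p \<otimes> p') \<otimes> (t \<otimes> (q \<otimes> y' \<ominus> q' \<otimes> y))"
    using c by algebra
  also have "\<dots> \<in> I"
    by (rule ideal_add[OF I ideal.I_l_closed[OF I s(2)] ideal.I_l_closed[OF I t(2)]])
        (use c in auto)
  finally have "fr_eq (q' \<otimes> x' \<oplus> p' \<otimes> y', p' \<otimes> q') (q \<otimes> x \<oplus> p \<otimes> y, p \<otimes> q)"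
    using S(3) s(1) t(1) by (auto simp: fr_eq_def)
  then show ?thesis using c S(3) assms 1 2 frac_eq_iff by (simp add: fr_ring_def)
qed

lemma smult_right: "a \<in> carrier K \<Longrightarrow> x \<in> carrier A \<Longrightarrow> y \<in> carrier A \<Longrightarrow>
    x \<otimes> (a \<odot> y) = a \<odot> (x \<otimes> y)"
  using A.smult_assoc2[of a y x] by (simp add: A.m_comm)

lemma smult_eq_mult: "a \<in> carrier K \<Longrightarrow> x \<in> carrier A \<Longrightarrow> a \<odot> x = (a \<odot> \<one>) \<otimes> x"
  by (simp add: A.smult_assoc2)

lemma fr_smult:
  assumes "a \<in> carrier K" "x \<in> carrier A" "p \<in> S"
  shows "a \<odot>\<^bsub>fr_ring\<^esub> frac (x, p) = frac (a \<odot> x, p)"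
proof -
  obtain x' p' where 1: "rep (frac (x, p)) = (x', p')" "x' \<in> carrier A" "p' \<in> S"
      "fr_eq (x', p') (x, p)"
    using rep_frac[of "(x, p)"] assms by (cases "rep (frac (x, p))") auto
  obtain s where s: "s \<in> S" "s \<otimes> (p \<otimes> x' \<ominus> p' \<otimes> x) \<in> I"
    using 1(4) by (auto simp: fr_eq_def)
  \<comment> \<open>The scalar becomes the ring element \<open>a \<odot> \<one>\<close>, so that the
    identity below is one of commutative rings.\<close>
  define e where "e = a \<odot> \<one>"
  have e: "e \<in> carrier A" using assms by (simp add: e_def)
  note c = assms(2) 1(2) S_closed[OF assms(3)] S_closed[OF 1(3)] S_closed[OF s(1)] e
  have "s \<otimes> (p \<otimes> (e \<otimes> x') \<ominus> p' \<otimes> (e \<otimes> x)) =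
     e \<otimes> (s \<otimes> (p \<otimes> x' \<ominus> p' \<otimes> x))"
    using c by algebra
  also have "\<dots> \<in> I" by (rule ideal.I_l_closed[OF I s(2) e])
  finally have "fr_eq (a \<odot> x', p') (a \<odot> x, p)"
    using s(1) smult_eq_mult[of a x] smult_eq_mult[of a x'] assms 1(2)
        by (auto simp: fr_eq_def e_def)
  then show ?thesis using c assms 1 frac_eq_iff by (simp add: fr_ring_def)
qed


lemma fr_elem: "u \<in> carrier fr_ring \<Longrightarrow> \<exists>x p. x \<in> carrier A \<and> p \<in> S \<and> u = frac (x, p)"
  unfolding fr_carrier by auto

lemma fr_ring_aff: "fr_ring \<in> aff K"
proof -
  have C: "frac (x, p) \<in> carrier fr_ring" if "x \<in> carrier A" "p \<in> S" for x p
    using that by (auto simp: fr_carrier)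
  note simps = fr_mult fr_add fr_smult fr_one fr_zero S S_closed smult_right A.smult_assoc2
  have ab: "abelian_group fr_ring"
  proof (rule abelian_groupI)
    fix u v w assume "u \<in> carrier fr_ring" "v \<in> carrier fr_ring" "w \<in> carrier fr_ring"
    then obtain x p y q z r where c: "x \<in> carrier A" "p \<in> S" "y \<in> carrier A" "q \<in> S" "z \<in> carrier A"
        "r \<in> S"
      and e: "u = frac (x, p)" "v = frac (y, q)" "w = frac (z, r)"
      by (metis fr_elem)
    note cc = c(1,3,5) c(2,4,6)[THEN S_closed]
    show "u \<oplus>\<^bsub>fr_ring\<^esub> v \<in> carrier fr_ring" by (simp add: e simps c C)
    have "p \<otimes> (q \<otimes> r) \<otimes> (r \<otimes> (q \<otimes> x \<oplus> p \<otimes> y) \<oplus> p \<otimes> q \<otimes> z) =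
      p \<otimes> q \<otimes> r \<otimes> (q \<otimes> r \<otimes> x \<oplus> p \<otimes> (r \<otimes> y \<oplus> q \<otimes> z))"
      using cc by algebra
    then show "u \<oplus>\<^bsub>fr_ring\<^esub> v \<oplus>\<^bsub>fr_ring\<^esub> w = u \<oplus>\<^bsub>fr_ring\<^esub> (v \<oplus>\<^bsub>fr_ring\<^esub> w)"
      by (simp add: e simps c) (rule frac_eqI, simp_all add: c S S_closed)
    show "u \<oplus>\<^bsub>fr_ring\<^esub> v = v \<oplus>\<^bsub>fr_ring\<^esub> u"
      using cc by (simp add: e simps c A.m_comm A.a_comm)
    show "\<zero>\<^bsub>fr_ring\<^esub> \<oplus>\<^bsub>fr_ring\<^esub> u = u" by (simp add: e simps c)
    have "frac (\<ominus> x, p) \<oplus>\<^bsub>fr_ring\<^esub> u = \<zero>\<^bsub>fr_ring\<^esub>"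
      by (simp add: e simps c) (rule frac_eqI, use cc in \<open>simp_all add: c S A.r_minus A.M.l_neg\<close>)
    then show "\<exists>y\<in>carrier fr_ring. y \<oplus>\<^bsub>fr_ring\<^esub> u = \<zero>\<^bsub>fr_ring\<^esub>" using C c by blast
  qed (use C S in \<open>auto simp: fr_zero\<close>)
  have cr: "cring fr_ring"
  proof (rule cringI[OF ab])
    show "comm_monoid fr_ring"
    proof (rule comm_monoidI)
      fix u v w assume "u \<in> carrier fr_ring" "v \<in> carrier fr_ring" "w \<in> carrier fr_ring"
      then obtain x p y q z r where c: "x \<in> carrier A" "p \<in> S" "y \<in> carrier A" "q \<in> S"
          "z \<in> carrier A" "r \<in> S"
        and e: "u = frac (x, p)" "v = frac (y, q)" "w = frac (z, r)"
        by (metis fr_elem)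
      note cc = c(1,3,5) c(2,4,6)[THEN S_closed]
      show "u \<otimes>\<^bsub>fr_ring\<^esub> v \<in> carrier fr_ring" by (simp add: e simps c C)
      show "u \<otimes>\<^bsub>fr_ring\<^esub> v \<otimes>\<^bsub>fr_ring\<^esub> w = u \<otimes>\<^bsub>fr_ring\<^esub> (v \<otimes>\<^bsub>fr_ring\<^esub> w)"
        using cc by (simp add: e simps c A.m_assoc)
      show "\<one>\<^bsub>fr_ring\<^esub> \<otimes>\<^bsub>fr_ring\<^esub> u = u" by (simp add: e simps c)
      show "u \<otimes>\<^bsub>fr_ring\<^esub> v = v \<otimes>\<^bsub>fr_ring\<^esub> u" using cc by (simp add: e simps c A.m_comm)
    qed (use C S in \<open>auto simp: fr_one\<close>)
  next
    fix u v w assume "u \<in> carrier fr_ring" "v \<in> carrier fr_ring" "w \<in> carrier fr_ring"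
    then obtain x p y q z r where c: "x \<in> carrier A" "p \<in> S" "y \<in> carrier A" "q \<in> S" "z \<in> carrier A"
        "r \<in> S"
      and e: "u = frac (x, p)" "v = frac (y, q)" "w = frac (z, r)"
      by (metis fr_elem)
    note cc = c(1,3,5) c(2,4,6)[THEN S_closed]
    have "(p \<otimes> r \<otimes> (q \<otimes> r)) \<otimes> ((q \<otimes> x \<oplus> p \<otimes> y) \<otimes> z) =
      (p \<otimes> q \<otimes> r) \<otimes> (q \<otimes> r \<otimes> (x \<otimes> z) \<oplus> p \<otimes> r \<otimes> (y \<otimes> z))"
      using cc by algebra
    then show "(u \<oplus>\<^bsub>fr_ring\<^esub> v) \<otimes>\<^bsub>fr_ring\<^esub> w = u \<otimes>\<^bsub>fr_ring\<^esub> w \<oplus>\<^bsub>fr_ring\<^esub> v \<otimes>\<^bsub>fr_ring\<^esub> w"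
      by (simp add: e simps c) (rule frac_eqI, simp_all add: c S S_closed)
  qed
  have "algebra K fr_ring"
  proof (rule algebraI[OF A.R.cring_axioms cr])
    fix a b u v assume ab: "a \<in> carrier K" "b \<in> carrier K"
        and "u \<in> carrier fr_ring" "v \<in> carrier fr_ring"
    then obtain x p y q where c: "x \<in> carrier A" "p \<in> S" "y \<in> carrier A" "q \<in> S"
      and e: "u = frac (x, p)" "v = frac (y, q)"
      by (metis fr_elem)
    note cc = c(1,3) c(2,4)[THEN S_closed]
    show "a \<odot>\<^bsub>fr_ring\<^esub> u \<in> carrier fr_ring" by (simp add: e simps c C ab)
    show "(a \<oplus>\<^bsub>K\<^esub> b) \<odot>\<^bsub>fr_ring\<^esub> u = a \<odot>\<^bsub>fr_ring\<^esub> u \<oplus>\<^bsub>fr_ring\<^esub> b \<odot>\<^bsub>fr_ring\<^esub> u"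
      by (simp add: e simps c ab) (rule frac_eqI, use cc in \<open>simp_all add: c S ab A.smult_l_distr
          A.r_distr A.m_assoc smult_right\<close>)
    show "a \<odot>\<^bsub>fr_ring\<^esub> (u \<oplus>\<^bsub>fr_ring\<^esub> v) = a \<odot>\<^bsub>fr_ring\<^esub> u \<oplus>\<^bsub>fr_ring\<^esub> a \<odot>\<^bsub>fr_ring\<^esub> v"
      using cc by (simp add: e simps c ab A.smult_r_distr)
    show "(a \<otimes>\<^bsub>K\<^esub> b) \<odot>\<^bsub>fr_ring\<^esub> u = a \<odot>\<^bsub>fr_ring\<^esub> (b \<odot>\<^bsub>fr_ring\<^esub> u)"
      using cc by (simp add: e simps c ab A.smult_assoc1)
    show "(a \<odot>\<^bsub>fr_ring\<^esub> u) \<otimes>\<^bsub>fr_ring\<^esub> v = a \<odot>\<^bsub>fr_ring\<^esub> (u \<otimes>\<^bsub>fr_ring\<^esub> v)"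
      by (simp add: e simps c ab)
  next
    fix u assume "u \<in> carrier fr_ring"
    then obtain x p where c: "x \<in> carrier A" "p \<in> S" "u = frac (x, p)" by (metis fr_elem)
    then show "\<one>\<^bsub>K\<^esub> \<odot>\<^bsub>fr_ring\<^esub> u = u" by (simp add: simps)
  qed
  then show ?thesis by (simp add: aff_def)
qed

definition fr_hom :: "'u \<Rightarrow> 'u" where
  "fr_hom = (\<lambda>x\<in>carrier A. frac (x, \<one>))"

lemma fr_hom: "fraction_map K A S I fr_ring fr_hom"
  unfolding fraction_map_def
proof (intro conjI ballI)
  note simps = fr_mult fr_add fr_smult fr_one fr_zero S S_closed fr_hom_def fr_carrier
  show "fr_hom \<in> alg_hom K A fr_ring"
    by (rule alg_homI) (simp_all add: simps)
  fix s assume s: "s \<in> S"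
  have "frac (\<one>, s) \<in> carrier fr_ring" "fr_hom s \<in> carrier fr_ring" using s by (simp_all add: simps)
  moreover have "fr_hom s \<otimes>\<^bsub>fr_ring\<^esub> frac (\<one>, s) = \<one>\<^bsub>fr_ring\<^esub>" "frac (\<one>, s) \<otimes>\<^bsub>fr_ring\<^esub> fr_hom s =
      \<one>\<^bsub>fr_ring\<^esub>"
    using s by (simp add: simps, intro frac_eqI, simp_all add: simps)+
  ultimately show "fr_hom s \<in> Units fr_ring" by (auto simp: Units_def)
next
  fix b assume "b \<in> carrier fr_ring"
  then obtain x p where c: "x \<in> carrier A" "p \<in> S" "b = frac (x, p)" by (metis fr_elem)
  have "b \<otimes>\<^bsub>fr_ring\<^esub> fr_hom p = fr_hom x"
    using c S S_closed by (simp add: fr_mult fr_hom_def) (intro frac_eqI, simp_all add: A.m_comm)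
  then show "\<exists>x\<in>carrier A. \<exists>s\<in>S. b \<otimes>\<^bsub>fr_ring\<^esub> fr_hom s = fr_hom x" using c by blast
next
  fix x assume "x \<in> carrier A"
  then show "fr_hom x = \<zero>\<^bsub>fr_ring\<^esub> \<longleftrightarrow> (\<exists>s\<in>S. s \<otimes> x \<in> I)"
    by (simp add: fr_hom_def fr_zero frac_eq_iff S fr_eq_def A.M.minus_eq)
qed

end

section \<open>Existence and universal property of rings of fractions\<close>

lemma fraction_map_exists:
  fixes A :: "('k, 'u) module"
  assumes "infinite (UNIV :: 'u set)" "A \<in> aff K"
    and "S \<subseteq> carrier A" "\<one>\<^bsub>A\<^esub> \<in> S" "\<And>s t. s \<in> S \<Longrightarrow> t \<in> S \<Longrightarrow> s \<otimes>\<^bsub>A\<^esub> t \<in> S" "ideal I A"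
  obtains B h where "B \<in> aff K" "fraction_map K A S I B h"
proof -
  obtain enc :: "'u \<times> 'u \<Rightarrow> 'u" where "inj enc" using infinite_square_inj assms(1) by blast
  then interpret fractions K A S I enc
    using assms(2-) by (simp add: fractions_def fractions_axioms_def aff_def)
  show thesis using that fr_ring_aff fr_hom by blast
qed

lemma (in ring) minus_eq_zero_iff:
  assumes "x \<in> carrier R" "y \<in> carrier R"
  shows "x \<ominus> y = \<zero> \<longleftrightarrow> x = y"
proof
  assume "x \<ominus> y = \<zero>"
  moreover have "x = (x \<ominus> y) \<oplus> y" using assms by (simp add: minus_eq a_assoc l_neg)
  ultimately show "x = y" using assms by simp
qed (use assms in \<open>simp add: minus_eq r_neg\<close>)

text \<open>If \<open>b\<close> times \<open>h s\<close> is \<open>h x\<close>, then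
  \<open>g b\<close> is forced to be \<open>f x\<close> divided by \<open>f s\<close>. Only the
  characterization \<open>fraction_map\<close> is used, not the construction, so the result holds
  for every localization or quotient that occurs.\<close>

lemma fraction_map_factor:
  assumes "A \<in> aff K" "B \<in> aff K" "C \<in> aff K" "S \<subseteq> carrier A" "\<And>s t. s \<in> S \<Longrightarrow> t \<in> S \<Longrightarrow> s \<otimes>\<^bsub>A\<^esub> t \<in> S"
    and h: "fraction_map K A S I B h" and f: "f \<in> alg_hom K A C"
    and fS: "\<And>s. s \<in> S \<Longrightarrow> f s \<in> Units C" and fI: "\<And>x. x \<in> I \<Longrightarrow> f x = \<zero>\<^bsub>C\<^esub>"
  obtains g where "g \<in> alg_hom K B C" "compose (carrier A) g h = f"
proof -
  interpret A: algebra K A using assms(1) by (simp add: aff_def)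
  interpret B: algebra K B using assms(2) by (simp add: aff_def)
  interpret C: algebra K C using assms(3) by (simp add: aff_def)
  have h': "h \<in> alg_hom K A B" and hS: "\<And>s. s \<in> S \<Longrightarrow> h s \<in> Units B"
    and hex: "\<And>b. b \<in> carrier B \<Longrightarrow> \<exists>x\<in>carrier A. \<exists>s\<in>S. b \<otimes>\<^bsub>B\<^esub> h s = h x"
    and h0: "\<And>x. x \<in> carrier A \<Longrightarrow> h x = \<zero>\<^bsub>B\<^esub> \<longleftrightarrow> (\<exists>s\<in>S. s \<otimes>\<^bsub>A\<^esub> x \<in> I)"
    using h by (auto simp: fraction_map_def)
  interpret h: ring_hom_cring A B h by (rule alg_hom_ring_hom_cring[OF assms(1,2) h'])
  interpret f: ring_hom_cring A C f by (rule alg_hom_ring_hom_cring[OF assms(1,3) f])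
  have Sc: "s \<in> carrier A" if "s \<in> S" for s using that assms(4) by blast
  have fSc: "f s \<in> carrier C" if "s \<in> S" for s using Sc that by simp
  have cancel: "c = d" if "s \<in> S" "c \<in> carrier C" "d \<in> carrier C" "c \<otimes>\<^bsub>C\<^esub> f s = d \<otimes>\<^bsub>C\<^esub> f s"
      for s c d
    using that C.Units_l_cancel[OF fS[OF that(1)] that(2,3)] fSc[OF that(1)] by (simp add: C.m_comm)
  have f0: "f x = \<zero>\<^bsub>C\<^esub>" if x: "x \<in> carrier A" "h x = \<zero>\<^bsub>B\<^esub>" for x
  proof -
    obtain s where s: "s \<in> S" "s \<otimes>\<^bsub>A\<^esub> x \<in> I" using h0 x by blast
    then have "f x \<otimes>\<^bsub>C\<^esub> f s = \<zero>\<^bsub>C\<^esub> \<otimes>\<^bsub>C\<^esub> f s" using fI[OF s(2)] x Sc[OF s(1)] by (simp add: C.m_comm)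
    then show ?thesis using cancel[OF s(1)] x by simp
  qed
  \<comment> \<open>Two ways of writing \<open>b\<close> as a fraction give the same value:
    \<open>h\<close> kills the difference of the cross products, hence so does \<open>f\<close>, and
    the image of \<open>s \<otimes> t\<close> can be cancelled.\<close>
  have wd: "c = d" if "b \<in> carrier B" "x \<in> carrier A" "y \<in> carrier A" "s \<in> S" "t \<in> S"
    "b \<otimes>\<^bsub>B\<^esub> h s = h x" "b \<otimes>\<^bsub>B\<^esub> h t = h y" "c \<in> carrier C" "d \<in> carrier C"
    "c \<otimes>\<^bsub>C\<^esub> f s = f x" "d \<otimes>\<^bsub>C\<^esub> f t = f y" for b x y s t c d
  proof -
    note cs = that(1-3,8,9) Sc[OF that(4)] Sc[OF that(5)]
    have "h (t \<otimes>\<^bsub>A\<^esub> x \<ominus>\<^bsub>A\<^esub> s \<otimes>\<^bsub>A\<^esub> y) = h t \<otimes>\<^bsub>B\<^esub> (b \<otimes>\<^bsub>B\<^esub> h s) \<ominus>\<^bsub>B\<^esub> h s \<otimes>\<^bsub>B\<^esub> (b \<otimes>\<^bsub>B\<^esub> h t)"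
      using cs that(6,7) by (simp add: A.minus_eq B.minus_eq)
    also have "\<dots> = \<zero>\<^bsub>B\<^esub>" using cs h.hom_closed[of s] h.hom_closed[of t] by algebra
    finally have "f (t \<otimes>\<^bsub>A\<^esub> x \<ominus>\<^bsub>A\<^esub> s \<otimes>\<^bsub>A\<^esub> y) = \<zero>\<^bsub>C\<^esub>" using f0 cs by simp
    then have "f t \<otimes>\<^bsub>C\<^esub> f x \<ominus>\<^bsub>C\<^esub> f s \<otimes>\<^bsub>C\<^esub> f y = \<zero>\<^bsub>C\<^esub>" using cs by (simp add: A.minus_eq C.minus_eq)
    then have "f t \<otimes>\<^bsub>C\<^esub> f x = f s \<otimes>\<^bsub>C\<^esub> f y" using cs by (simp add: C.minus_eq_zero_iff)
    then have "c \<otimes>\<^bsub>C\<^esub> f (s \<otimes>\<^bsub>A\<^esub> t) = d \<otimes>\<^bsub>C\<^esub> f (s \<otimes>\<^bsub>A\<^esub> t)"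
      using cs by (simp add: that(10,11)[symmetric] C.m_ac)
    then show ?thesis using cancel assms(5) cs that(4,5) by blast
  qed
  have ex: "\<exists>c. c \<in> carrier C \<and> (\<exists>x\<in>carrier A. \<exists>s\<in>S. b \<otimes>\<^bsub>B\<^esub> h s = h x \<and> c \<otimes>\<^bsub>C\<^esub> f s = f x)"
      if "b \<in> carrier B" for b
  proof -
    obtain x s where xs: "x \<in> carrier A" "s \<in> S" "b \<otimes>\<^bsub>B\<^esub> h s = h x" using hex \<open>b \<in> carrier B\<close>
        by blast
    have "f x \<otimes>\<^bsub>C\<^esub> inv\<^bsub>C\<^esub> f s \<otimes>\<^bsub>C\<^esub> f s = f x"
      using xs fS[OF xs(2)] fSc[OF xs(2)] by (simp add: C.m_assoc)
    moreover have "f x \<otimes>\<^bsub>C\<^esub> inv\<^bsub>C\<^esub> f s \<in> carrier C" using xs fS[OF xs(2)] by simp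
    ultimately show ?thesis using xs(1-3) by blast
  qed
  define g where "g = (\<lambda>b\<in>carrier B. SOME c. c \<in> carrier C \<and> (\<exists>x\<in>carrier A. \<exists>s\<in>S. b \<otimes>\<^bsub>B\<^esub> h s = h x \<and>
      c \<otimes>\<^bsub>C\<^esub> f s = f x))"
  have g: "g b \<in> carrier C \<and> (\<exists>x\<in>carrier A. \<exists>s\<in>S. b \<otimes>\<^bsub>B\<^esub> h s = h x \<and> g b \<otimes>\<^bsub>C\<^esub> f s = f x)"
      if "b \<in> carrier B" for b
    using someI_ex[OF ex[OF that]] that by (simp add: g_def)
  have gE: "\<exists>x s. x \<in> carrier A \<and> s \<in> S \<and> b \<otimes>\<^bsub>B\<^esub> h s = h x \<and> g b \<otimes>\<^bsub>C\<^esub> f s = f x \<and> g b \<in> carrier C \<and>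
      s \<in> carrier A"
    if "b \<in> carrier B" for b
    using g[OF that] Sc by blast
  have gI: "g b = c" if bc: "b \<in> carrier B" "x \<in> carrier A" "s \<in> S" "b \<otimes>\<^bsub>B\<^esub> h s = h x"
      "c \<in> carrier C" "c \<otimes>\<^bsub>C\<^esub> f s = f x" for b c x s
  proof -
    obtain y t where "y \<in> carrier A" "t \<in> S" "b \<otimes>\<^bsub>B\<^esub> h t = h y" "g b \<otimes>\<^bsub>C\<^esub> f t = f y"
        "g b \<in> carrier C"
      using gE[OF bc(1)] by blast
    then show ?thesis using wd[of b y x t s "g b" c] bc by simp
  qed
  have "g \<in> alg_hom K B C"
  proof (rule alg_homI)
    show "g b \<in> carrier C" if "b \<in> carrier B" for b using g that by simp
    show "g \<in> extensional (carrier B)" by (simp add: g_def)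
    \<comment> \<open>That \<open>S\<close> is nonempty is read off from writing
      \<open>\<one>\<close> as a fraction.\<close>
    obtain s where s: "s \<in> S" using hex[of "\<one>\<^bsub>B\<^esub>"] by auto
    show "g \<one>\<^bsub>B\<^esub> = \<one>\<^bsub>C\<^esub>" by (rule gI[of _ s s]) (use s Sc in auto)
  next
    fix b b' assume b: "b \<in> carrier B" "b' \<in> carrier B"
    obtain x s where 1: "x \<in> carrier A" "s \<in> S" "b \<otimes>\<^bsub>B\<^esub> h s = h x" "g b \<otimes>\<^bsub>C\<^esub> f s = f x"
        "g b \<in> carrier C" "s \<in> carrier A"
      using gE[OF b(1)] by blast
    obtain y t where 2: "y \<in> carrier A" "t \<in> S" "b' \<otimes>\<^bsub>B\<^esub> h t = h y" "g b' \<otimes>\<^bsub>C\<^esub> f t = f y"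
        "g b' \<in> carrier C" "t \<in> carrier A"
      using gE[OF b(2)] by blast
    have cl: "h s \<in> carrier B" "h t \<in> carrier B" "f s \<in> carrier C" "f t \<in> carrier C" using 1 2
        by auto
    have "(b \<otimes>\<^bsub>B\<^esub> b') \<otimes>\<^bsub>B\<^esub> (h s \<otimes>\<^bsub>B\<^esub> h t) = (b \<otimes>\<^bsub>B\<^esub> h s) \<otimes>\<^bsub>B\<^esub> (b' \<otimes>\<^bsub>B\<^esub> h t)"
      "(g b \<otimes>\<^bsub>C\<^esub> g b') \<otimes>\<^bsub>C\<^esub> (f s \<otimes>\<^bsub>C\<^esub> f t) = (g b \<otimes>\<^bsub>C\<^esub> f s) \<otimes>\<^bsub>C\<^esub> (g b' \<otimes>\<^bsub>C\<^esub> f t)"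
      using b 1(5) 2(5) cl by algebra+
    then show "g (b \<otimes>\<^bsub>B\<^esub> b') = g b \<otimes>\<^bsub>C\<^esub> g b'"
      by (intro gI[of _ "x \<otimes>\<^bsub>A\<^esub> y" "s \<otimes>\<^bsub>A\<^esub> t"]) (use b 1 2 assms(5) in auto)
    have "(b \<oplus>\<^bsub>B\<^esub> b') \<otimes>\<^bsub>B\<^esub> (h s \<otimes>\<^bsub>B\<^esub> h t) = h t \<otimes>\<^bsub>B\<^esub> (b \<otimes>\<^bsub>B\<^esub> h s) \<oplus>\<^bsub>B\<^esub> h s \<otimes>\<^bsub>B\<^esub> (b' \<otimes>\<^bsub>B\<^esub> h t)"
      "(g b \<oplus>\<^bsub>C\<^esub> g b') \<otimes>\<^bsub>C\<^esub> (f s \<otimes>\<^bsub>C\<^esub> f t) = f t \<otimes>\<^bsub>C\<^esub> (g b \<otimes>\<^bsub>C\<^esub> f s) \<oplus>\<^bsub>C\<^esub> f s \<otimes>\<^bsub>C\<^esub> (g b' \<otimes>\<^bsub>C\<^esub> f t)"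
      using b 1(5) 2(5) cl by algebra+
    then show "g (b \<oplus>\<^bsub>B\<^esub> b') = g b \<oplus>\<^bsub>C\<^esub> g b'"
      by (intro gI[of _ "t \<otimes>\<^bsub>A\<^esub> x \<oplus>\<^bsub>A\<^esub> s \<otimes>\<^bsub>A\<^esub> y" "s \<otimes>\<^bsub>A\<^esub> t"]) (use b 1 2 assms(5) in auto)
  next
    fix a b assume b: "a \<in> carrier K" "b \<in> carrier B"
    obtain x s where 1: "x \<in> carrier A" "s \<in> S" "b \<otimes>\<^bsub>B\<^esub> h s = h x" "g b \<otimes>\<^bsub>C\<^esub> f s = f x"
        "g b \<in> carrier C" "s \<in> carrier A"
      using gE[OF b(2)] by blast
    show "g (a \<odot>\<^bsub>B\<^esub> b) = a \<odot>\<^bsub>C\<^esub> g b"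
      by (rule gI[of _ "a \<odot>\<^bsub>A\<^esub> x" s])
        (use b 1 in \<open>auto simp: B.smult_assoc2 C.smult_assoc2 alg_hom_smult[OF h'] alg_hom_smult[OF
            f]\<close>)
  qed
  moreover have "compose (carrier A) g h = f"
  proof (rule extensionalityI[of _ "carrier A"])
    show "f \<in> extensional (carrier A)" using alg_hom_extensional[OF f] .
    fix x assume x: "x \<in> carrier A"
    obtain s where s: "s \<in> S" using hex[of "\<one>\<^bsub>B\<^esub>"] by auto
    \<comment> \<open>The element \<open>h x\<close> is presented with numerator
      \<open>x \<otimes> s\<close> and denominator \<open>s\<close>.\<close>
    have "g (h x) = f x" by (rule gI[of _ "x \<otimes>\<^bsub>A\<^esub> s" s]) (use s Sc x in auto)
    then show "compose (carrier A) g h x = f x" using x by (simp add: compose_def)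
  qed simp
  ultimately show thesis using that by blast
qed

text \<open>Each \<open>b\<close> satisfies an equation \<open>b\<close> times \<open>h s\<close>
  equals \<open>h x\<close> with data from \<open>A\<close>, on which \<open>g\<close> and
  \<open>g'\<close> agree, and the image of \<open>h s\<close> is a unit.\<close>

lemma fraction_map_epi:
  assumes "A \<in> aff K" "B \<in> aff K" "C \<in> aff K" "S \<subseteq> carrier A"
    and h: "fraction_map K A S I B h" and g: "g \<in> alg_hom K B C" "g' \<in> alg_hom K B C"
    and eq: "compose (carrier A) g h = compose (carrier A) g' h"
  shows "g = g'"
proof (rule alg_hom_eqI[OF g])
  interpret C: algebra K C using assms(3) by (simp add: aff_def)
  have h': "h \<in> alg_hom K A B" using h by (simp add: fraction_map_def)
  have eq': "g (h x) = g' (h x)" if "x \<in> carrier A" for x using eq that by (metis compose_eq)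
  fix b assume b: "b \<in> carrier B"
  then obtain x s where xs: "x \<in> carrier A" "s \<in> S" "b \<otimes>\<^bsub>B\<^esub> h s = h x" "h s \<in> Units B"
    using h by (auto simp: fraction_map_def)
  have s: "s \<in> carrier A" "h s \<in> carrier B" using xs assms(4) alg_hom_closed[OF h'] by auto
  have gs: "g (h s) \<in> Units C" by (rule alg_hom_Units[OF assms(2,3) g(1) xs(4)])
  have "g b \<otimes>\<^bsub>C\<^esub> g (h s) = g' b \<otimes>\<^bsub>C\<^esub> g (h s)"
    using eq' s(1) xs(1) alg_hom_mult[OF g(1) b s(2)] alg_hom_mult[OF g(2) b s(2)] xs(3) by simp
  then show "g b = g' b"
    using C.Units_l_cancel[OF gs] b s(2) alg_hom_closed[OF g(1)] alg_hom_closed[OF g(2)]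
        by (simp add: C.m_comm)
qed

section \<open>Localization at one element\<close>

lemma (in monoid) Units_pow: "x \<in> Units G \<Longrightarrow> x [^] (n::nat) \<in> Units G"
  by (induction n) auto

text \<open>\<open>fraction_map\<close> asks that all powers of \<open>a\<close> become units and
  describes the kernel by an equivalence. Both follow from the invertibility of \<open>h a\<close>,
  as a power of \<open>h a\<close> can be cancelled.\<close>

lemma localization_map_iff:
  assumes "A \<in> aff K" "B \<in> aff K" "a \<in> carrier A"
  shows "localization_map K A a B h \<longleftrightarrow> fraction_map K A (range (\<lambda>n::nat. a [^]\<^bsub>A\<^esub> n)) {\<zero>\<^bsub>A\<^esub>} B h"
proof (cases "h \<in> alg_hom K A B")
  case h: True
  interpret A: algebra K A using assms(1) by (simp add: aff_def)
  interpret B: algebra K B using assms(2) by (simp add: aff_def)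
  interpret h: ring_hom_cring A B h by (rule alg_hom_ring_hom_cring[OF assms(1,2) h])
  have pow: "h (a [^]\<^bsub>A\<^esub> n) = h a [^]\<^bsub>B\<^esub> n" for n :: nat
      by (rule alg_hom_pow[OF assms(1,2) h assms(3)])
  have U: "h a \<in> Units B \<longleftrightarrow> (\<forall>n::nat. h a [^]\<^bsub>B\<^esub> n \<in> Units B)"
  proof
    assume "\<forall>n::nat. h a [^]\<^bsub>B\<^esub> n \<in> Units B"
    then have "h a [^]\<^bsub>B\<^esub> (1::nat) \<in> Units B" ..
    then show "h a \<in> Units B" using assms(3) by simp
  qed (simp add: B.Units_pow)
  have Z: "h x = \<zero>\<^bsub>B\<^esub>" if U: "h a \<in> Units B" and x: "x \<in> carrier A" "a [^]\<^bsub>A\<^esub> n \<otimes>\<^bsub>A\<^esub> x = \<zero>\<^bsub>A\<^esub>" for x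
      and n :: nat
  proof -
    have "h a [^]\<^bsub>B\<^esub> n \<otimes>\<^bsub>B\<^esub> h x = h a [^]\<^bsub>B\<^esub> n \<otimes>\<^bsub>B\<^esub> \<zero>\<^bsub>B\<^esub>"
      using x assms(3) pow[of n]
          by (metis A.nat_pow_closed B.r_null h.hom_closed h.hom_mult h.hom_zero)
    then show ?thesis using B.Units_l_cancel[OF B.Units_pow[OF U]] x by simp
  qed
  show ?thesis
    unfolding localization_map_def fraction_map_def
    using U Z h by (auto simp: pow)
qed (auto simp: localization_map_def fraction_map_def)

lemma range_pow:
  assumes "A \<in> aff K" "a \<in> carrier A"
  shows "range (\<lambda>n::nat. a [^]\<^bsub>A\<^esub> n) \<subseteq> carrier A"
    and "\<And>s t. s \<in> range (\<lambda>n::nat. a [^]\<^bsub>A\<^esub> n) \<Longrightarrow> t \<in> range (\<lambda>n::nat. a [^]\<^bsub>A\<^esub> n) \<Longrightarrow>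
        s \<otimes>\<^bsub>A\<^esub> t \<in> range (\<lambda>n::nat. a [^]\<^bsub>A\<^esub> n)"
    and "\<one>\<^bsub>A\<^esub> \<in> range (\<lambda>n::nat. a [^]\<^bsub>A\<^esub> n)"
proof -
  interpret A: algebra K A using assms(1) by (simp add: aff_def)
  show "range (\<lambda>n::nat. a [^]\<^bsub>A\<^esub> n) \<subseteq> carrier A" using assms by auto
  show "\<one>\<^bsub>A\<^esub> \<in> range (\<lambda>n::nat. a [^]\<^bsub>A\<^esub> n)" using A.nat_pow_0 by (metis rangeI)
  fix s t assume "s \<in> range (\<lambda>n::nat. a [^]\<^bsub>A\<^esub> n)" "t \<in> range (\<lambda>n::nat. a [^]\<^bsub>A\<^esub> n)"
  then show "s \<otimes>\<^bsub>A\<^esub> t \<in> range (\<lambda>n::nat. a [^]\<^bsub>A\<^esub> n)" using assms by (auto simp: A.nat_pow_mult)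
qed

lemma localization_map_hom: "localization_map K A a B h \<Longrightarrow> h \<in> alg_hom K A B"
  by (simp add: localization_map_def)

lemma localization_map_Units: "localization_map K A a B h \<Longrightarrow> h a \<in> Units B"
  by (simp add: localization_map_def)

lemma localization_exists:
  fixes A :: "('k, 'u) module"
  assumes "infinite (UNIV :: 'u set)" "A \<in> aff K" "a \<in> carrier A"
  obtains B h where "B \<in> aff K" "localization_map K A a B h"
proof -
  obtain B h where "B \<in> aff K" "fraction_map K A (range (\<lambda>n::nat. a [^]\<^bsub>A\<^esub> n)) {\<zero>\<^bsub>A\<^esub>} B h"
    using fraction_map_exists[OF assms(1,2) range_pow(1,3,2)[OF assms(2,3)] ring.zeroideal[OF
        aff_ring[OF assms(2)]]] by blast
  then show thesis using that localization_map_iff[OF assms(2) _ assms(3)] by blast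
qed

lemma localization_factor:
  assumes "A \<in> aff K" "B \<in> aff K" "C \<in> aff K" "a \<in> carrier A" "localization_map K A a B h"
    and "f \<in> alg_hom K A C" "f a \<in> Units C"
  obtains g where "g \<in> alg_hom K B C" "compose (carrier A) g h = f"
proof -
  interpret C: algebra K C using assms(3) by (simp add: aff_def)
  have "f s \<in> Units C" if "s \<in> range (\<lambda>n::nat. a [^]\<^bsub>A\<^esub> n)" for s
    using that C.Units_pow[OF assms(7)] alg_hom_pow[OF assms(1,3,6,4)] by auto
  then show thesis
    using fraction_map_factor[OF assms(1-3) range_pow(1,2)[OF assms(1,4)] assms(5)[unfolded
        localization_map_iff[OF assms(1,2,4)]] assms(6)]
      alg_hom_zero[OF assms(1,3,6)] that by blast
qed

lemma localization_zero_iff: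
  assumes "A \<in> aff K" "B \<in> aff K" "a \<in> carrier A" "localization_map K A a B h" "x \<in> carrier A"
  shows "h x = \<zero>\<^bsub>B\<^esub> \<longleftrightarrow> (\<exists>n::nat. a [^]\<^bsub>A\<^esub> n \<otimes>\<^bsub>A\<^esub> x = \<zero>\<^bsub>A\<^esub>)"
  using assms(4,5) unfolding localization_map_iff[OF assms(1-3)] fraction_map_def by auto

lemma localization_elem:
  assumes "localization_map K A a B h" "b \<in> carrier B"
  obtains x and n :: nat where "x \<in> carrier A" "b \<otimes>\<^bsub>B\<^esub> (h a [^]\<^bsub>B\<^esub> n) = h x"
  using assms by (auto simp: localization_map_def)

text \<open>The denominator goes to a unit, so vanishing is a matter of the numerator. This moves
  kernels between a basic open and \<open>Spec A\<close>, where their elements can be compared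
  across charts.\<close>

lemma localization_numerator_zero:
  assumes "A \<in> aff K" "B \<in> aff K" "C \<in> aff K" "a \<in> carrier A" "localization_map K A a B h"
      "g \<in> alg_hom K B C"
    "b \<in> carrier B" "x \<in> carrier A" "b \<otimes>\<^bsub>B\<^esub> (h a [^]\<^bsub>B\<^esub> (n::nat)) = h x"
  shows "g b = \<zero>\<^bsub>C\<^esub> \<longleftrightarrow> g (h x) = \<zero>\<^bsub>C\<^esub>"
proof -
  interpret B: algebra K B using assms(2) by (simp add: aff_def)
  interpret C: algebra K C using assms(3) by (simp add: aff_def)
  interpret g: ring_hom_cring B C g by (rule alg_hom_ring_hom_cring[OF assms(2,3,6)])
  have ha: "h a \<in> Units B" "h a [^]\<^bsub>B\<^esub> n \<in> Units B"
    using localization_map_Units[OF assms(5)] B.Units_pow by auto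
  have u: "g (h a [^]\<^bsub>B\<^esub> n) \<in> Units C" by (rule alg_hom_Units[OF assms(2,3,6) ha(2)])
  have c: "h a [^]\<^bsub>B\<^esub> n \<in> carrier B" "g b \<in> carrier C" "g (h a [^]\<^bsub>B\<^esub> n) \<in> carrier C"
      using ha(2) assms(7) by auto
  have "g (h x) = g (b \<otimes>\<^bsub>B\<^esub> (h a [^]\<^bsub>B\<^esub> n))" using assms(9) by simp
  also have "\<dots> = g (h a [^]\<^bsub>B\<^esub> n) \<otimes>\<^bsub>C\<^esub> g b" using g.hom_mult[OF assms(7) c(1)] c
      by (simp add: C.m_comm)
  finally have "g (h x) = g (h a [^]\<^bsub>B\<^esub> n) \<otimes>\<^bsub>C\<^esub> g b" .
  then show ?thesis using C.Units_l_cancel[OF u c(2), of "\<zero>\<^bsub>C\<^esub>"] c by simp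
qed

text \<open>The quotient \<open>A \<rightarrow> A/I\<close>, with carrier in the type of \<open>A\<close>.\<close>

definition quotient_map ::
    "'k ring \<Rightarrow> ('k, 'u) module \<Rightarrow> 'u set \<Rightarrow> ('k, 'u) module \<Rightarrow> ('u \<Rightarrow> 'u) \<Rightarrow> bool" where
  "quotient_map K A I B q \<longleftrightarrow> q \<in> alg_hom K A B \<and> q ` carrier A = carrier B \<and>
     (\<forall>x\<in>carrier A. q x = \<zero>\<^bsub>B\<^esub> \<longleftrightarrow> x \<in> I)"

text \<open>With \<open>\<one>\<close> as the only denominator the fraction condition is
  surjectivity; existence, factorization and cancellation for quotients are thus inherited from
  fractions.\<close>

lemma quotient_map_iff:
  assumes "A \<in> aff K" "B \<in> aff K"
  shows "quotient_map K A I B q \<longleftrightarrow> fraction_map K A {\<one>\<^bsub>A\<^esub>} I B q"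
proof (cases "q \<in> alg_hom K A B")
  case q: True
  interpret A: algebra K A using assms(1) by (simp add: aff_def)
  interpret B: algebra K B using assms(2) by (simp add: aff_def)
  interpret q: ring_hom_cring A B q by (rule alg_hom_ring_hom_cring[OF assms(1,2) q])
  show ?thesis unfolding quotient_map_def fraction_map_def by (auto simp: q)
qed (auto simp: quotient_map_def fraction_map_def)

lemma quotient_map_hom: "quotient_map K A I B q \<Longrightarrow> q \<in> alg_hom K A B"
  by (simp add: quotient_map_def)

lemma quotient_map_surj: "quotient_map K A I B q \<Longrightarrow> q ` carrier A = carrier B"
  by (simp add: quotient_map_def)

lemma quotient_map_zero: "quotient_map K A I B q \<Longrightarrow> x \<in> carrier A \<Longrightarrow> q x = \<zero>\<^bsub>B\<^esub> \<longleftrightarrow> x \<in> I"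
  by (simp add: quotient_map_def)

lemma quotient_exists:
  fixes A :: "('k, 'u) module"
  assumes "infinite (UNIV :: 'u set)" "A \<in> aff K" "ideal I A"
  obtains B q where "B \<in> aff K" "quotient_map K A I B q"
proof -
  interpret A: algebra K A using assms(2) by (simp add: aff_def)
  obtain B q where "B \<in> aff K" "fraction_map K A {\<one>\<^bsub>A\<^esub>} I B q"
    using fraction_map_exists[OF assms(1,2) _ _ _ assms(3), of "{\<one>\<^bsub>A\<^esub>}"] by auto
  then show thesis using that quotient_map_iff[OF assms(2)] by blast
qed

lemma quotient_factor:
  assumes "A \<in> aff K" "B \<in> aff K" "C \<in> aff K" "quotient_map K A I B q"
    and "f \<in> alg_hom K A C" "\<And>x. x \<in> I \<Longrightarrow> f x = \<zero>\<^bsub>C\<^esub>"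
  obtains g where "g \<in> alg_hom K B C" "compose (carrier A) g q = f"
proof -
  interpret A: algebra K A using assms(1) by (simp add: aff_def)
  interpret C: algebra K C using assms(3) by (simp add: aff_def)
  show thesis
    using fraction_map_factor[OF assms(1-3) _ _ assms(4)[unfolded quotient_map_iff[OF assms(1,2)]]
        assms(5)]
      assms(6) that by (auto simp: alg_hom_one[OF assms(5)])
qed

lemma quotient_epi:
  assumes "A \<in> aff K" "B \<in> aff K" "C \<in> aff K" "quotient_map K A I B q"
    and "g \<in> alg_hom K B C" "g' \<in> alg_hom K B C"
        "compose (carrier A) g q = compose (carrier A) g' q"
  shows "g = g'"
proof -
  interpret A: algebra K A using assms(1) by (simp add: aff_def)
  show ?thesis
    by (rule fraction_map_epi[OF assms(1-3) _ assms(4)[unfolded quotient_map_iff[OF assms(1,2)]]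
        assms(5-7)]) simp
qed


subsection \<open>Reduced algebras\<close>

definition radical_ideal :: "'u set \<Rightarrow> ('k, 'u) module \<Rightarrow> bool" where
  "radical_ideal J A \<longleftrightarrow> ideal J A \<and> (\<forall>x\<in>carrier A. \<forall>n::nat. x [^]\<^bsub>A\<^esub> n \<in> J \<longrightarrow> x \<in> J)"

text \<open>The least radical ideal, that is, the nilradical; the set of nilpotent elements would need the
  binomial theorem to be shown an ideal.\<close>

definition nilradical :: "('k, 'u) module \<Rightarrow> 'u set" where
  "nilradical A = \<Inter>{J. radical_ideal J A}"

lemma radical_ideal_carrier: "A \<in> aff K \<Longrightarrow> radical_ideal (carrier A) A"
  by (simp add: radical_ideal_def ring.oneideal aff_ring)

lemma nilradical_ideal: "A \<in> aff K \<Longrightarrow> ideal (nilradical A) A"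
  unfolding nilradical_def
  by (rule ring.i_Intersect[OF aff_ring]) (use radical_ideal_carrier in \<open>auto simp:
      radical_ideal_def\<close>)

lemma nilradical_sub: "A \<in> aff K \<Longrightarrow> nilradical A \<subseteq> carrier A"
  using nilradical_ideal ideal_sub by blast

lemma nilradical_pow:
  "x \<in> carrier A \<Longrightarrow> x [^]\<^bsub>A\<^esub> (n::nat) \<in> nilradical A \<Longrightarrow> x \<in> nilradical A"
  by (auto simp: nilradical_def radical_ideal_def)

text \<open>The kernel of a homomorphism to a reduced ring is a radical ideal, and the nilradical is
  contained in each of these.\<close>

lemma reduced_kills_nilradical:
  assumes "A \<in> aff K" "B \<in> aff K" "f \<in> alg_hom K A B" "reduced_ring B" "x \<in> nilradical A"
  shows "f x = \<zero>\<^bsub>B\<^esub>"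
proof -
  have "radical_ideal {x \<in> carrier A. f x = \<zero>\<^bsub>B\<^esub>} A"
    unfolding radical_ideal_def using kernel_ideal[OF assms(1-3)] assms(4)
    by (auto simp: alg_hom_pow[OF assms(1-3)] reduced_ring_def alg_hom_closed[OF assms(3)])
  then show ?thesis using assms(5) by (auto simp: nilradical_def)
qed

lemma reduced_quotient:
  assumes "A \<in> aff K" "B \<in> aff K" "quotient_map K A (nilradical A) B q"
  shows "reduced_ring B"
  unfolding reduced_ring_def
proof (intro ballI allI impI)
  note q = quotient_map_hom[OF assms(3)]
  interpret A: algebra K A using assms(1) by (simp add: aff_def)
  fix b and n :: nat assume b: "b \<in> carrier B" "b [^]\<^bsub>B\<^esub> n = \<zero>\<^bsub>B\<^esub>"
  then obtain x where x: "x \<in> carrier A" "b = q x" using quotient_map_surj[OF assms(3)] by blast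
  then have "x [^]\<^bsub>A\<^esub> n \<in> nilradical A"
    using b(2) quotient_map_zero[OF assms(3), of "x [^]\<^bsub>A\<^esub> n"]
        by (simp add: alg_hom_pow[OF assms(1,2) q])
  then have "x \<in> nilradical A" by (rule nilradical_pow[OF x(1)])
  then show "b = \<zero>\<^bsub>B\<^esub>" using x(2) quotient_map_zero[OF assms(3) x(1)] by simp
qed

text \<open>If a fraction with numerator \<open>x\<close> is nilpotent, then some power of
  \<open>a\<close> kills a power of \<open>x\<close>. The product of that power of \<open>a\<close>
  with \<open>x\<close> is then nilpotent in \<open>A\<close>, hence zero.\<close>

lemma reduced_localization:
  assumes "A \<in> aff K" "B \<in> aff K" "a \<in> carrier A" "localization_map K A a B h" "reduced_ring A"
  shows "reduced_ring B"
  unfolding reduced_ring_def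
proof (intro ballI allI impI)
  interpret A: algebra K A using assms(1) by (simp add: aff_def)
  interpret B: algebra K B using assms(2) by (simp add: aff_def)
  note h = localization_map_hom[OF assms(4)]
  interpret h: ring_hom_cring A B h by (rule alg_hom_ring_hom_cring[OF assms(1,2) h])
  fix b and n :: nat assume b: "b \<in> carrier B" "b [^]\<^bsub>B\<^esub> n = \<zero>\<^bsub>B\<^esub>"
  obtain x and m :: nat where x: "x \<in> carrier A" "b \<otimes>\<^bsub>B\<^esub> (h a [^]\<^bsub>B\<^esub> m) = h x"
    using localization_elem[OF assms(4) b(1)] .
  have "h (x [^]\<^bsub>A\<^esub> n) = (b \<otimes>\<^bsub>B\<^esub> (h a [^]\<^bsub>B\<^esub> m)) [^]\<^bsub>B\<^esub> n"
    by (simp add: alg_hom_pow[OF assms(1,2) h x(1)] x(2))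
  also have "\<dots> = \<zero>\<^bsub>B\<^esub>" using b assms(3) by (simp add: B.nat_pow_distrib)
  finally obtain N :: nat where N: "a [^]\<^bsub>A\<^esub> N \<otimes>\<^bsub>A\<^esub> x [^]\<^bsub>A\<^esub> n = \<zero>\<^bsub>A\<^esub>"
    using localization_zero_iff[OF assms(1-4), of "x [^]\<^bsub>A\<^esub> n"] x(1) by auto
  have "a [^]\<^bsub>A\<^esub> N \<otimes>\<^bsub>A\<^esub> x = \<zero>\<^bsub>A\<^esub>"
  proof (cases n)
    case 0
    \<comment> \<open>For exponent zero the hypothesis says that \<open>B\<close> is the zero ring,
      and a power of \<open>a\<close> vanishes already.\<close>
    then have "a [^]\<^bsub>A\<^esub> N = \<zero>\<^bsub>A\<^esub>" using N assms(3) by simp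
    then show ?thesis using x by simp
  next
    case (Suc k)
    have "(a [^]\<^bsub>A\<^esub> N \<otimes>\<^bsub>A\<^esub> x) [^]\<^bsub>A\<^esub> n = (a [^]\<^bsub>A\<^esub> N) [^]\<^bsub>A\<^esub> k \<otimes>\<^bsub>A\<^esub> (a [^]\<^bsub>A\<^esub> N \<otimes>\<^bsub>A\<^esub> x [^]\<^bsub>A\<^esub> n)"
      using assms(3) x(1) by (simp add: A.nat_pow_distrib Suc A.m_ac)
    then have "(a [^]\<^bsub>A\<^esub> N \<otimes>\<^bsub>A\<^esub> x) [^]\<^bsub>A\<^esub> n = \<zero>\<^bsub>A\<^esub>" using N assms(3) by simp
    moreover have "a [^]\<^bsub>A\<^esub> N \<otimes>\<^bsub>A\<^esub> x \<in> carrier A" using assms(3) x(1) by simp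
    ultimately show ?thesis using assms(5) unfolding reduced_ring_def by blast
  qed
  then have "h x = \<zero>\<^bsub>B\<^esub>" using localization_zero_iff[OF assms(1-4) x(1)] by blast
  then have "b \<otimes>\<^bsub>B\<^esub> (h a [^]\<^bsub>B\<^esub> m) = \<zero>\<^bsub>B\<^esub>" using x(2) by simp
  then have "h a [^]\<^bsub>B\<^esub> m \<otimes>\<^bsub>B\<^esub> b = h a [^]\<^bsub>B\<^esub> m \<otimes>\<^bsub>B\<^esub> \<zero>\<^bsub>B\<^esub>"
    using b assms(3) by (simp add: B.m_comm)
  then show "b = \<zero>\<^bsub>B\<^esub>"
    using B.Units_l_cancel[OF B.Units_pow[OF localization_map_Units[OF assms(4)]] b(1), of "\<zero>\<^bsub>B\<^esub>" m]
        by simp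
qed


subsection \<open>Zariski descent\<close>

text \<open>The annihilator of \<open>y\<close> is an ideal containing a power of each
  \<open>a\<close> in the cover, so it contains \<open>\<one>\<close>.\<close>

lemma localization_separated:
  assumes "A \<in> aff K" "y \<in> carrier A" "S \<subseteq> carrier A" "Idl\<^bsub>A\<^esub> S = carrier A"
    and "\<And>a. a \<in> S \<Longrightarrow> \<exists>B\<in>aff K. \<exists>h. localization_map K A a B h \<and> h y = \<zero>\<^bsub>B\<^esub>"
  shows "y = \<zero>\<^bsub>A\<^esub>"
proof -
  interpret A: algebra K A using assms(1) by (simp add: aff_def)
  have id: "ideal {r \<in> carrier A. r \<otimes>\<^bsub>A\<^esub> y = \<zero>\<^bsub>A\<^esub>} A"
    by (rule cring_idealI) (use assms(2) in \<open>auto simp: A.cring_axioms A.l_distr A.m_assoc\<close>)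
  have "{r \<in> carrier A. r \<otimes>\<^bsub>A\<^esub> y = \<zero>\<^bsub>A\<^esub>} = carrier A"
  proof (rule ideal_UNIV_of_powers[OF assms(1) id assms(3,4)])
    fix a assume a: "a \<in> S"
    then have ac: "a \<in> carrier A" using assms(3) by blast
    obtain B h where "B \<in> aff K" "localization_map K A a B h" "h y = \<zero>\<^bsub>B\<^esub>" using assms(5)[OF a]
        by blast
    then show "\<exists>n::nat. a [^]\<^bsub>A\<^esub> n \<in> {r \<in> carrier A. r \<otimes>\<^bsub>A\<^esub> y = \<zero>\<^bsub>A\<^esub>}"
      using localization_zero_iff[OF assms(1) _ ac _ assms(2)] ac by auto
  qed
  from equalityD2[OF this] A.one_closed have "\<one>\<^bsub>A\<^esub> \<in> {r \<in> carrier A. r \<otimes>\<^bsub>A\<^esub> y = \<zero>\<^bsub>A\<^esub>}"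
    by (rule subsetD)
  then have "\<one>\<^bsub>A\<^esub> \<otimes>\<^bsub>A\<^esub> y = \<zero>\<^bsub>A\<^esub>" by simp
  then show ?thesis using assms(2) by simp
qed


text \<open>Call \<open>r\<close> good if the family of the products of \<open>h a r\<close> and
  \<open>y a\<close> comes from an element of \<open>A\<close>. Good elements form an ideal, and a
  power of each \<open>b\<close> in \<open>T\<close> is good because \<open>y b\<close> is a
  fraction with denominator a power of \<open>b\<close>. Hence \<open>\<one>\<close> is
  good.\<close>

lemma localization_descent:
  fixes A :: "('k, 'u) module"
  assumes inf: "infinite (UNIV :: 'u set)" and A: "A \<in> aff K" and T: "finite T" "T \<subseteq> carrier A"
      "Idl\<^bsub>A\<^esub> T = carrier A"
    and loc: "\<And>a. a \<in> T \<Longrightarrow> B a \<in> aff K" "\<And>a. a \<in> T \<Longrightarrow> localization_map K A a (B a) (h a)"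
    and y: "\<And>a. a \<in> T \<Longrightarrow> y a \<in> carrier (B a)"
    and compat: "\<And>a b C p q. a \<in> T \<Longrightarrow> b \<in> T \<Longrightarrow> C \<in> aff K \<Longrightarrow> p \<in> alg_hom K (B a) C \<Longrightarrow>
        q \<in> alg_hom K (B b) C \<Longrightarrow>
      compose (carrier A) p (h a) = compose (carrier A) q (h b) \<Longrightarrow> p (y a) = q (y b)"
  obtains x where "x \<in> carrier A" "\<And>a. a \<in> T \<Longrightarrow> h a x = y a"
proof -
  interpret A: algebra K A using A by (simp add: aff_def)
  let ?J = "{r \<in> carrier A. \<exists>x\<in>carrier A. \<forall>a\<in>T. h a x = h a r \<otimes>\<^bsub>B a\<^esub> y a}"
  have Tc: "a \<in> carrier A" if "a \<in> T" for a using that T(2) by blast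
  have hom: "ring_hom_cring A (B a) (h a)" if "a \<in> T" for a
    by (rule alg_hom_ring_hom_cring[OF A loc(1)[OF that] localization_map_hom[OF loc(2)[OF that]]])
  have id: "ideal ?J A"
  proof (rule cring_idealI[OF A.cring_axioms])
    have "h a \<zero>\<^bsub>A\<^esub> = h a \<zero>\<^bsub>A\<^esub> \<otimes>\<^bsub>B a\<^esub> y a" if "a \<in> T" for a
    proof -
      interpret ring_hom_cring A "B a" "h a" by (rule hom[OF that])
      show ?thesis using y[OF that] by simp
    qed
    then show "\<zero>\<^bsub>A\<^esub> \<in> ?J" by auto
    fix r s assume "r \<in> ?J" "s \<in> ?J"
    then obtain x z where xz: "x \<in> carrier A" "z \<in> carrier A" "r \<in> carrier A" "s \<in> carrier A"
      "\<And>a. a \<in> T \<Longrightarrow> h a x = h a r \<otimes>\<^bsub>B a\<^esub> y a" "\<And>a. a \<in> T \<Longrightarrow> h a z = h a s \<otimes>\<^bsub>B a\<^esub> y a" by blast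
    have "h a (x \<oplus>\<^bsub>A\<^esub> z) = h a (r \<oplus>\<^bsub>A\<^esub> s) \<otimes>\<^bsub>B a\<^esub> y a" if "a \<in> T" for a
    proof -
      interpret ring_hom_cring A "B a" "h a" by (rule hom[OF that])
      show ?thesis using y[OF that] xz that by (simp add: S.l_distr)
    qed
    then show "r \<oplus>\<^bsub>A\<^esub> s \<in> ?J" using xz(1-4) by (auto intro!: bexI[of _ "x \<oplus>\<^bsub>A\<^esub> z"])
  next
    fix r s assume r: "r \<in> carrier A" and "s \<in> ?J"
    then obtain z where xz: "z \<in> carrier A" "s \<in> carrier A" "\<And>a. a \<in> T \<Longrightarrow> h a z = h a s \<otimes>\<^bsub>B a\<^esub> y a"
        by blast
    have "h a (r \<otimes>\<^bsub>A\<^esub> z) = h a (r \<otimes>\<^bsub>A\<^esub> s) \<otimes>\<^bsub>B a\<^esub> y a" if "a \<in> T" for a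
    proof -
      interpret ring_hom_cring A "B a" "h a" by (rule hom[OF that])
      show ?thesis using y[OF that] xz r that by (simp add: S.m_assoc)
    qed
    then show "r \<otimes>\<^bsub>A\<^esub> s \<in> ?J" using xz(1,2) r by (auto intro!: bexI[of _ "r \<otimes>\<^bsub>A\<^esub> z"])
  qed auto
  have "?J = carrier A"
  proof (rule ideal_UNIV_of_powers[OF A id T(2,3)])
    fix b assume b: "b \<in> T"
    interpret b: ring_hom_cring A "B b" "h b" by (rule hom[OF b])
    obtain x n where x: "x \<in> carrier A" "y b \<otimes>\<^bsub>B b\<^esub> (h b b [^]\<^bsub>B b\<^esub> (n::nat)) = h b x"
      using localization_elem[OF loc(2)[OF b] y[OF b]] .
    have hb: "h c (b [^]\<^bsub>A\<^esub> n) = h c b [^]\<^bsub>B c\<^esub> n" if "c \<in> T" for c and n :: nat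
      by (rule alg_hom_pow[OF A loc(1)[OF that] localization_map_hom[OF loc(2)[OF that]] Tc[OF b]])
    \<comment> \<open>Every large exponent is allowed, so that one exponent can later serve all of
      the finitely many \<open>a\<close>.\<close>
    have "\<exists>N. \<forall>M\<ge>N. h a (b [^]\<^bsub>A\<^esub> M \<otimes>\<^bsub>A\<^esub> x) = h a (b [^]\<^bsub>A\<^esub> (M + n)) \<otimes>\<^bsub>B a\<^esub> y a" if a: "a \<in> T" for a
    proof -
      interpret a: ring_hom_cring A "B a" "h a" by (rule hom[OF a])
      have hab: "h a b \<in> carrier (B a)" using Tc[OF b] by simp
      \<comment> \<open>\<open>Spec C\<close> is the overlap of \<open>D(a)\<close> and
        \<open>D(b)\<close>. Agreement there turns into agreement on \<open>D(a)\<close> after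
        multiplication by a power of \<open>b\<close>.\<close>
      obtain C p where C: "C \<in> aff K" "localization_map K (B a) (h a b) C p"
        using localization_exists[OF inf loc(1)[OF a] hab] .
      note p = localization_map_hom[OF C(2)]
      note ha = localization_map_hom[OF loc(2)[OF a]]
      have "compose (carrier A) p (h a) b \<in> Units C"
        using localization_map_Units[OF C(2)] Tc[OF b] by (simp add: compose_def)
      then obtain q where q: "q \<in> alg_hom K (B b) C" "compose (carrier A) q (h b) =
          compose (carrier A) p (h a)"
        using localization_factor[OF A loc(1)[OF b] C(1) Tc[OF b] loc(2)[OF b] alg_hom_comp[OF A ha
            p]] by blast
      interpret p: ring_hom_cring "B a" C p by (rule alg_hom_ring_hom_cring[OF loc(1)[OF a] C(1) p])
      interpret q: ring_hom_cring "B b" C q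
          by (rule alg_hom_ring_hom_cring[OF loc(1)[OF b] C(1) q(1)])
      have pq: "p (h a z) = q (h b z)" if "z \<in> carrier A" for z
        using q(2) that by (metis compose_eq)
      have bn: "h a b [^]\<^bsub>B a\<^esub> n \<in> carrier (B a)" "h b b [^]\<^bsub>B b\<^esub> n \<in> carrier (B b)"
          using hab Tc[OF b] by auto
      have "p (h a x) = q (y b) \<otimes>\<^bsub>C\<^esub> q (h b b [^]\<^bsub>B b\<^esub> n)"
        using pq[OF x(1)] x(2) q.hom_mult[OF y[OF b] bn(2)] by simp
      also have "q (h b b [^]\<^bsub>B b\<^esub> n) = p (h a b [^]\<^bsub>B a\<^esub> n)"
        using pq[of "b [^]\<^bsub>A\<^esub> n"] Tc[OF b] by (simp add: hb a b)
      also have "q (y b) = p (y a)" using compat[OF a b C(1) p q(1) q(2)[symmetric]] by simp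
      also have "p (y a) \<otimes>\<^bsub>C\<^esub> p (h a b [^]\<^bsub>B a\<^esub> n) = p (h a b [^]\<^bsub>B a\<^esub> n \<otimes>\<^bsub>B a\<^esub> y a)"
        using bn y[OF a] by (simp add: p.S.m_comm)
      finally have "p (h a x \<ominus>\<^bsub>B a\<^esub> h a b [^]\<^bsub>B a\<^esub> n \<otimes>\<^bsub>B a\<^esub> y a) = \<zero>\<^bsub>C\<^esub>"
        using x(1) bn y[OF a]
            by (simp add: alg_hom_minus[OF loc(1)[OF a] C(1) p] p.S.minus_eq_zero_iff)
      then obtain N :: nat
          where N: "h a b [^]\<^bsub>B a\<^esub> N \<otimes>\<^bsub>B a\<^esub> (h a x \<ominus>\<^bsub>B a\<^esub> h a b [^]\<^bsub>B a\<^esub> n \<otimes>\<^bsub>B a\<^esub> y a) = \<zero>\<^bsub>B a\<^esub>"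
        using localization_zero_iff[OF loc(1)[OF a] C(1) hab C(2), of
            "h a x \<ominus>\<^bsub>B a\<^esub> h a b [^]\<^bsub>B a\<^esub> n \<otimes>\<^bsub>B a\<^esub> y a"]
          x(1) bn y[OF a] by auto
      have "h a (b [^]\<^bsub>A\<^esub> M \<otimes>\<^bsub>A\<^esub> x) = h a (b [^]\<^bsub>A\<^esub> (M + n)) \<otimes>\<^bsub>B a\<^esub> y a" if M: "M \<ge> N" for M
      proof -
        define u v w where "u = h a b [^]\<^bsub>B a\<^esub> N" and "v = h a b [^]\<^bsub>B a\<^esub> (M - N)"
            and "w = h a b [^]\<^bsub>B a\<^esub> n"
        have uvw: "u \<in> carrier (B a)" "v \<in> carrier (B a)" "w \<in> carrier (B a)" "y a \<in> carrier (B a)"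
            "h a x \<in> carrier (B a)"
          using hab y[OF a] x(1) by (auto simp: u_def v_def w_def)
        have "v \<otimes>\<^bsub>B a\<^esub> u \<otimes>\<^bsub>B a\<^esub> h a x \<ominus>\<^bsub>B a\<^esub> v \<otimes>\<^bsub>B a\<^esub> u \<otimes>\<^bsub>B a\<^esub> w \<otimes>\<^bsub>B a\<^esub> y a =
            v \<otimes>\<^bsub>B a\<^esub> (u \<otimes>\<^bsub>B a\<^esub> (h a x \<ominus>\<^bsub>B a\<^esub> w \<otimes>\<^bsub>B a\<^esub> y a))"
          using uvw by algebra
        also have "\<dots> = \<zero>\<^bsub>B a\<^esub>" using N uvw by (simp add: u_def w_def)
        finally have "v \<otimes>\<^bsub>B a\<^esub> u \<otimes>\<^bsub>B a\<^esub> h a x = v \<otimes>\<^bsub>B a\<^esub> u \<otimes>\<^bsub>B a\<^esub> w \<otimes>\<^bsub>B a\<^esub> y a"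
          using uvw by (simp add: a.S.minus_eq_zero_iff)
        moreover have "v \<otimes>\<^bsub>B a\<^esub> u = h a (b [^]\<^bsub>A\<^esub> M)" "v \<otimes>\<^bsub>B a\<^esub> u \<otimes>\<^bsub>B a\<^esub> w = h a (b [^]\<^bsub>A\<^esub> (M + n))"
          using M hab by (simp_all add: u_def v_def w_def a.S.nat_pow_mult hb[OF a])
        ultimately show ?thesis using x(1) Tc[OF b] by simp
      qed
      then show ?thesis by blast
    qed
    then obtain N where N: "\<And>a M. a \<in> T \<Longrightarrow> N a \<le> M \<Longrightarrow>
        h a (b [^]\<^bsub>A\<^esub> M \<otimes>\<^bsub>A\<^esub> x) = h a (b [^]\<^bsub>A\<^esub> (M + n)) \<otimes>\<^bsub>B a\<^esub> y a"
      by metis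
    define M where "M = Max (N ` T)"
    have M: "h a (b [^]\<^bsub>A\<^esub> M \<otimes>\<^bsub>A\<^esub> x) = h a (b [^]\<^bsub>A\<^esub> (M + n)) \<otimes>\<^bsub>B a\<^esub> y a" if "a \<in> T" for a
      using N[OF that] T(1) that by (simp add: M_def)
    have "b [^]\<^bsub>A\<^esub> (M + n) \<in> ?J"
      using M Tc[OF b] x(1) by (auto intro!: bexI[of _ "b [^]\<^bsub>A\<^esub> M \<otimes>\<^bsub>A\<^esub> x"])
    then show "\<exists>n::nat. b [^]\<^bsub>A\<^esub> n \<in> ?J" by blast
  qed
  from equalityD2[OF this] A.one_closed have "\<one>\<^bsub>A\<^esub> \<in> ?J" by (rule subsetD)
  then obtain x where x: "x \<in> carrier A" "\<And>a. a \<in> T \<Longrightarrow> h a x = h a \<one>\<^bsub>A\<^esub> \<otimes>\<^bsub>B a\<^esub> y a" by blast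
  have "h a x = y a" if "a \<in> T" for a
  proof -
    interpret ring_hom_cring A "B a" "h a" by (rule hom[OF that])
    show ?thesis using x(2)[OF that] y[OF that] by simp
  qed
  with x(1) that show thesis by blast
qed

subsection \<open>Properties holding locally on the spectrum\<close>

text \<open>The basic opens on which \<open>P\<close> holds cover the spectrum. Asking for some
  localization at \<open>a\<close>, instead of a fixed model, spares every \<open>P\<close> a proof
  of invariance under isomorphism.\<close>

definition locally_on :: "'k ring \<Rightarrow> ('k, 'u) module \<Rightarrow> (('k, 'u) module \<Rightarrow> ('u \<Rightarrow> 'u) \<Rightarrow> bool) \<Rightarrow> bool"
    where
  "locally_on K A P \<longleftrightarrow>
     Idl\<^bsub>A\<^esub> {a \<in> carrier A. \<exists>B\<in>aff K. \<exists>h. localization_map K A a B h \<and> P B h} = carrier A"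

lemma locally_on_mono:
  assumes "A \<in> aff K" "locally_on K A P"
    and "\<And>a B h. a \<in> carrier A \<Longrightarrow> B \<in> aff K \<Longrightarrow> localization_map K A a B h \<Longrightarrow> P B h \<Longrightarrow> Q B h"
  shows "locally_on K A Q"
  using assms(2) unfolding locally_on_def
  by (rule Idl_UNIV_mono[OF assms(1), rotated 2]) (use assms(3) in blast)+

lemma locally_onI:
  assumes "A \<in> aff K" "\<And>a B h. a \<in> carrier A \<Longrightarrow> B \<in> aff K \<Longrightarrow> localization_map K A a B h \<Longrightarrow> P B h"
    and "infinite (UNIV :: 'u set)"
  shows "locally_on K (A :: ('k, 'u) module) P"
proof -
  interpret A: algebra K A using assms(1) by (simp add: aff_def)
  \<comment> \<open>The spectrum is covered by the single basic open of
    \<open>\<one>\<close>.\<close>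
  obtain B h where "B \<in> aff K" "localization_map K A \<one>\<^bsub>A\<^esub> B h"
    using localization_exists[OF assms(3,1) A.one_closed] .
  then have "\<one>\<^bsub>A\<^esub> \<in> {a \<in> carrier A. \<exists>B\<in>aff K. \<exists>h. localization_map K A a B h \<and> P B h}" (is "_ \<in> ?S")
    using assms(2)[OF A.one_closed] by auto
  then have "\<one>\<^bsub>A\<^esub> \<in> Idl\<^bsub>A\<^esub> ?S" using A.genideal_self[of ?S] by auto
  moreover have "?S \<subseteq> carrier A" by blast
  ultimately show ?thesis unfolding locally_on_def
    by (intro ideal.one_imp_carrier A.genideal_ideal)
qed

lemma Idl_unit:
  assumes "A \<in> aff K" "S \<subseteq> carrier A" "a \<in> S" "a \<in> Units A"
  shows "Idl\<^bsub>A\<^esub> S = carrier A"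
proof -
  interpret A: algebra K A using assms(1) by (simp add: aff_def)
  have id: "ideal (Idl\<^bsub>A\<^esub> S) A" by (rule A.genideal_ideal[OF assms(2)])
  have "a \<in> Idl\<^bsub>A\<^esub> S" using A.genideal_self[OF assms(2)] assms(3) by blast
  from ideal.I_l_closed[OF id this, of "inv\<^bsub>A\<^esub> a"] show ?thesis
    using ideal.one_imp_carrier[OF id] assms(4) by simp
qed

text \<open>The preimage of the basic open of \<open>a\<close> under \<open>Spec f\<close> is the
  basic open of \<open>f a\<close>; the map \<open>g\<close> between the two comes from the
  universal property, since \<open>f a\<close> is invertible in \<open>B'\<close>.\<close>

lemma localization_pull:
  fixes A :: "('k, 'u) module"
  assumes "infinite (UNIV :: 'u set)" "A \<in> aff K" "A' \<in> aff K" "B \<in> aff K" "f \<in> alg_hom K A A'"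
    "a \<in> carrier A" "localization_map K A a B h"
  obtains B' h' g where "B' \<in> aff K" "localization_map K A' (f a) B' h'" "g \<in> alg_hom K B B'"
    "compose (carrier A) g h = compose (carrier A) h' f"
proof -
  have fa: "f a \<in> carrier A'" using assms(5,6) by blast
  obtain B' h' where B': "B' \<in> aff K" "localization_map K A' (f a) B' h'"
    using localization_exists[OF assms(1,3) fa] .
  have "compose (carrier A) h' f a \<in> Units B'"
    using localization_map_Units[OF B'(2)] assms(6) by (simp add: compose_def)
  from localization_factor[OF assms(2,4) B'(1) assms(6,7) alg_hom_comp[OF assms(2,5)
      localization_map_hom[OF B'(2)]] this]
  show thesis using that B' by metis
qed

lemma locally_on_pull:
  fixes A :: "('k, 'u) module"
  assumes "infinite (UNIV :: 'u set)" "A \<in> aff K" "A' \<in> aff K" "f \<in> alg_hom K A A'"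
      "locally_on K A P"
    and "\<And>a B h B' h' g. a \<in> carrier A \<Longrightarrow> B \<in> aff K \<Longrightarrow> B' \<in> aff K \<Longrightarrow> localization_map K A a B h \<Longrightarrow>
      localization_map K A' (f a) B' h' \<Longrightarrow> g \<in> alg_hom K B B' \<Longrightarrow>
      compose (carrier A) g h = compose (carrier A) h' f \<Longrightarrow> P B h \<Longrightarrow> Q B' h'"
  shows "locally_on K A' Q"
proof -
  let ?S = "{a \<in> carrier A. \<exists>B\<in>aff K. \<exists>h. localization_map K A a B h \<and> P B h}"
  let ?S' = "{a \<in> carrier A'. \<exists>B\<in>aff K. \<exists>h. localization_map K A' a B h \<and> Q B h}"
  have "f ` ?S \<subseteq> ?S'"
  proof
    fix b assume "b \<in> f ` ?S"
    then obtain a B h where a: "a \<in> carrier A" "b = f a" "B \<in> aff K" "localization_map K A a B h"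
        "P B h" by blast
    obtain B' h' g where "B' \<in> aff K" "localization_map K A' (f a) B' h'" "g \<in> alg_hom K B B'"
      "compose (carrier A) g h = compose (carrier A) h' f"
      using localization_pull[OF assms(1-3) a(3) assms(4) a(1,4)] .
    with assms(6)[of a B B' h h' g] a have "Q B' h'" by blast
    then show "b \<in> ?S'" using a alg_hom_closed[OF assms(4) a(1)] \<open>B' \<in> aff K\<close> \<open>localization_map K A'
        (f a) B' h'\<close> by auto
  qed
  moreover have "?S' \<subseteq> carrier A'" by auto
  moreover have "Idl\<^bsub>A'\<^esub> (f ` ?S) = carrier A'"
    by (rule Idl_UNIV_image[OF assms(2-4) _ assms(5)[unfolded locally_on_def]]) auto
  ultimately show ?thesis unfolding locally_on_def by (rule Idl_UNIV_mono[OF assms(3)])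
qed

lemma locally_on_zero:
  assumes "A \<in> aff K" "y \<in> carrier A" "locally_on K A (\<lambda>B h. h y = \<zero>\<^bsub>B\<^esub>)"
  shows "y = \<zero>\<^bsub>A\<^esub>"
  by (rule localization_separated[OF assms(1,2) _ assms(3)[unfolded locally_on_def]]) auto

lemma locally_on_finite:
  assumes "A \<in> aff K" "locally_on K A P"
  obtains T B h where "finite T" "T \<subseteq> carrier A" "Idl\<^bsub>A\<^esub> T = carrier A"
    "\<And>a. a \<in> T \<Longrightarrow> B a \<in> aff K" "\<And>a. a \<in> T \<Longrightarrow> localization_map K A a (B a) (h a)" "\<And>a. a \<in> T \<Longrightarrow>
        P (B a) (h a)"
proof -
  let ?S = "{a \<in> carrier A. \<exists>B\<in>aff K. \<exists>h. localization_map K A a B h \<and> P B h}"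
  have sub: "?S \<subseteq> carrier A" by blast
  obtain T where T: "finite T" "T \<subseteq> ?S" "Idl\<^bsub>A\<^esub> T = carrier A"
    by (rule Idl_UNIV_finite[OF assms(1) sub assms(2)[unfolded locally_on_def]])
  then have "\<forall>a\<in>T. \<exists>B h. B \<in> aff K \<and> localization_map K A a B h \<and> P B h" by blast
  then obtain B h where "\<forall>a\<in>T. B a \<in> aff K \<and> localization_map K A a (B a) (h a) \<and> P (B a) (h a)"
      by metis
  moreover have "T \<subseteq> carrier A" using T(2) sub by (rule subset_trans)
  ultimately show thesis using that[of T B h] T by blast
qed

lemma locally_on_finiteI:
  assumes "A \<in> aff K" "T \<subseteq> carrier A" "Idl\<^bsub>A\<^esub> T = carrier A"
    "\<And>a. a \<in> T \<Longrightarrow> B a \<in> aff K" "\<And>a. a \<in> T \<Longrightarrow> localization_map K A a (B a) (h a)" "\<And>a. a \<in> T \<Longrightarrow>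
        P (B a) (h a)"
  shows "locally_on K A P"
  unfolding locally_on_def by (rule Idl_UNIV_mono[OF assms(1) _ _ assms(3)]) (use assms in blast)+


section \<open>Presheaves\<close>

lemma pull_closed:
  "presheaf K F \<Longrightarrow> A \<in> aff K \<Longrightarrow> B \<in> aff K \<Longrightarrow> f \<in> alg_hom K A B \<Longrightarrow> x \<in> pts F A \<Longrightarrow>
      pull F A B f x \<in> pts F B"
  unfolding presheaf_def by blast

lemma pull_id: "presheaf K F \<Longrightarrow> A \<in> aff K \<Longrightarrow> x \<in> pts F A \<Longrightarrow> pull F A A (\<lambda>a\<in>carrier A. a) x = x"
  unfolding presheaf_def by blast

lemma pull_comp:
  "presheaf K F \<Longrightarrow> A \<in> aff K \<Longrightarrow> B \<in> aff K \<Longrightarrow> C \<in> aff K \<Longrightarrow> f \<in> alg_hom K A B \<Longrightarrow> g \<in> alg_hom K B C \<Longrightarrow>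
   x \<in> pts F A \<Longrightarrow> pull F B C g (pull F A B f x) = pull F A C (compose (carrier A) g f) x"
  unfolding presheaf_def by simp

lemma presheafI:
  assumes "\<And>A B f x. A \<in> aff K \<Longrightarrow> B \<in> aff K \<Longrightarrow> f \<in> alg_hom K A B \<Longrightarrow> x \<in> pts F A \<Longrightarrow>
      pull F A B f x \<in> pts F B"
    and "\<And>A x. A \<in> aff K \<Longrightarrow> x \<in> pts F A \<Longrightarrow> pull F A A (\<lambda>a\<in>carrier A. a) x = x"
    and "\<And>A B C f g x. A \<in> aff K \<Longrightarrow> B \<in> aff K \<Longrightarrow> C \<in> aff K \<Longrightarrow> f \<in> alg_hom K A B \<Longrightarrow> g \<in> alg_hom K B C \<Longrightarrow>
      x \<in> pts F A \<Longrightarrow> pull F A C (compose (carrier A) g f) x = pull F B C g (pull F A B f x)"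
  shows "presheaf K F"
  unfolding presheaf_def using assms by auto

lemma psh_map_presheaf: "psh_map K F G \<alpha> \<Longrightarrow> presheaf K F" "psh_map K F G \<alpha> \<Longrightarrow> presheaf K G"
  by (simp_all add: psh_map_def)

lemma psh_map_closed: "psh_map K F G \<alpha> \<Longrightarrow> A \<in> aff K \<Longrightarrow> x \<in> pts F A \<Longrightarrow> \<alpha> A x \<in> pts G A"
  unfolding psh_map_def by blast

lemma psh_map_pull:
  "psh_map K F G \<alpha> \<Longrightarrow> A \<in> aff K \<Longrightarrow> B \<in> aff K \<Longrightarrow> f \<in> alg_hom K A B \<Longrightarrow> x \<in> pts F A \<Longrightarrow>
   \<alpha> B (pull F A B f x) = pull G A B f (\<alpha> A x)"
  unfolding psh_map_def by blast

lemma psh_mapI: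
  assumes "presheaf K F" "presheaf K G" "\<And>A x. A \<in> aff K \<Longrightarrow> x \<in> pts F A \<Longrightarrow> \<alpha> A x \<in> pts G A"
    "\<And>A B f x. A \<in> aff K \<Longrightarrow> B \<in> aff K \<Longrightarrow> f \<in> alg_hom K A B \<Longrightarrow> x \<in> pts F A \<Longrightarrow>
     \<alpha> B (pull F A B f x) = pull G A B f (\<alpha> A x)"
  shows "psh_map K F G \<alpha>"
  unfolding psh_map_def using assms by auto

lemma psh_map_comp:
  assumes "psh_map K F G \<alpha>" "psh_map K G H \<beta>"
  shows "psh_map K F H (psh_comp \<beta> \<alpha>)"
  by (rule psh_mapI)
    (simp_all add: psh_comp_def psh_map_presheaf[OF assms(1)] psh_map_presheaf[OF assms(2)]
        psh_map_closed[OF assms(1)]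
      psh_map_closed[OF assms(2)] psh_map_pull[OF assms(1)] psh_map_pull[OF assms(2)])

lemma presheaf_Spec: "A \<in> aff K \<Longrightarrow> presheaf K (Spec K A)"
  by (rule presheafI) (auto simp: Spec_def alg_hom_comp_id alg_hom_comp_assoc)

lemma pts_Spec [simp]: "pts (Spec K A) = alg_hom K A"
  and pull_Spec [simp]: "pull (Spec K A) B C f g = compose (carrier A) f g"
  by (simp_all add: Spec_def)

section \<open>Points of representable presheaves and sub-presheaves\<close>

lemma yoneda_eq:
  assumes "psh_map K (Spec K A) F s" "A \<in> aff K" "B \<in> aff K" "f \<in> alg_hom K A B"
  shows "s B f = pull F A B f (s A (\<lambda>a\<in>carrier A. a))"
  using psh_map_pull[OF assms(1,2,3,4), of "\<lambda>a\<in>carrier A. a"] assms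
      by (simp add: alg_hom_id alg_hom_comp_id)

lemma yoneda_pt:
  assumes "psh_map K (Spec K A) F s" "A \<in> aff K"
  shows "s A (\<lambda>a\<in>carrier A. a) \<in> pts F A"
  using psh_map_closed[OF assms, of "\<lambda>a\<in>carrier A. a"] assms(2) by (simp add: alg_hom_id)

definition sub_psh :: "('k, 'u, 'v) psh \<Rightarrow> (('k, 'u) module \<Rightarrow> 'v \<Rightarrow> bool) \<Rightarrow> ('k, 'u, 'v) psh" where
  "sub_psh F P = \<lparr>pts = (\<lambda>A. {x \<in> pts F A. P A x}), pull = pull F\<rparr>"

lemma pts_sub_psh [simp]: "pts (sub_psh F P) A = {x \<in> pts F A. P A x}"
  and pull_sub_psh [simp]: "pull (sub_psh F P) = pull F"
  by (simp_all add: sub_psh_def)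

lemma presheaf_sub_psh:
  assumes "presheaf K F"
    "\<And>A B f x. A \<in> aff K \<Longrightarrow> B \<in> aff K \<Longrightarrow> f \<in> alg_hom K A B \<Longrightarrow> x \<in> pts F A \<Longrightarrow> P A x \<Longrightarrow>
        P B (pull F A B f x)"
  shows "presheaf K (sub_psh F P)"
  by (rule presheafI) (use assms in \<open>auto simp: pull_closed pull_id pull_comp\<close>)

lemma sub_psh_incl:
  assumes "presheaf K F" "presheaf K (sub_psh F P)"
  shows "psh_map K (sub_psh F P) F psh_incl"
  by (rule psh_mapI) (use assms in \<open>auto simp: psh_incl_def\<close>)


section \<open>Points factoring locally through reduced algebras\<close>

text \<open>A general reduced scheme behind a point is seen only through its affine charts;
  therefore \<open>Q\<close> is an algebra here, and \<open>lred\<close> asks for this on a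
  cover.\<close>

definition red_pt :: "'k ring \<Rightarrow> ('k, 'u, 'v) psh \<Rightarrow> ('k, 'u) module \<Rightarrow> 'v \<Rightarrow> bool" where
  "red_pt K F A x \<longleftrightarrow> (\<exists>Q\<in>aff K. reduced_ring Q \<and> (\<exists>\<psi>\<in>alg_hom K Q A. \<exists>y\<in>pts F Q. x = pull F Q A \<psi> y))"

definition lred :: "'k ring \<Rightarrow> ('k, 'u, 'v) psh \<Rightarrow> ('k, 'u) module \<Rightarrow> 'v \<Rightarrow> bool" where
  "lred K F A x \<longleftrightarrow> x \<in> pts F A \<and> locally_on K A (\<lambda>B h. red_pt K F B (pull F A B h x))"

lemma red_pt_map:
  assumes "psh_map K F G \<alpha>" "A \<in> aff K" "red_pt K F A x"
  shows "red_pt K G A (\<alpha> A x)"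
proof -
  obtain Q \<psi> y where Q: "Q \<in> aff K" "reduced_ring Q" "\<psi> \<in> alg_hom K Q A" "y \<in> pts F Q"
      "x = pull F Q A \<psi> y"
    using assms(3) by (auto simp: red_pt_def)
  then have "\<alpha> A x = pull G Q A \<psi> (\<alpha> Q y)" using psh_map_pull[OF assms(1) Q(1) assms(2) Q(3,4)]
      by simp
  then show ?thesis using Q psh_map_closed[OF assms(1) Q(1,4)] unfolding red_pt_def by blast
qed

lemma lred_map:
  assumes "psh_map K F G \<alpha>" "A \<in> aff K" "lred K F A x"
  shows "lred K G A (\<alpha> A x)"
proof -
  have x: "x \<in> pts F A" "locally_on K A (\<lambda>B h. red_pt K F B (pull F A B h x))" using assms(3)
      by (auto simp: lred_def)
  have "locally_on K A (\<lambda>B h. red_pt K G B (pull G A B h (\<alpha> A x)))"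
  proof (rule locally_on_mono[OF assms(2) x(2)])
    fix a B h assume B: "B \<in> aff K" "localization_map K A a B h" "red_pt K F B (pull F A B h x)"
    show "red_pt K G B (pull G A B h (\<alpha> A x))"
      using red_pt_map[OF assms(1) B(1,3)] psh_map_pull[OF assms(1,2) B(1) localization_map_hom[OF
          B(2)] x(1)] by simp
  qed
  then show ?thesis using psh_map_closed[OF assms(1,2) x(1)] by (simp add: lred_def)
qed

lemma red_pt_pull:
  assumes "presheaf K F" "A \<in> aff K" "B \<in> aff K" "f \<in> alg_hom K A B" "red_pt K F A x"
  shows "red_pt K F B (pull F A B f x)"
proof -
  obtain Q \<psi> y where Q: "Q \<in> aff K" "reduced_ring Q" "\<psi> \<in> alg_hom K Q A" "y \<in> pts F Q"
      "x = pull F Q A \<psi> y"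
    using assms(5) by (auto simp: red_pt_def)
  then have "pull F A B f x = pull F Q B (compose (carrier Q) f \<psi>) y"
    using pull_comp[OF assms(1) Q(1) assms(2,3) Q(3) assms(4) Q(4)] by simp
  then show ?thesis using Q alg_hom_comp[OF Q(1,3) assms(4)] unfolding red_pt_def by blast
qed

lemma red_pt_imp_lred:
  fixes A :: "('k, 'u) module"
  assumes "infinite (UNIV :: 'u set)" "presheaf K F" "A \<in> aff K" "x \<in> pts F A" "red_pt K F A x"
  shows "lred K F A x"
  unfolding lred_def
  using assms red_pt_pull[OF assms(2,3) _ localization_map_hom assms(5)]
  by (intro conjI locally_onI) auto

section \<open>Affine charts of schemes\<close>

lemma scheme_presheaf: "scheme K X \<Longrightarrow> presheaf K X"
  by (simp add: scheme_def zariski_sheaf_def)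

lemma open_emb_psh_map: "open_emb K U X j \<Longrightarrow> psh_map K U X j"
  by (simp add: open_emb_def)

lemma chart_eq:
  assumes "open_emb K (Spec K R) X j" "R \<in> aff K" "B \<in> aff K" "\<phi> \<in> alg_hom K R B"
  shows "j B \<phi> = pull X R B \<phi> (j R (\<lambda>a\<in>carrier R. a))"
  by (rule yoneda_eq[OF open_emb_psh_map[OF assms(1)] assms(2-4)])

lemma chart_pull:
  assumes "open_emb K (Spec K R) X j" "B \<in> aff K" "C \<in> aff K" "\<phi> \<in> alg_hom K R B"
      "f \<in> alg_hom K B C"
  shows "pull X B C f (j B \<phi>) = j C (compose (carrier R) f \<phi>)"
  using psh_map_pull[OF open_emb_psh_map[OF assms(1)] assms(2,3,5)] assms(4) by simp

lemma chart_inj: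
  assumes "open_emb K (Spec K R) X j" "B \<in> aff K" "\<phi> \<in> alg_hom K R B" "\<phi>' \<in> alg_hom K R B"
      "j B \<phi> = j B \<phi>'"
  shows "\<phi> = \<phi>'"
  using assms inj_onD[of "j B" "alg_hom K R B" \<phi> \<phi>'] by (simp add: open_emb_def)

lemma chart_ideal:
  assumes "open_emb K (Spec K R) X j" "A \<in> aff K" "x \<in> pts X A"
  obtains I where "ideal I A" "\<forall>B\<in>aff K. \<forall>f\<in>alg_hom K A B.
    (\<exists>\<phi>\<in>alg_hom K R B. pull X A B f x = j B \<phi>) \<longleftrightarrow> Idl\<^bsub>B\<^esub> (f ` I) = carrier B"
proof -
  obtain I where "ideal I A" "\<forall>B\<in>aff K. \<forall>f\<in>alg_hom K A B.
      pull X A B f x \<in> j B ` pts (Spec K R) B \<longleftrightarrow> Idl\<^bsub>B\<^esub> (f ` I) = carrier B"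
    using assms unfolding open_emb_def by blast
  with that show thesis by (simp add: image_iff)
qed

text \<open>For a nonzero \<open>b\<close> the preimage in \<open>A\<close> of the principal ideal
  of \<open>b\<close> strictly contains \<open>M\<close>. By maximality it is everything, so
  \<open>\<one>\<close> is a multiple of \<open>b\<close>.\<close>

lemma maximal_quotient_field:
  assumes "A \<in> aff K" "L \<in> aff K" "maximalideal M A" "quotient_map K A M L q"
  shows "field L"
proof -
  interpret A: algebra K A using assms(1) by (simp add: aff_def)
  interpret L: algebra K L using assms(2) by (simp add: aff_def)
  interpret M: maximalideal M A by fact
  note q = quotient_map_hom[OF assms(4)]
  show ?thesis
  proof (rule L.cring_fieldI2)
    have "\<one>\<^bsub>A\<^esub> \<notin> M" using M.I_notcarr M.one_imp_carrier by metis
    then show "\<zero>\<^bsub>L\<^esub> \<noteq> \<one>\<^bsub>L\<^esub>" using quotient_map_zero[OF assms(4), of "\<one>\<^bsub>A\<^esub>"] alg_hom_one[OF q]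
        by auto
    fix b assume b: "b \<in> carrier L" "b \<noteq> \<zero>\<^bsub>L\<^esub>"
    obtain x where x: "x \<in> carrier A" "b = q x" using b(1) quotient_map_surj[OF assms(4)] by blast
    have xM: "x \<notin> M" using quotient_map_zero[OF assms(4) x(1)] x(2) b(2) by simp
    let ?V = "{y \<in> carrier A. q y \<in> PIdl\<^bsub>L\<^esub> b}"
    have idb: "ideal (PIdl\<^bsub>L\<^esub> b) L" by (rule L.cgenideal_ideal[OF b(1)])
    have idV: "ideal ?V A" by (rule vimage_ideal[OF assms(1,2) q idb])
    have "M \<subseteq> ?V"
    proof
      fix m assume "m \<in> M"
      then have "m \<in> carrier A" "q m = \<zero>\<^bsub>L\<^esub>" using M.Icarr quotient_map_zero[OF assms(4)] by auto
      then show "m \<in> ?V" using ideal_zero[OF idb] by simp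
    qed
    moreover have "x \<in> ?V" using x L.cgenideal_self[OF b(1)] by simp
    ultimately have "?V = carrier A" using M.I_maximal[OF idV] xM by blast
    then have "\<one>\<^bsub>A\<^esub> \<in> ?V" using A.one_closed by (rule ssubst)
    then have "\<one>\<^bsub>L\<^esub> \<in> PIdl\<^bsub>L\<^esub> b" by (simp add: alg_hom_one[OF q])
    then obtain r where "r \<in> carrier L" "\<one>\<^bsub>L\<^esub> = r \<otimes>\<^bsub>L\<^esub> b" unfolding cgenideal_def by blast
    then show "\<exists>c\<in>carrier L. b \<otimes>\<^bsub>L\<^esub> c = \<one>\<^bsub>L\<^esub>" using b(1) L.m_comm by metis
  qed
qed

text \<open>Charts are known to cover only points with values in fields. If the basic opens that map
  into charts did not cover \<open>Spec A\<close>, they would all come from one maximal ideal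
  \<open>M\<close>. The point at the residue field of \<open>M\<close> lies in some chart, and the
  ideal \<open>I\<close> of the preimage of that chart is not contained in \<open>M\<close>; an
  element of \<open>I\<close> outside \<open>M\<close> gives a basic open that does map into the
  chart.\<close>

lemma scheme_charts:
  fixes X :: "('k, 'u, 'v) psh"
  assumes "infinite (UNIV :: 'u set)" "scheme K X" "A \<in> aff K" "x \<in> pts X A"
  shows "locally_on K A (\<lambda>B h. \<exists>R\<in>aff K. \<exists>j. open_emb K (Spec K R) X j \<and>
      (\<exists>\<phi>\<in>alg_hom K R B. pull X A B h x = j B \<phi>))"
    (is "locally_on K A ?P")
  unfolding locally_on_def
proof (subst Idl_UNIV_iff[OF assms(3)], blast, intro allI impI notI)
  fix M assume M: "maximalideal M A"
      and sub: "{a \<in> carrier A. \<exists>B\<in>aff K. \<exists>h. localization_map K A a B h \<and> ?P B h} \<subseteq> M"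
  interpret M: maximalideal M A by fact
  obtain L q where L: "L \<in> aff K" "quotient_map K A M L q"
      using quotient_exists[OF assms(1,3) M.is_ideal] .
  have fL: "field L" by (rule maximal_quotient_field[OF assms(3) L(1) M L(2)])
  then interpret L: field L .
  note q = quotient_map_hom[OF L(2)]
  have "pull X A L q x \<in> pts X L"
      by (rule pull_closed[OF scheme_presheaf[OF assms(2)] assms(3) L(1) q assms(4)])
  then obtain R j where R: "R \<in> aff K" "open_emb K (Spec K R) X j"
      "pull X A L q x \<in> j L ` pts (Spec K R) L"
    using assms(2) L(1) fL unfolding scheme_def by blast
  obtain I where I: "ideal I A" "\<forall>B\<in>aff K. \<forall>f\<in>alg_hom K A B.
    (\<exists>\<phi>\<in>alg_hom K R B. pull X A B f x = j B \<phi>) \<longleftrightarrow> Idl\<^bsub>B\<^esub> (f ` I) = carrier B"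
    using chart_ideal[OF R(2) assms(3,4)] .
  have IL: "Idl\<^bsub>L\<^esub> (q ` I) = carrier L" using I(2)[rule_format, OF L(1) q] R(3) by auto
  have "\<not> I \<subseteq> M"
  proof
    assume "I \<subseteq> M"
    then have "q ` I \<subseteq> {\<zero>\<^bsub>L\<^esub>}" using quotient_map_zero[OF L(2)] ideal_sub[OF I(1)] by blast
    then have "Idl\<^bsub>L\<^esub> (q ` I) \<subseteq> {\<zero>\<^bsub>L\<^esub>}" using L.genideal_minimal[OF L.zeroideal] by simp
    moreover have "\<one>\<^bsub>L\<^esub> \<in> Idl\<^bsub>L\<^esub> (q ` I)" using IL by simp
    ultimately show False using L.one_not_zero by blast
  qed
  then obtain a where a: "a \<in> I" "a \<notin> M" by blast
  have ac: "a \<in> carrier A" using a ideal_sub[OF I(1)] by blast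
  obtain B h where B: "B \<in> aff K" "localization_map K A a B h"
      using localization_exists[OF assms(1,3) ac] .
  note h = localization_map_hom[OF B(2)]
  have "h ` I \<subseteq> carrier B" using alg_hom_closed[OF h] ideal_sub[OF I(1)] by blast
  then have "Idl\<^bsub>B\<^esub> (h ` I) = carrier B"
    using Idl_unit[OF B(1)] a(1) localization_map_Units[OF B(2)] by blast
  then have "?P B h" using I(2)[rule_format, OF B(1) h] R(1,2) by blast
  then show False using sub a(2) ac B by blast
qed

text \<open>The reduced points of a scheme, described by all charts at once: in this form the condition is
  visibly stable under base change and local.\<close>

definition chart_red :: "'k ring \<Rightarrow> ('k, 'u, 'v) psh \<Rightarrow> ('k, 'u) module \<Rightarrow> 'v \<Rightarrow> bool" where
  "chart_red K X A x \<longleftrightarrow> (\<forall>B\<in>aff K. \<forall>h\<in>alg_hom K A B. \<forall>R\<in>aff K. \<forall>j. open_emb K (Spec K R) X j \<longrightarrow>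
     (\<forall>\<phi>\<in>alg_hom K R B. pull X A B h x = j B \<phi> \<longrightarrow> (\<forall>n\<in>nilradical R. \<phi> n = \<zero>\<^bsub>B\<^esub>)))"

lemma chart_redD:
  assumes "chart_red K X A x" "B \<in> aff K" "h \<in> alg_hom K A B" "R \<in> aff K"
      "open_emb K (Spec K R) X j"
    "\<phi> \<in> alg_hom K R B" "pull X A B h x = j B \<phi>" "n \<in> nilradical R"
  shows "\<phi> n = \<zero>\<^bsub>B\<^esub>"
  using assms unfolding chart_red_def by blast

lemma chart_red_pull:
  assumes "presheaf K X" "A \<in> aff K" "B \<in> aff K" "f \<in> alg_hom K A B" "x \<in> pts X A"
      "chart_red K X A x"
  shows "chart_red K X B (pull X A B f x)"
  unfolding chart_red_def
proof (intro ballI allI impI)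
  fix C h R j \<phi> n
  assume C: "C \<in> aff K" "h \<in> alg_hom K B C" "R \<in> aff K" "open_emb K (Spec K R) X j"
      "\<phi> \<in> alg_hom K R C"
    "pull X B C h (pull X A B f x) = j C \<phi>" "n \<in> nilradical R"
  have "pull X A C (compose (carrier A) h f) x = j C \<phi>"
    using pull_comp[OF assms(1,2,3) C(1) assms(4) C(2) assms(5)] C(6) by simp
  from chart_redD[OF assms(6) C(1) alg_hom_comp[OF assms(2,4) C(2)] C(3-5) this C(7)]
  show "\<phi> n = \<zero>\<^bsub>C\<^esub>" .
qed

text \<open>Let the point come from a reduced \<open>Q\<close>. The preimage of the chart in
  \<open>Spec Q\<close> is covered by the basic opens of elements \<open>i\<close> of
  \<open>I\<close>, and on each of them \<open>R\<close> maps to a localization of \<open>Q\<close>,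
  which is reduced and so kills the nilradical. The elements \<open>f i\<close> give a cover of
  \<open>Spec B\<close> on which \<open>\<phi> n\<close> therefore vanishes.\<close>

lemma red_pt_imp_chart_red:
  fixes X :: "('k, 'u, 'v) psh"
  assumes inf: "infinite (UNIV :: 'u set)" and X: "presheaf K X" and A: "A \<in> aff K"
      and "red_pt K X A x"
  shows "chart_red K X A x"
  unfolding chart_red_def
proof (intro ballI allI impI)
  obtain Q \<psi> y where Q: "Q \<in> aff K" "reduced_ring Q" "\<psi> \<in> alg_hom K Q A" "y \<in> pts X Q"
      "x = pull X Q A \<psi> y"
    using assms(4) by (auto simp: red_pt_def)
  fix B h R j \<phi> n
  assume B: "B \<in> aff K" and h: "h \<in> alg_hom K A B" and R: "R \<in> aff K" "open_emb K (Spec K R) X j"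
    and \<phi>: "\<phi> \<in> alg_hom K R B" and eq: "pull X A B h x = j B \<phi>" and n: "n \<in> nilradical R"
  define f where "f = compose (carrier Q) h \<psi>"
  have f: "f \<in> alg_hom K Q B" unfolding f_def by (rule alg_hom_comp[OF Q(1,3) h])
  have nR: "n \<in> carrier R" using n nilradical_sub[OF R(1)] by blast
  have fy: "pull X Q B f y = j B \<phi>" using eq Q(5) pull_comp[OF X Q(1) A B Q(3) h Q(4)]
      by (simp add: f_def)
  obtain I where I: "ideal I Q" "\<forall>B\<in>aff K. \<forall>f\<in>alg_hom K Q B.
    (\<exists>\<phi>\<in>alg_hom K R B. pull X Q B f y = j B \<phi>) \<longleftrightarrow> Idl\<^bsub>B\<^esub> (f ` I) = carrier B"
    using chart_ideal[OF R(2) Q(1,4)] .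
  have IB: "Idl\<^bsub>B\<^esub> (f ` I) = carrier B" using I(2)[rule_format, OF B f] fy \<phi> by blast
  have "locally_on K B (\<lambda>D l. l (\<phi> n) = \<zero>\<^bsub>D\<^esub>)"
    unfolding locally_on_def
  proof (rule Idl_UNIV_mono[OF B _ _ IB])
    show "f ` I \<subseteq> {b \<in> carrier B. \<exists>D\<in>aff K. \<exists>l. localization_map K B b D l \<and> l (\<phi> n) = \<zero>\<^bsub>D\<^esub>}"
    proof
      fix b assume "b \<in> f ` I"
      then obtain i where i: "i \<in> I" "b = f i" by blast
      have ic: "i \<in> carrier Q" using i ideal_sub[OF I(1)] by blast
      obtain Qi q where Qi: "Qi \<in> aff K" "localization_map K Q i Qi q"
          using localization_exists[OF inf Q(1) ic] .
      note q = localization_map_hom[OF Qi(2)]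
      obtain D l g where D: "D \<in> aff K" "localization_map K B (f i) D l" "g \<in> alg_hom K Qi D"
        "compose (carrier Q) g q = compose (carrier Q) l f"
        using localization_pull[OF inf Q(1) B Qi(1) f ic Qi(2)] .
      note l = localization_map_hom[OF D(2)]
      have "q ` I \<subseteq> carrier Qi" using alg_hom_closed[OF q] ideal_sub[OF I(1)] by blast
      then have "Idl\<^bsub>Qi\<^esub> (q ` I) = carrier Qi"
        using Idl_unit[OF Qi(1)] i(1) localization_map_Units[OF Qi(2)] by blast
      then obtain \<chi> where \<chi>: "\<chi> \<in> alg_hom K R Qi" "pull X Q Qi q y = j Qi \<chi>"
          using I(2)[rule_format, OF Qi(1) q] by blast
      have "j D (compose (carrier R) l \<phi>) = pull X B D l (pull X Q B f y)"
        using chart_pull[OF R(2) B D(1) \<phi> l] fy by simp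
      also have "\<dots> = pull X Qi D g (pull X Q Qi q y)"
        using pull_comp[OF X Q(1) B D(1) f l Q(4)] pull_comp[OF X Q(1) Qi(1) D(1) q D(3) Q(4)] D(4)
            by simp
      also have "\<dots> = j D (compose (carrier R) g \<chi>)"
        using chart_pull[OF R(2) Qi(1) D(1) \<chi>(1) D(3)] \<chi>(2) by simp
      \<comment> \<open>A chart is a monomorphism, so the two factorizations over \<open>D\<close>
        coincide.\<close>
      finally have "compose (carrier R) l \<phi> = compose (carrier R) g \<chi>"
        by (rule chart_inj[OF R(2) D(1) alg_hom_comp[OF R(1) \<phi> l] alg_hom_comp[OF R(1) \<chi>(1) D(3)]])
      then have "l (\<phi> n) = g (\<chi> n)" using nR by (metis compose_eq)
      also have "\<chi> n = \<zero>\<^bsub>Qi\<^esub>"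
        by (rule reduced_kills_nilradical[OF R(1) Qi(1) \<chi>(1) reduced_localization[OF Q(1) Qi(1) ic
            Qi(2) Q(2)] n])
      finally have "l (\<phi> n) = \<zero>\<^bsub>D\<^esub>" using alg_hom_zero[OF Qi(1) D(1,3)] by simp
      then show "b \<in> {b \<in> carrier B. \<exists>D\<in>aff K. \<exists>l. localization_map K B b D l \<and> l (\<phi> n) = \<zero>\<^bsub>D\<^esub>}"
        using D(1,2) i(2) alg_hom_closed[OF f ic] by blast
    qed
  qed blast
  then show "\<phi> n = \<zero>\<^bsub>B\<^esub>" by (rule locally_on_zero[OF B alg_hom_closed[OF \<phi> nR]])
qed

text \<open>The vanishing of \<open>\<phi> n\<close> is a local question on \<open>Spec B\<close>,
  and the given cover of \<open>Spec A\<close> pulls back to \<open>Spec B\<close>.\<close>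

lemma chart_red_local:
  fixes X :: "('k, 'u, 'v) psh"
  assumes inf: "infinite (UNIV :: 'u set)" and X: "presheaf K X" and A: "A \<in> aff K"
      and x: "x \<in> pts X A"
    and loc: "locally_on K A (\<lambda>B h. chart_red K X B (pull X A B h x))"
  shows "chart_red K X A x"
  unfolding chart_red_def
proof (intro ballI allI impI)
  fix B f R j \<phi> n
  assume B: "B \<in> aff K" and f: "f \<in> alg_hom K A B" and R: "R \<in> aff K" "open_emb K (Spec K R) X j"
    and \<phi>: "\<phi> \<in> alg_hom K R B" and eq: "pull X A B f x = j B \<phi>" and n: "n \<in> nilradical R"
  have nR: "n \<in> carrier R" using n nilradical_sub[OF R(1)] by blast
  have "locally_on K B (\<lambda>D l. l (\<phi> n) = \<zero>\<^bsub>D\<^esub>)"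
  proof (rule locally_on_pull[OF inf A B f loc])
    fix a D h D' h' g assume D: "D \<in> aff K" "D' \<in> aff K" "localization_map K A a D h"
        "localization_map K B (f a) D' h'"
      "g \<in> alg_hom K D D'" "compose (carrier A) g h = compose (carrier A) h' f"
          "chart_red K X D (pull X A D h x)"
    note h = localization_map_hom[OF D(3)] and h' = localization_map_hom[OF D(4)]
    have "pull X D D' g (pull X A D h x) = pull X B D' h' (j B \<phi>)"
      using pull_comp[OF X A B D(2) f h' x] pull_comp[OF X A D(1,2) h D(5) x] D(6) eq by simp
    also have "\<dots> = j D' (compose (carrier R) h' \<phi>)" by (rule chart_pull[OF R(2) B D(2) \<phi> h'])
    finally have "compose (carrier R) h' \<phi> n = \<zero>\<^bsub>D'\<^esub>"
      by (rule chart_redD[OF D(7,2,5) R alg_hom_comp[OF R(1) \<phi> h'] _ n])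
    then show "h' (\<phi> n) = \<zero>\<^bsub>D'\<^esub>" using nR by (simp add: compose_def)
  qed
  then show "\<phi> n = \<zero>\<^bsub>B\<^esub>" by (rule locally_on_zero[OF B alg_hom_closed[OF \<phi> nR]])
qed

lemma nilradical_factor:
  fixes R :: "('k, 'u) module"
  assumes "infinite (UNIV :: 'u set)" "R \<in> aff K" "B \<in> aff K"
    "\<phi> \<in> alg_hom K R B" "\<And>n. n \<in> nilradical R \<Longrightarrow> \<phi> n = \<zero>\<^bsub>B\<^esub>"
  obtains Q q \<psi> where "Q \<in> aff K" "quotient_map K R (nilradical R) Q q" "\<psi> \<in> alg_hom K Q B"
      "\<phi> = compose (carrier R) \<psi> q"
proof -
  obtain Q q where Q: "Q \<in> aff K" "quotient_map K R (nilradical R) Q q"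
    using quotient_exists[OF assms(1,2) nilradical_ideal[OF assms(2)]] .
  from quotient_factor[OF assms(2) Q(1) assms(3) Q(2) assms(4,5)] Q that show thesis by metis
qed

text \<open>The point lies in charts on a cover, and there killing the nilradical of
  \<open>R\<close> means factoring through the reduced quotient of \<open>R\<close>.\<close>

lemma chart_red_imp_lred:
  fixes X :: "('k, 'u, 'v) psh"
  assumes inf: "infinite (UNIV :: 'u set)" and X: "scheme K X" and A: "A \<in> aff K"
      and x: "x \<in> pts X A"
    and red: "chart_red K X A x"
  shows "lred K X A x"
  unfolding lred_def
proof (intro conjI x locally_on_mono[OF A scheme_charts[OF inf X A x]])
  fix a B h assume B: "B \<in> aff K" "localization_map K A a B h"
    and "\<exists>R\<in>aff K. \<exists>j. open_emb K (Spec K R) X j \<and> (\<exists>\<phi>\<in>alg_hom K R B. pull X A B h x = j B \<phi>)"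
  then obtain R j \<phi> where R: "R \<in> aff K" "open_emb K (Spec K R) X j" "\<phi> \<in> alg_hom K R B"
      "pull X A B h x = j B \<phi>" by blast
  have "\<phi> n = \<zero>\<^bsub>B\<^esub>" if "n \<in> nilradical R" for n
    by (rule chart_redD[OF red B(1) localization_map_hom[OF B(2)] R that])
  then obtain Q q \<psi> where Q: "Q \<in> aff K" "quotient_map K R (nilradical R) Q q" "\<psi> \<in> alg_hom K Q B"
      "\<phi> = compose (carrier R) \<psi> q"
    using nilradical_factor[OF inf R(1) B(1) R(3)] by metis
  note q = quotient_map_hom[OF Q(2)]
  have "pull X A B h x = pull X Q B \<psi> (j Q q)"
    using R(4) Q(4) chart_pull[OF R(2) Q(1) B(1) q Q(3)] by simp
  moreover have "j Q q \<in> pts X Q" using psh_map_closed[OF open_emb_psh_map[OF R(2)] Q(1)] q by simp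
  ultimately show "red_pt K X B (pull X A B h x)"
    unfolding red_pt_def using Q reduced_quotient[OF R(1) Q(1,2)] by blast
qed

text \<open>The two descriptions complement each other: \<open>lred\<close> is functorial in the
  presheaf, while \<open>chart_red\<close> yields locality and the equations in charts.\<close>

lemma lred_scheme_iff:
  fixes X :: "('k, 'u, 'v) psh"
  assumes inf: "infinite (UNIV :: 'u set)" and X: "scheme K X" and A: "A \<in> aff K"
  shows "lred K X A x \<longleftrightarrow> x \<in> pts X A \<and> chart_red K X A x"
proof
  assume "lred K X A x"
  then have x: "x \<in> pts X A" "locally_on K A (\<lambda>B h. red_pt K X B (pull X A B h x))"
      by (auto simp: lred_def)
  have "locally_on K A (\<lambda>B h. chart_red K X B (pull X A B h x))"
    by (rule locally_on_mono[OF A x(2)]) (rule red_pt_imp_chart_red[OF inf scheme_presheaf[OF X]])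
  then show "x \<in> pts X A \<and> chart_red K X A x"
    using chart_red_local[OF inf scheme_presheaf[OF X] A x(1)] x(1) by blast
qed (use chart_red_imp_lred[OF assms] in blast)

lemma lred_scheme_pull:
  fixes X :: "('k, 'u, 'v) psh"
  assumes inf: "infinite (UNIV :: 'u set)" and X: "scheme K X"
      and "A \<in> aff K" "B \<in> aff K" "f \<in> alg_hom K A B" "lred K X A x"
  shows "lred K X B (pull X A B f x)"
  using assms chart_red_pull[OF scheme_presheaf[OF X]] pull_closed[OF scheme_presheaf[OF X]]
      by (simp add: lred_scheme_iff)

lemma lred_scheme_local:
  fixes X :: "('k, 'u, 'v) psh"
  assumes inf: "infinite (UNIV :: 'u set)" and X: "scheme K X" and A: "A \<in> aff K"
      and x: "x \<in> pts X A"
    and loc: "locally_on K A (\<lambda>B h. lred K X B (pull X A B h x))"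
  shows "lred K X A x"
proof -
  have "locally_on K A (\<lambda>B h. chart_red K X B (pull X A B h x))"
    by (rule locally_on_mono[OF A loc]) (simp add: lred_scheme_iff[OF inf X])
  then show ?thesis
      using chart_red_local[OF inf scheme_presheaf[OF X] A x] x lred_scheme_iff[OF inf X A] by blast
qed

text \<open>On a cover the point factors through affine charts of \<open>X\<close>, and these are
  spectra of reduced rings by definition of a reduced scheme.\<close>

lemma reduced_scheme_lred:
  fixes X :: "('k, 'u, 'v) psh"
  assumes inf: "infinite (UNIV :: 'u set)" and X: "reduced_scheme K X" and A: "A \<in> aff K"
      and x: "x \<in> pts X A"
  shows "lred K X A x"
proof -
  have sX: "scheme K X" using X by (simp add: reduced_scheme_def)
  show ?thesis unfolding lred_def
  proof (intro conjI x locally_on_mono[OF A scheme_charts[OF inf sX A x]])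
    fix a B h assume B: "B \<in> aff K"
      and "\<exists>R\<in>aff K. \<exists>j. open_emb K (Spec K R) X j \<and> (\<exists>\<phi>\<in>alg_hom K R B. pull X A B h x = j B \<phi>)"
    then obtain R j \<phi> where R: "R \<in> aff K" "open_emb K (Spec K R) X j" "\<phi> \<in> alg_hom K R B"
        "pull X A B h x = j B \<phi>" by blast
    have "reduced_ring R" using X R(1,2) by (auto simp: reduced_scheme_def)
    then show "red_pt K X B (pull X A B h x)"
      unfolding red_pt_def
          using chart_eq[OF R(2,1) B R(3)] R(1,3,4) yoneda_pt[OF open_emb_psh_map[OF R(2)] R(1)]
          by auto
  qed
qed

section \<open>The closed locus where a point of a scheme is reduced\<close>

lemma locally_on_imageI:
  fixes A :: "('k, 'u) module"
  assumes "infinite (UNIV :: 'u set)" "A \<in> aff K" "B \<in> aff K" "f \<in> alg_hom K A B" "T \<subseteq> carrier A"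
      "Idl\<^bsub>A\<^esub> T = carrier A"
    "\<And>a D l. a \<in> T \<Longrightarrow> D \<in> aff K \<Longrightarrow> localization_map K B (f a) D l \<Longrightarrow> P D l"
  shows "locally_on K B P"
  unfolding locally_on_def
proof (rule Idl_UNIV_mono[OF assms(3) _ _ Idl_UNIV_image[OF assms(2-6)]])
  show "f ` T \<subseteq> {b \<in> carrier B. \<exists>D\<in>aff K. \<exists>l. localization_map K B b D l \<and> P D l}"
  proof
    fix b assume "b \<in> f ` T"
    then obtain a where a: "a \<in> T" "b = f a" by blast
    then have b: "f a \<in> carrier B" using assms(4,5) by blast
    obtain D l where "D \<in> aff K" "localization_map K B (f a) D l"
        using localization_exists[OF assms(1,3) b] .
    then show "b \<in> {b \<in> carrier B. \<exists>D\<in>aff K. \<exists>l. localization_map K B b D l \<and> P D l}"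
      using a b assms(7) by blast
  qed
qed blast

lemma chart_red_pt:
  fixes X :: "('k, 'u, 'v) psh"
  assumes inf: "infinite (UNIV :: 'u set)" and R: "R \<in> aff K" "open_emb K (Spec K R) X j"
      and B: "B \<in> aff K"
    and \<phi>: "\<phi> \<in> alg_hom K R B" "\<And>n. n \<in> nilradical R \<Longrightarrow> \<phi> n = \<zero>\<^bsub>B\<^esub>"
  shows "red_pt K X B (j B \<phi>)"
proof -
  obtain Q q \<psi> where Q: "Q \<in> aff K" "quotient_map K R (nilradical R) Q q" "\<psi> \<in> alg_hom K Q B"
      "\<phi> = compose (carrier R) \<psi> q"
    using nilradical_factor[OF inf R(1) B \<phi>] .
  note q = quotient_map_hom[OF Q(2)]
  have "j B \<phi> = pull X Q B \<psi> (j Q q)"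
    using Q(4) chart_pull[OF R(2) Q(1) B q Q(3)] by simp
  moreover have "j Q q \<in> pts X Q" using psh_map_closed[OF open_emb_psh_map[OF R(2)] Q(1)] q by simp
  ultimately show ?thesis unfolding red_pt_def using Q reduced_quotient[OF R(1) Q(1,2)] by blast
qed

lemma lred_chart_kills:
  fixes X :: "('k, 'u, 'v) psh"
  assumes inf: "infinite (UNIV :: 'u set)" and X: "scheme K X"
      and R: "R \<in> aff K" "open_emb K (Spec K R) X j" and B: "B \<in> aff K"
    and \<phi>: "\<phi> \<in> alg_hom K R B" and l: "lred K X B (j B \<phi>)" and n: "n \<in> nilradical R"
  shows "\<phi> n = \<zero>\<^bsub>B\<^esub>"
proof -
  have "chart_red K X B (j B \<phi>)" "j B \<phi> \<in> pts X B" using l lred_scheme_iff[OF inf X B] by auto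
  then show ?thesis
    using chart_redD[OF _ B alg_hom_id[OF B] R \<phi> _ n] pull_id[OF scheme_presheaf[OF X] B] by blast
qed

text \<open>\<open>Spec Q\<close> is the closed subscheme of the chart \<open>D(a)\<close> of \<open>Spec A\<close> on which the point \<open>z\<close> is
  reduced.\<close>

definition reduced_locus ::
    "'k ring \<Rightarrow> ('k, 'u, 'v) psh \<Rightarrow> ('k, 'u) module \<Rightarrow> 'v \<Rightarrow> 'u \<Rightarrow> ('k, 'u) module \<Rightarrow> ('u \<Rightarrow> 'u) \<Rightarrow> bool"
        where
  "reduced_locus K X A z a Q k \<longleftrightarrow> Q \<in> aff K \<and> k \<in> alg_hom K A Q \<and> lred K X Q (pull X A Q k z) \<and>
    (\<forall>C\<in>aff K. \<forall>\<psi>\<in>alg_hom K A C. \<psi> a \<in> Units C \<longrightarrow> lred K X C (pull X A C \<psi> z) \<longrightarrow>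
       (\<forall>x\<in>carrier A. k x = \<zero>\<^bsub>Q\<^esub> \<longrightarrow> \<psi> x = \<zero>\<^bsub>C\<^esub>)) \<and>
    (\<forall>C\<in>aff K. \<forall>\<psi>\<in>alg_hom K A C. \<psi> a \<in> Units C \<longrightarrow> (\<forall>x\<in>carrier A. k x = \<zero>\<^bsub>Q\<^esub> \<longrightarrow> \<psi> x = \<zero>\<^bsub>C\<^esub>) \<longrightarrow>
       (\<exists>\<psi>'\<in>alg_hom K Q C. \<psi> = compose (carrier A) \<psi>' k))"

text \<open>Over the basic open of \<open>a\<close>, which maps into the chart
  \<open>Spec R\<close>, the locus is cut out by the image of the nilradical of \<open>R\<close>; so
  \<open>Q\<close> is the quotient of \<open>B\<close> by the ideal generated by that image.\<close>

lemma reduced_locus_chart: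
  fixes X :: "('k, 'u, 'v) psh"
  assumes inf: "infinite (UNIV :: 'u set)" and X: "scheme K X" and A: "A \<in> aff K"
      and z: "z \<in> pts X A"
    and a: "a \<in> carrier A" and B: "B \<in> aff K" "localization_map K A a B h"
    and R: "R \<in> aff K" "open_emb K (Spec K R) X j" "\<phi> \<in> alg_hom K R B" "pull X A B h z = j B \<phi>"
  shows "\<exists>Q k. reduced_locus K X A z a Q k"
proof -
  note h = localization_map_hom[OF B(2)] and PX = scheme_presheaf[OF X]
  have nR: "\<phi> ` nilradical R \<subseteq> carrier B" using nilradical_sub[OF R(1)] alg_hom_closed[OF R(3)]
      by blast
  let ?I = "Idl\<^bsub>B\<^esub> (\<phi> ` nilradical R)"
  have I: "ideal ?I B" by (rule ring.genideal_ideal[OF aff_ring[OF B(1)] nR])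
  obtain Q q where Q: "Q \<in> aff K" "quotient_map K B ?I Q q" using quotient_exists[OF inf B(1) I] .
  note q = quotient_map_hom[OF Q(2)]
  define k where "k = compose (carrier A) q h"
  have k: "k \<in> alg_hom K A Q" unfolding k_def by (rule alg_hom_comp[OF A h q])
  have kx: "k x = q (h x)" if "x \<in> carrier A" for x using that by (simp add: k_def compose_def)
  have "q x = \<zero>\<^bsub>Q\<^esub>" if "x \<in> ?I" for x
    using quotient_map_zero[OF Q(2), of x] that ideal_sub[OF I] by blast
  then have qn: "q (\<phi> n) = \<zero>\<^bsub>Q\<^esub>" if "n \<in> nilradical R" for n
    using Idl_kernel[OF B(1) Q(1) q nR] that by blast
  have "pull X A Q k z = j Q (compose (carrier R) q \<phi>)"
    using pull_comp[OF PX A B(1) Q(1) h q z] chart_pull[OF R(2) B(1) Q(1) R(3) q] R(4)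
        by (simp add: k_def)
  moreover have "red_pt K X Q (j Q (compose (carrier R) q \<phi>))"
    using qn nilradical_sub[OF R(1)]
    by (intro chart_red_pt[OF inf R(1,2) Q(1) alg_hom_comp[OF R(1,3) q]]) (auto simp: compose_def)
  ultimately have 1: "lred K X Q (pull X A Q k z)"
    using red_pt_imp_lred[OF inf PX Q(1)] pull_closed[OF PX A Q(1) k z] by simp
  have 2: "\<psi> x = \<zero>\<^bsub>C\<^esub>" if C: "C \<in> aff K" and \<psi>: "\<psi> \<in> alg_hom K A C" "\<psi> a \<in> Units C"
    and l: "lred K X C (pull X A C \<psi> z)" and x: "x \<in> carrier A" "k x = \<zero>\<^bsub>Q\<^esub>" for C \<psi> x
  proof -
    obtain g where g: "g \<in> alg_hom K B C" "compose (carrier A) g h = \<psi>"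
      using localization_factor[OF A B(1) C a B(2) \<psi>] .
    have "pull X A C \<psi> z = j C (compose (carrier R) g \<phi>)"
      using pull_comp[OF PX A B(1) C h g(1) z] chart_pull[OF R(2) B(1) C R(3) g(1)] R(4) g(2)
          by simp
    then have "g (\<phi> n) = \<zero>\<^bsub>C\<^esub>" if "n \<in> nilradical R" for n
      using lred_chart_kills[OF inf X R(1,2) C alg_hom_comp[OF R(1,3) g(1)] _ that] l
          nilradical_sub[OF R(1)] that
      by (auto simp: compose_def)
    then have "\<forall>y\<in>?I. g y = \<zero>\<^bsub>C\<^esub>" using Idl_kernel[OF B(1) C g(1) nR] by blast
    moreover have "h x \<in> ?I" using x kx quotient_map_zero[OF Q(2) alg_hom_closed[OF h x(1)]] by simp
    ultimately have "g (h x) = \<zero>\<^bsub>C\<^esub>" by blast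
    then show ?thesis using g(2) x(1) by (metis compose_eq)
  qed
  have 3: "\<exists>\<psi>'\<in>alg_hom K Q C. \<psi> = compose (carrier A) \<psi>' k" if C: "C \<in> aff K"
      and \<psi>: "\<psi> \<in> alg_hom K A C" "\<psi> a \<in> Units C"
    and ker: "\<forall>x\<in>carrier A. k x = \<zero>\<^bsub>Q\<^esub> \<longrightarrow> \<psi> x = \<zero>\<^bsub>C\<^esub>" for C \<psi>
  proof -
    obtain g where g: "g \<in> alg_hom K B C" "compose (carrier A) g h = \<psi>"
      using localization_factor[OF A B(1) C a B(2) \<psi>] .
    \<comment> \<open>\<open>b\<close> itself need not come from \<open>A\<close>, but its numerator
      \<open>x\<close> does and lies in the kernel of \<open>k\<close>, where the hypothesis on
      \<open>\<psi>\<close> applies.\<close>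
    have "g b = \<zero>\<^bsub>C\<^esub>" if b: "b \<in> ?I" for b
    proof -
      have bc: "b \<in> carrier B" using b ideal_sub[OF I] by blast
      obtain x and n :: nat where x: "x \<in> carrier A" "b \<otimes>\<^bsub>B\<^esub> (h a [^]\<^bsub>B\<^esub> n) = h x"
        using localization_elem[OF B(2) bc] .
      have "q b = \<zero>\<^bsub>Q\<^esub>" using quotient_map_zero[OF Q(2) bc] b by simp
      then have "k x = \<zero>\<^bsub>Q\<^esub>"
          using localization_numerator_zero[OF A B(1) Q(1) a B(2) q bc x] kx[OF x(1)] by simp
      then have "\<psi> x = \<zero>\<^bsub>C\<^esub>" using ker x(1) by blast
      then have "g (h x) = \<zero>\<^bsub>C\<^esub>" using g(2) x(1) by (metis compose_eq)
      then show ?thesis using localization_numerator_zero[OF A B(1) C a B(2) g(1) bc x] by simp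
    qed
    then obtain g' where g': "g' \<in> alg_hom K Q C" "compose (carrier B) g' q = g"
      using quotient_factor[OF B(1) Q(1) C Q(2) g(1)] by metis
    then have "\<psi> = compose (carrier A) g' k" using g(2) alg_hom_comp_assoc[OF h, of g' q]
        by (simp add: k_def)
    with g'(1) show ?thesis by blast
  qed
  have "reduced_locus K X A z a Q k" unfolding reduced_locus_def
    by (intro conjI ballI impI Q(1) k 1, (rule 2, assumption+), (rule 3, assumption+))
  then show ?thesis by blast
qed

text \<open>\<open>I\<close> collects the elements of \<open>A\<close> that vanish on each of the
  finitely many local loci \<open>Spec (Q a)\<close>. That a reduced point kills \<open>I\<close> is
  checked on the cover. Conversely, if \<open>\<phi>\<close> kills \<open>I\<close>, its restriction
  to the basic open of \<open>a\<close> must be shown to kill the kernel of \<open>k a\<close>,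
  which can be larger than \<open>I\<close>; but each of its elements enters \<open>I\<close> after
  multiplication by a power of \<open>a\<close>, and \<open>a\<close> is invertible there.\<close>

lemma reduced_locus_ideal:
  fixes X :: "('k, 'u, 'v) psh"
  assumes inf: "infinite (UNIV :: 'u set)" and X: "scheme K X" and A: "A \<in> aff K"
      and z: "z \<in> pts X A"
  obtains I where "ideal I A"
    "\<forall>B\<in>aff K. \<forall>\<phi>\<in>alg_hom K A B. lred K X B (pull X A B \<phi> z) \<longleftrightarrow> (\<forall>x\<in>I. \<phi> x = \<zero>\<^bsub>B\<^esub>)"
proof -
  interpret A: algebra K A using A by (simp add: aff_def)
  note PX = scheme_presheaf[OF X]
  obtain T B h where T: "finite T" "T \<subseteq> carrier A" "Idl\<^bsub>A\<^esub> T = carrier A"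
    and B: "\<And>a. a \<in> T \<Longrightarrow> B a \<in> aff K" "\<And>a. a \<in> T \<Longrightarrow> localization_map K A a (B a) (h a)"
    and P: "\<And>a. a \<in> T \<Longrightarrow> \<exists>R\<in>aff K. \<exists>j. open_emb K (Spec K R) X j \<and>
        (\<exists>\<phi>\<in>alg_hom K R (B a). pull X A (B a) (h a) z = j (B a) \<phi>)"
    using locally_on_finite[OF A scheme_charts[OF inf X A z]] by metis
  have Tc: "a \<in> carrier A" if "a \<in> T" for a using that T(2) by blast
  have "\<exists>Q k. reduced_locus K X A z a Q k" if a: "a \<in> T" for a
  proof -
    from P[OF a] obtain R j \<phi> where R: "R \<in> aff K" "open_emb K (Spec K R) X j"
        "\<phi> \<in> alg_hom K R (B a)" "pull X A (B a) (h a) z = j (B a) \<phi>" by blast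
    show ?thesis
      by (rule reduced_locus_chart[where B = "B a" and h = "h a" and j = j and R = R and \<phi> = \<phi>,
            OF inf X A z Tc[OF a] B(1)[OF a] B(2)[OF a] R])
  qed
  then obtain Q k where good: "\<And>a. a \<in> T \<Longrightarrow> reduced_locus K X A z a (Q a) (k a)" by metis
  have Q: "Q a \<in> aff K" and k: "k a \<in> alg_hom K A (Q a)"
      and kl: "lred K X (Q a) (pull X A (Q a) (k a) z)" if "a \<in> T" for a
    using good[OF that] by (auto simp: reduced_locus_def)
  have ker: "\<psi> x = \<zero>\<^bsub>C\<^esub>" if "a \<in> T" "C \<in> aff K" "\<psi> \<in> alg_hom K A C" "\<psi> a \<in> Units C"
      "lred K X C (pull X A C \<psi> z)"
    "x \<in> carrier A" "k a x = \<zero>\<^bsub>Q a\<^esub>" for a C \<psi> x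
    using good[OF that(1)] that(2-) unfolding reduced_locus_def by blast
  have fac: "\<exists>\<psi>'\<in>alg_hom K (Q a) C. \<psi> = compose (carrier A) \<psi>' (k a)"
      if "a \<in> T" "C \<in> aff K" "\<psi> \<in> alg_hom K A C" "\<psi> a \<in> Units C"
    "\<forall>x\<in>carrier A. k a x = \<zero>\<^bsub>Q a\<^esub> \<longrightarrow> \<psi> x = \<zero>\<^bsub>C\<^esub>" for a C \<psi>
    using good[OF that(1)] that(2-) unfolding reduced_locus_def by blast
  have khom: "ring_hom_cring A (Q a) (k a)" if "a \<in> T" for a
      by (rule alg_hom_ring_hom_cring[OF A Q[OF that] k[OF that]])
  define I where "I = {x \<in> carrier A. \<forall>a\<in>T. k a x = \<zero>\<^bsub>Q a\<^esub>}"
  have kid: "ideal {x \<in> carrier A. k a x = \<zero>\<^bsub>Q a\<^esub>} A" if "a \<in> T" for a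
      by (rule kernel_ideal[OF A Q[OF that] k[OF that]])
  have id: "ideal I A"
  proof (rule cring_idealI[OF A.cring_axioms])
    show "I \<subseteq> carrier A" by (auto simp: I_def)
    show "\<zero>\<^bsub>A\<^esub> \<in> I" using ideal_zero[OF kid] by (auto simp: I_def)
    show "x \<oplus>\<^bsub>A\<^esub> y \<in> I" if "x \<in> I" "y \<in> I" for x y using ideal_add[OF kid, of _ x y] that
        by (auto simp: I_def)
    show "r \<otimes>\<^bsub>A\<^esub> x \<in> I" if "r \<in> carrier A" "x \<in> I" for r x
        using ideal.I_l_closed[OF kid, of _ x r] that by (auto simp: I_def)
  qed
  have "lred K X C (pull X A C \<phi> z) \<longleftrightarrow> (\<forall>x\<in>I. \<phi> x = \<zero>\<^bsub>C\<^esub>)" if C: "C \<in> aff K"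
      and \<phi>: "\<phi> \<in> alg_hom K A C" for C \<phi>
  proof
    assume l: "lred K X C (pull X A C \<phi> z)"
    show "\<forall>x\<in>I. \<phi> x = \<zero>\<^bsub>C\<^esub>"
    proof
      fix x assume x: "x \<in> I"
      have xc: "x \<in> carrier A" using x by (simp add: I_def)
      have "locally_on K C (\<lambda>D l. l (\<phi> x) = \<zero>\<^bsub>D\<^esub>)"
      proof (rule locally_on_imageI[OF inf A C \<phi> T(2,3)])
        fix a D d assume a: "a \<in> T" and D: "D \<in> aff K" "localization_map K C (\<phi> a) D d"
        note d = localization_map_hom[OF D(2)]
        have "compose (carrier A) d \<phi> a \<in> Units D" using localization_map_Units[OF D(2)] Tc[OF a]
            by (simp add: compose_def)
        moreover have "lred K X D (pull X A D (compose (carrier A) d \<phi>) z)"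
          using lred_scheme_pull[OF inf X C D(1) d l] pull_comp[OF PX A C D(1) \<phi> d z] by simp
        moreover have "k a x = \<zero>\<^bsub>Q a\<^esub>" using x a by (simp add: I_def)
        ultimately have "compose (carrier A) d \<phi> x = \<zero>\<^bsub>D\<^esub>"
            using ker[OF a D(1) alg_hom_comp[OF A \<phi> d]] xc by blast
        then show "d (\<phi> x) = \<zero>\<^bsub>D\<^esub>" using xc by (simp add: compose_def)
      qed
      then show "\<phi> x = \<zero>\<^bsub>C\<^esub>" by (rule locally_on_zero[OF C alg_hom_closed[OF \<phi> xc]])
    qed
  next
    assume kill: "\<forall>x\<in>I. \<phi> x = \<zero>\<^bsub>C\<^esub>"
    show "lred K X C (pull X A C \<phi> z)"
    proof (rule lred_scheme_local[OF inf X C pull_closed[OF PX A C \<phi> z]], rule locally_on_imageI[OF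
        inf A C \<phi> T(2,3)])
      fix a D d assume a: "a \<in> T" and D: "D \<in> aff K" "localization_map K C (\<phi> a) D d"
      note d = localization_map_hom[OF D(2)]
      define \<psi> where "\<psi> = compose (carrier A) d \<phi>"
      have \<psi>: "\<psi> \<in> alg_hom K A D" unfolding \<psi>_def by (rule alg_hom_comp[OF A \<phi> d])
      interpret \<psi>: ring_hom_cring A D \<psi> by (rule alg_hom_ring_hom_cring[OF A D(1) \<psi>])
      have \<psi>a: "\<psi> a \<in> Units D" using localization_map_Units[OF D(2)] Tc[OF a]
          by (simp add: \<psi>_def compose_def)
      have "\<psi> x = \<zero>\<^bsub>D\<^esub>" if x: "x \<in> carrier A" "k a x = \<zero>\<^bsub>Q a\<^esub>" for x
      proof -
        \<comment> \<open>Inverting \<open>a\<close> on the locus over the basic open of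
          \<open>b\<close> gives a reduced point at which \<open>a\<close> is a unit. It kills
          \<open>x\<close> by the property of \<open>k a\<close>, so a power of \<open>a\<close>
          times \<open>x\<close> vanishes in \<open>Q b\<close>.\<close>
        have "\<exists>N::nat. \<forall>M\<ge>N. k b (a [^]\<^bsub>A\<^esub> M \<otimes>\<^bsub>A\<^esub> x) = \<zero>\<^bsub>Q b\<^esub>" if b: "b \<in> T" for b
        proof -
          interpret k: ring_hom_cring A "Q b" "k b" by (rule khom[OF b])
          have kba: "k b a \<in> carrier (Q b)" using Tc[OF a] by simp
          obtain E e where E: "E \<in> aff K" "localization_map K (Q b) (k b a) E e"
              using localization_exists[OF inf Q[OF b] kba] .
          note e = localization_map_hom[OF E(2)]
          have "compose (carrier A) e (k b) a \<in> Units E"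
              using localization_map_Units[OF E(2)] Tc[OF a] by (simp add: compose_def)
          moreover have "lred K X E (pull X A E (compose (carrier A) e (k b)) z)"
            using lred_scheme_pull[OF inf X Q[OF b] E(1) e kl[OF b]] pull_comp[OF PX A Q[OF b] E(1)
                k[OF b] e z] by simp
          ultimately have "compose (carrier A) e (k b) x = \<zero>\<^bsub>E\<^esub>"
            using ker[OF a E(1) alg_hom_comp[OF A k[OF b] e]] x by blast
          then have "e (k b x) = \<zero>\<^bsub>E\<^esub>" using x(1) by (simp add: compose_def)
          then obtain N :: nat where N: "k b a [^]\<^bsub>Q b\<^esub> N \<otimes>\<^bsub>Q b\<^esub> k b x = \<zero>\<^bsub>Q b\<^esub>"
            using localization_zero_iff[OF Q[OF b] E(1) kba E(2), of "k b x"] x(1) by auto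
          have "k b (a [^]\<^bsub>A\<^esub> M \<otimes>\<^bsub>A\<^esub> x) = \<zero>\<^bsub>Q b\<^esub>" if M: "M \<ge> N" for M
          proof -
            have "k b (a [^]\<^bsub>A\<^esub> M \<otimes>\<^bsub>A\<^esub> x) = k b a [^]\<^bsub>Q b\<^esub> ((M - N) + N) \<otimes>\<^bsub>Q b\<^esub> k b x"
              using x(1) Tc[OF a] M by (simp add: alg_hom_pow[OF A Q[OF b] k[OF b]])
            also have "\<dots> = k b a [^]\<^bsub>Q b\<^esub> (M - N) \<otimes>\<^bsub>Q b\<^esub> (k b a [^]\<^bsub>Q b\<^esub> N \<otimes>\<^bsub>Q b\<^esub> k b x)"
              using x(1) kba
                  by (simp only: k.S.nat_pow_mult[symmetric] k.S.m_assoc k.S.nat_pow_closed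
                  k.hom_closed)
            finally show ?thesis using N kba by simp
          qed
          then show ?thesis by blast
        qed
        then have "\<forall>b\<in>T. \<exists>N::nat. \<forall>M\<ge>N. k b (a [^]\<^bsub>A\<^esub> M \<otimes>\<^bsub>A\<^esub> x) = \<zero>\<^bsub>Q b\<^esub>" by (rule ballI)
        from bchoice[OF this] obtain N :: "'u \<Rightarrow> nat"
          where N: "\<forall>b\<in>T. \<forall>M\<ge>N b. k b (a [^]\<^bsub>A\<^esub> M \<otimes>\<^bsub>A\<^esub> x) = \<zero>\<^bsub>Q b\<^esub>" by (rule exE)
        define M where "M = Max (N ` T)"
        have "N b \<le> M" if "b \<in> T" for b using T(1) that by (simp add: M_def)
        then have "\<forall>b\<in>T. k b (a [^]\<^bsub>A\<^esub> M \<otimes>\<^bsub>A\<^esub> x) = \<zero>\<^bsub>Q b\<^esub>" using N by simp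
        then have "a [^]\<^bsub>A\<^esub> M \<otimes>\<^bsub>A\<^esub> x \<in> I" using x(1) Tc[OF a] by (simp add: I_def)
        then have "\<phi> (a [^]\<^bsub>A\<^esub> M \<otimes>\<^bsub>A\<^esub> x) = \<zero>\<^bsub>C\<^esub>" using kill by blast
        then have "\<psi> (a [^]\<^bsub>A\<^esub> M \<otimes>\<^bsub>A\<^esub> x) = \<zero>\<^bsub>D\<^esub>"
          using x(1) Tc[OF a] alg_hom_zero[OF C D(1) d] unfolding \<psi>_def by (simp add: compose_def)
        then have "\<psi> a [^]\<^bsub>D\<^esub> M \<otimes>\<^bsub>D\<^esub> \<psi> x = \<psi> a [^]\<^bsub>D\<^esub> M \<otimes>\<^bsub>D\<^esub> \<zero>\<^bsub>D\<^esub>"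
          using x(1) Tc[OF a] by (simp add: alg_hom_pow[OF A D(1) \<psi>])
        then show ?thesis
          using \<psi>.S.Units_l_cancel[OF \<psi>.S.Units_pow[OF \<psi>a, of M], of "\<psi> x" "\<zero>\<^bsub>D\<^esub>"] x(1) by simp
      qed
      then obtain \<psi>' where \<psi>': "\<psi>' \<in> alg_hom K (Q a) D" "\<psi> = compose (carrier A) \<psi>' (k a)"
        using fac[OF a D(1) \<psi> \<psi>a] by blast
      have "lred K X D (pull X A D \<psi> z)"
        using lred_scheme_pull[OF inf X Q[OF a] D(1) \<psi>'(1) kl[OF a]] pull_comp[OF PX A Q[OF a] D(1)
            k[OF a] \<psi>'(1) z] \<psi>'(2) by simp
      then show "lred K X D (pull X C D d (pull X A C \<phi> z))"
        using pull_comp[OF PX A C D(1) \<phi> d z] by (simp add: \<psi>_def)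
    qed
  qed
  with id that show thesis by blast
qed

section \<open>Isomorphism invariance\<close>

lemma psh_iso_inverse:
  assumes "psh_iso K F G \<alpha>"
  obtains \<beta> where "psh_iso K G F \<beta>" "\<And>A x. A \<in> aff K \<Longrightarrow> x \<in> pts F A \<Longrightarrow> \<beta> A (\<alpha> A x) = x"
    "\<And>A y. A \<in> aff K \<Longrightarrow> y \<in> pts G A \<Longrightarrow> \<alpha> A (\<beta> A y) = y"
proof -
  have \<alpha>: "psh_map K F G \<alpha>" "\<And>A. A \<in> aff K \<Longrightarrow> bij_betw (\<alpha> A) (pts F A) (pts G A)"
    using assms by (auto simp: psh_iso_def)
  define \<beta> where "\<beta> A = inv_into (pts F A) (\<alpha> A)" for A
  have bij: "bij_betw (\<beta> A) (pts G A) (pts F A)" if "A \<in> aff K" for A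
    unfolding \<beta>_def by (rule bij_betw_inv_into[OF \<alpha>(2)[OF that]])
  have 1: "\<beta> A (\<alpha> A x) = x" if "A \<in> aff K" "x \<in> pts F A" for A x
    unfolding \<beta>_def by (rule bij_betw_inv_into_left[OF \<alpha>(2)[OF that(1)] that(2)])
  have 2: "\<alpha> A (\<beta> A y) = y" if "A \<in> aff K" "y \<in> pts G A" for A y
    unfolding \<beta>_def by (rule bij_betw_inv_into_right[OF \<alpha>(2)[OF that(1)] that(2)])
  have c: "\<beta> A y \<in> pts F A" if "A \<in> aff K" "y \<in> pts G A" for A y
    using bij[OF that(1)] that(2) by (rule bij_betwE[rule_format])
  have "psh_map K G F \<beta>"
  proof (rule psh_mapI[OF psh_map_presheaf(2)[OF \<alpha>(1)] psh_map_presheaf(1)[OF \<alpha>(1)] c])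
    fix A B f y assume A: "A \<in> aff K" "B \<in> aff K" "f \<in> alg_hom K A B" "y \<in> pts G A"
    have "\<beta> B (pull G A B f y) = \<beta> B (\<alpha> B (pull F A B f (\<beta> A y)))"
      using psh_map_pull[OF \<alpha>(1) A(1-3) c[OF A(1,4)]] 2[OF A(1,4)] by simp
    then show "\<beta> B (pull G A B f y) = pull F A B f (\<beta> A y)"
      using 1[OF A(2) pull_closed[OF psh_map_presheaf(1)[OF \<alpha>(1)] A(1-3) c[OF A(1,4)]]] by simp
  qed
  then have "psh_iso K G F \<beta>" using bij by (simp add: psh_iso_def)
  with 1 2 that show thesis by blast
qed

lemma psh_iso_psh_map: "psh_iso K F G \<alpha> \<Longrightarrow> psh_map K F G \<alpha>"
  by (simp add: psh_iso_def)

lemma psh_iso_inj: "psh_iso K F G \<alpha> \<Longrightarrow> A \<in> aff K \<Longrightarrow> inj_on (\<alpha> A) (pts F A)"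
  by (simp add: psh_iso_def bij_betw_def)

lemma psh_iso_image: "psh_iso K F G \<alpha> \<Longrightarrow> A \<in> aff K \<Longrightarrow> \<alpha> A ` pts F A = pts G A"
  by (simp add: psh_iso_def bij_betw_def)

lemma open_emb_iso:
  assumes j: "open_emb K U F j" and "psh_iso K F G \<alpha>"
  shows "open_emb K U G (psh_comp \<alpha> j)"
proof -
  note \<alpha> = psh_iso_psh_map[OF assms(2)] and jm = open_emb_psh_map[OF j]
  obtain \<beta> where \<beta>: "psh_iso K G F \<beta>" "\<And>A x. A \<in> aff K \<Longrightarrow> x \<in> pts F A \<Longrightarrow> \<beta> A (\<alpha> A x) = x"
    "\<And>A y. A \<in> aff K \<Longrightarrow> y \<in> pts G A \<Longrightarrow> \<alpha> A (\<beta> A y) = y" using psh_iso_inverse[OF assms(2)] by metis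
  show ?thesis
    unfolding open_emb_def
  proof (intro conjI ballI psh_map_comp[OF jm \<alpha>])
    show "inj_on (psh_comp \<alpha> j A) (pts U A)" if A: "A \<in> aff K" for A
    proof (rule inj_onI)
      fix x y assume xy: "x \<in> pts U A" "y \<in> pts U A" "psh_comp \<alpha> j A x = psh_comp \<alpha> j A y"
      then have "j A x = j A y"
        using inj_onD[OF psh_iso_inj[OF assms(2) A], of "j A x" "j A y"] psh_map_closed[OF jm A]
            by (simp add: psh_comp_def)
      moreover have "inj_on (j A) (pts U A)" using j A by (simp add: open_emb_def)
      ultimately show "x = y" using xy by (meson inj_onD)
    qed
    fix A y assume A: "A \<in> aff K" and y: "y \<in> pts G A"
    have by': "\<beta> A y \<in> pts F A" by (rule psh_map_closed[OF psh_iso_psh_map[OF \<beta>(1)] A y])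
    then obtain I where I: "ideal I A" "\<forall>B\<in>aff K. \<forall>f\<in>alg_hom K A B.
        pull F A B f (\<beta> A y) \<in> j B ` pts U B \<longleftrightarrow> Idl\<^bsub>B\<^esub> (f ` I) = carrier B"
      using j A unfolding open_emb_def by blast
    have "pull G A B f y \<in> psh_comp \<alpha> j B ` pts U B \<longleftrightarrow> pull F A B f (\<beta> A y) \<in> j B ` pts U B"
      if B: "B \<in> aff K" and f: "f \<in> alg_hom K A B" for B f
    proof -
      let ?z = "pull F A B f (\<beta> A y)"
      have z: "?z \<in> pts F B" by (rule pull_closed[OF psh_map_presheaf(1)[OF \<alpha>] A B f by'])
      have "pull G A B f y = \<alpha> B ?z" using psh_map_pull[OF \<alpha> A B f by'] \<beta>(3)[OF A y] by simp
      moreover have "\<alpha> B ?z = \<alpha> B (j B u) \<longleftrightarrow> ?z = j B u" if "u \<in> pts U B" for u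
        using inj_onD[OF psh_iso_inj[OF assms(2) B] _ z psh_map_closed[OF jm B that]] by auto
      ultimately show ?thesis by (auto simp: psh_comp_def image_iff)
    qed
    then show "\<exists>I. ideal I A \<and> (\<forall>B\<in>aff K. \<forall>f\<in>alg_hom K A B.
        pull G A B f y \<in> psh_comp \<alpha> j B ` pts U B \<longleftrightarrow> Idl\<^bsub>B\<^esub> (f ` I) = carrier B)"
      using I(2) by (intro exI[of _ I] conjI ballI I(1)) simp
  qed
qed

section \<open>Transport of the sheaf and scheme conditions along isomorphisms\<close>

definition gluing_data ::
    "'k ring \<Rightarrow> ('k, 'u, 'v) psh \<Rightarrow> ('k, 'u) module \<Rightarrow> 'u set \<Rightarrow> ('u \<Rightarrow> ('k, 'u) module) \<Rightarrow> ('u \<Rightarrow> 'u \<Rightarrow> 'u)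
        \<Rightarrow> ('u \<Rightarrow> 'v) \<Rightarrow> bool" where
  "gluing_data K F A T B h s \<longleftrightarrow>
        finite T \<and> T \<subseteq> carrier A \<and> Idl\<^bsub>A\<^esub> T = carrier A \<and>
        (\<forall>a\<in>T. B a \<in> aff K \<and> localization_map K A a (B a) (h a) \<and> s a \<in> pts F (B a)) \<and>
        (\<forall>a\<in>T. \<forall>b\<in>T. \<forall>C\<in>aff K. \<forall>p\<in>alg_hom K (B a) C. \<forall>q\<in>alg_hom K (B b) C.
           compose (carrier A) p (h a) = compose (carrier A) q (h b) \<longrightarrow>
           pull F (B a) C p (s a) = pull F (B b) C q (s b))"

lemma zariski_sheaf_iff:
  "zariski_sheaf K F \<longleftrightarrow> presheaf K F \<and> (\<forall>A\<in>aff K. \<forall>T B h s. gluing_data K F A T B h s \<longrightarrow>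
     (\<exists>!x. x \<in> pts F A \<and> (\<forall>a\<in>T. pull F A (B a) (h a) x = s a)))"
  unfolding zariski_sheaf_def gluing_data_def by (rule refl)

lemma gluing_dataD:
  assumes "gluing_data K F A T B h s"
  shows "finite T" "T \<subseteq> carrier A" "Idl\<^bsub>A\<^esub> T = carrier A"
    and "\<And>a. a \<in> T \<Longrightarrow> B a \<in> aff K" "\<And>a. a \<in> T \<Longrightarrow> localization_map K A a (B a) (h a)"
    and "\<And>a. a \<in> T \<Longrightarrow> s a \<in> pts F (B a)"
  using assms unfolding gluing_data_def by simp_all

lemma gluing_data_map:
  assumes "gluing_data K F A T B h s" "psh_map K F G \<alpha>"
  shows "gluing_data K G A T B h (\<lambda>a. \<alpha> (B a) (s a))"
  unfolding gluing_data_def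
proof (intro conjI ballI impI)
  note g = assms(1)[unfolded gluing_data_def]
  show "finite T" "T \<subseteq> carrier A" "Idl\<^bsub>A\<^esub> T = carrier A" by (rule gluing_dataD[OF assms(1)])+
  show "B a \<in> aff K" "localization_map K A a (B a) (h a)" "\<alpha> (B a) (s a) \<in> pts G (B a)" if "a \<in> T"
      for a
    using gluing_dataD(4-6)[OF assms(1) that] psh_map_closed[OF assms(2)] by simp_all
  fix a b C p q assume a: "a \<in> T" "b \<in> T" "C \<in> aff K" "p \<in> alg_hom K (B a) C"
      "q \<in> alg_hom K (B b) C"
    "compose (carrier A) p (h a) = compose (carrier A) q (h b)"
  have B: "B a \<in> aff K" "B b \<in> aff K" "s a \<in> pts F (B a)" "s b \<in> pts F (B b)"
    using gluing_dataD(4,6)[OF assms(1)] a(1,2) by simp_all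
  have "pull F (B a) C p (s a) = pull F (B b) C q (s b)"
    by (rule g[THEN conjunct2, THEN conjunct2, THEN conjunct2, THEN conjunct2, rule_format, OF a])
  then show "pull G (B a) C p (\<alpha> (B a) (s a)) = pull G (B b) C q (\<alpha> (B b) (s b))"
    using psh_map_pull[OF assms(2) B(1) a(3,4) B(3)] psh_map_pull[OF assms(2) B(2) a(3,5) B(4)]
        by simp
qed

lemma zariski_sheaf_iso:
  assumes F: "zariski_sheaf K F" and iso: "psh_iso K F G \<alpha>"
  shows "zariski_sheaf K G"
  unfolding zariski_sheaf_iff
proof (intro conjI ballI allI impI)
  note \<alpha> = psh_iso_psh_map[OF iso]
  obtain \<beta> where \<beta>: "psh_iso K G F \<beta>" "\<And>A x. A \<in> aff K \<Longrightarrow> x \<in> pts F A \<Longrightarrow> \<beta> A (\<alpha> A x) = x"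
    "\<And>A y. A \<in> aff K \<Longrightarrow> y \<in> pts G A \<Longrightarrow> \<alpha> A (\<beta> A y) = y" using psh_iso_inverse[OF iso] by metis
  note \<beta>m = psh_iso_psh_map[OF \<beta>(1)]
  show "presheaf K G" by (rule psh_map_presheaf(2)[OF \<alpha>])
  fix A T B h s assume A: "A \<in> aff K" and g: "gluing_data K G A T B h s"
  from F gluing_data_map[OF g \<beta>m] A
  have "\<exists>!x. x \<in> pts F A \<and> (\<forall>a\<in>T. pull F A (B a) (h a) x = \<beta> (B a) (s a))"
      unfolding zariski_sheaf_iff by simp
  then obtain x where x: "x \<in> pts F A" "\<forall>a\<in>T. pull F A (B a) (h a) x = \<beta> (B a) (s a)"
    and uniq: "\<And>x'. x' \<in> pts F A \<Longrightarrow> \<forall>a\<in>T. pull F A (B a) (h a) x' = \<beta> (B a) (s a) \<Longrightarrow> x' = x" by auto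
  have B: "B a \<in> aff K" "h a \<in> alg_hom K A (B a)" "s a \<in> pts G (B a)" if "a \<in> T" for a
    using gluing_dataD(4-6)[OF g that] localization_map_hom by simp_all
  show "\<exists>!y. y \<in> pts G A \<and> (\<forall>a\<in>T. pull G A (B a) (h a) y = s a)"
  proof (rule ex1I[of _ "\<alpha> A x"])
    show "\<alpha> A x \<in> pts G A \<and> (\<forall>a\<in>T. pull G A (B a) (h a) (\<alpha> A x) = s a)"
      using psh_map_closed[OF \<alpha> A x(1)] psh_map_pull[OF \<alpha> A B(1,2) x(1)] x(2) \<beta>(3)[OF B(1,3)]
          by metis
    fix y assume y: "y \<in> pts G A \<and> (\<forall>a\<in>T. pull G A (B a) (h a) y = s a)"
    have "\<forall>a\<in>T. pull F A (B a) (h a) (\<beta> A y) = \<beta> (B a) (s a)"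
      using psh_map_pull[OF \<beta>m A B(1,2)] y by metis
    then have "\<beta> A y = x" using uniq psh_map_closed[OF \<beta>m A] y by blast
    then show "y = \<alpha> A x" using \<beta>(3)[OF A] y by metis
  qed
qed

text \<open>A closed subfunctor of an affine scheme is only isomorphic to some
  \<open>Spec Q\<close>, not equal to it; this makes it a scheme nevertheless.\<close>

lemma scheme_iso:
  assumes F: "scheme K F" and iso: "psh_iso K F G \<alpha>"
  shows "scheme K G"
  unfolding scheme_def
proof (intro conjI ballI impI)
  show "zariski_sheaf K G" using zariski_sheaf_iso[OF _ iso] F by (simp add: scheme_def)
  fix L y assume L: "L \<in> aff K" "field L" "y \<in> pts G L"
  then obtain x where x: "x \<in> pts F L" "y = \<alpha> L x" using psh_iso_image[OF iso L(1)] by blast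
  then obtain A j where A: "A \<in> aff K" "open_emb K (Spec K A) F j" "x \<in> j L ` pts (Spec K A) L"
    using F L unfolding scheme_def by blast
  have "y \<in> psh_comp \<alpha> j L ` pts (Spec K A) L" using A(3) x(2) by (auto simp: psh_comp_def)
  then show "\<exists>A\<in>aff K. \<exists>j. open_emb K (Spec K A) G j \<and> y \<in> j L ` pts (Spec K A) L"
    using A(1) open_emb_iso[OF A(2) iso] by blast
qed

text \<open>It permits retagging the values of a reduced scheme, so as to place it in the type over
  which \<open>reduction\<close> quantifies.\<close>

lemma reduced_scheme_iso:
  assumes F: "reduced_scheme K F" and iso: "psh_iso K F G \<alpha>"
  shows "reduced_scheme K G"
proof -
  obtain \<beta> where \<beta>: "psh_iso K G F \<beta>" using psh_iso_inverse[OF iso] by metis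
  have "reduced_ring A" if "A \<in> aff K" "open_emb K (Spec K A) G j" for A j
    using F open_emb_iso[OF that(2) \<beta>] that(1) unfolding reduced_scheme_def by blast
  then show ?thesis using scheme_iso[OF _ iso] F by (simp add: reduced_scheme_def)
qed


section \<open>The reduced subscheme\<close>

lemma presheaf_reduced_subscheme:
  fixes X :: "('k, 'u, 'v) psh"
  assumes inf: "infinite (UNIV :: 'u set)" and X: "scheme K X"
  shows "presheaf K (sub_psh X (lred K X))"
  by (rule presheaf_sub_psh[OF scheme_presheaf[OF X]]) (rule lred_scheme_pull[OF inf X])

text \<open>The reduced points in the chart \<open>Spec R\<close> are the points of
  \<open>Spec Q\<close> for the reduced quotient \<open>Q\<close> of \<open>R\<close>. A reduced
  point that lands in \<open>Spec R\<close> lands in \<open>Spec Q\<close>, so the ideal that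
  describes the open preimage for \<open>j\<close> serves here too.\<close>

lemma reduced_chart:
  fixes X :: "('k, 'u, 'v) psh"
  assumes inf: "infinite (UNIV :: 'u set)" and X: "scheme K X"
      and R: "R \<in> aff K" "open_emb K (Spec K R) X j"
    and Q: "Q \<in> aff K" "quotient_map K R (nilradical R) Q q"
  shows "open_emb K (Spec K Q) (sub_psh X (lred K X)) (\<lambda>B \<psi>. j B (compose (carrier R) \<psi> q))"
    (is "open_emb K _ ?X ?j")
proof -
  note q = quotient_map_hom[OF Q(2)] and jm = open_emb_psh_map[OF R(2)]
      and PX = scheme_presheaf[OF X]
  have c: "compose (carrier R) \<psi> q \<in> alg_hom K R B" if "\<psi> \<in> alg_hom K Q B" for B \<psi>
      by (rule alg_hom_comp[OF R(1) q that])
  have k: "compose (carrier R) \<psi> q n = \<zero>\<^bsub>B\<^esub>" if "B \<in> aff K" "\<psi> \<in> alg_hom K Q B" "n \<in> nilradical R"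
      for B \<psi> n
  proof -
    have "q n = \<zero>\<^bsub>Q\<^esub>"
        by (rule reduced_kills_nilradical[OF R(1) Q(1) q reduced_quotient[OF R(1) Q] that(3)])
    moreover have "n \<in> carrier R" using that(3) nilradical_sub[OF R(1)] by blast
    ultimately show ?thesis using alg_hom_zero[OF Q(1) that(1,2)] by (simp add: compose_def)
  qed
  have cl: "?j B \<psi> \<in> pts ?X B" if B: "B \<in> aff K" and \<psi>: "\<psi> \<in> alg_hom K Q B" for B \<psi>
  proof -
    have "?j B \<psi> \<in> pts X B" using psh_map_closed[OF jm B] c[OF \<psi>] by simp
    then show ?thesis
      using red_pt_imp_lred[OF inf PX B] chart_red_pt[OF inf R B c[OF \<psi>] k[OF B \<psi>]] by simp
  qed
  show ?thesis
    unfolding open_emb_def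
  proof (intro conjI ballI)
    show "psh_map K (Spec K Q) ?X ?j"
    proof (rule psh_mapI[OF presheaf_Spec[OF Q(1)] presheaf_reduced_subscheme[OF inf X]])
      show "?j B \<psi> \<in> pts ?X B" if "B \<in> aff K" "\<psi> \<in> pts (Spec K Q) B" for B \<psi> using cl that by simp
      fix A B f \<psi> assume A: "A \<in> aff K" "B \<in> aff K" "f \<in> alg_hom K A B" "\<psi> \<in> pts (Spec K Q) A"
      then show "?j B (pull (Spec K Q) A B f \<psi>) = pull ?X A B f (?j A \<psi>)"
        using chart_pull[OF R(2) A(1,2) c A(3)] by (simp add: alg_hom_comp_assoc[OF q])
    qed
    show "inj_on (?j A) (pts (Spec K Q) A)" if A: "A \<in> aff K" for A
    proof (rule inj_onI)
      fix \<psi> \<psi>' assume "\<psi> \<in> pts (Spec K Q) A" "\<psi>' \<in> pts (Spec K Q) A" and e: "?j A \<psi> = ?j A \<psi>'"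
      then have \<psi>: "\<psi> \<in> alg_hom K Q A" "\<psi>' \<in> alg_hom K Q A" by simp_all
      have "compose (carrier R) \<psi> q = compose (carrier R) \<psi>' q"
        by (rule chart_inj[OF R(2) A c[OF \<psi>(1)] c[OF \<psi>(2)]]) (use e in simp)
      then show "\<psi> = \<psi>'" by (rule quotient_epi[OF R(1) Q(1) A Q(2) \<psi>])
    qed
    fix A x assume A: "A \<in> aff K" and "x \<in> pts ?X A"
    then have x: "x \<in> pts X A" "lred K X A x" by auto
    obtain I where I: "ideal I A" "\<forall>B\<in>aff K. \<forall>f\<in>alg_hom K A B.
      (\<exists>\<phi>\<in>alg_hom K R B. pull X A B f x = j B \<phi>) \<longleftrightarrow> Idl\<^bsub>B\<^esub> (f ` I) = carrier B"
      using chart_ideal[OF R(2) A x(1)] .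
    have "pull ?X A B f x \<in> ?j B ` pts (Spec K Q) B \<longleftrightarrow> (\<exists>\<phi>\<in>alg_hom K R B. pull X A B f x = j B \<phi>)"
      if B: "B \<in> aff K" and f: "f \<in> alg_hom K A B" for B f
    proof
      assume "\<exists>\<phi>\<in>alg_hom K R B. pull X A B f x = j B \<phi>"
      then obtain \<phi> where \<phi>: "\<phi> \<in> alg_hom K R B" "pull X A B f x = j B \<phi>" by blast
      have "lred K X B (j B \<phi>)" using lred_scheme_pull[OF inf X A B f x(2)] \<phi>(2) by simp
      then have "\<phi> n = \<zero>\<^bsub>B\<^esub>" if "n \<in> nilradical R" for n
          by (rule lred_chart_kills[OF inf X R B \<phi>(1) _ that])
      then obtain \<psi> where "\<psi> \<in> alg_hom K Q B" "compose (carrier R) \<psi> q = \<phi>"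
        using quotient_factor[OF R(1) Q(1) B Q(2) \<phi>(1)] by metis
      then show "pull ?X A B f x \<in> ?j B ` pts (Spec K Q) B" using \<phi>(2) by auto
    qed (use c in auto)
    then show "\<exists>I. ideal I A \<and> (\<forall>B\<in>aff K. \<forall>f\<in>alg_hom K A B.
        pull ?X A B f x \<in> ?j B ` pts (Spec K Q) B \<longleftrightarrow> Idl\<^bsub>B\<^esub> (f ` I) = carrier B)"
      using I(2) by (intro exI[of _ I] conjI ballI I(1)) simp
  qed
qed

text \<open>The tautological point of the chart is locally reduced, so by \<open>chart_red\<close>,
  applied to the chart itself, the identity of \<open>A\<close> kills the nilradical and with it
  every nilpotent element.\<close>

lemma reduced_of_open_emb:
  fixes F :: "('k, 'u, 'v) psh"
  assumes inf: "infinite (UNIV :: 'u set)" and F: "presheaf K F"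
      and A: "A \<in> aff K" "open_emb K (Spec K A) F j"
    and l: "\<And>x. x \<in> pts F A \<Longrightarrow> lred K F A x"
  shows "reduced_ring A"
  unfolding reduced_ring_def
proof (intro ballI allI impI)
  fix a and n :: nat assume a: "a \<in> carrier A" "a [^]\<^bsub>A\<^esub> n = \<zero>\<^bsub>A\<^esub>"
  let ?i = "\<lambda>a\<in>carrier A. a"
  have x: "j A ?i \<in> pts F A" using yoneda_pt[OF open_emb_psh_map[OF A(2)] A(1)] .
  have "locally_on K A (\<lambda>B h. red_pt K F B (pull F A B h (j A ?i)))" using l[OF x]
      by (simp add: lred_def)
  then have "locally_on K A (\<lambda>B h. chart_red K F B (pull F A B h (j A ?i)))"
    by (rule locally_on_mono[OF A(1)]) (rule red_pt_imp_chart_red[OF inf F])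
  then have cr: "chart_red K F A (j A ?i)" by (rule chart_red_local[OF inf F A(1) x])
  have n: "a \<in> nilradical A"
    using nilradical_pow[OF a(1), of n] a(2) ideal_zero[OF nilradical_ideal[OF A(1)]] by simp
  have "?i a = \<zero>\<^bsub>A\<^esub>"
    by (rule chart_redD[where h = ?i and \<phi> = ?i and j = j
        and R = A, OF cr A(1) alg_hom_id[OF A(1)] A alg_hom_id[OF A(1)] pull_id[OF F A(1) x] n])
  then show "a = \<zero>\<^bsub>A\<^esub>" using a(1) by simp
qed

text \<open>Sections glue because \<open>lred\<close> is local on a scheme, and
  \<open>reduced_chart\<close> supplies the charts. For reducedness the points must be locally
  reduced in the subscheme itself and not just in \<open>X\<close>.\<close>

lemma reduced_subscheme:
  fixes X :: "('k, 'u, 'v) psh"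
  assumes inf: "infinite (UNIV :: 'u set)" and X: "scheme K X"
  shows "reduced_scheme K (sub_psh X (lred K X))"
proof -
  let ?X = "sub_psh X (lred K X)"
  note PX = scheme_presheaf[OF X]
  have P: "presheaf K ?X" by (rule presheaf_reduced_subscheme[OF inf X])
  \<comment> \<open>The point \<open>y\<close> behind \<open>x\<close> has a reduced source, so it
    is itself a point of the subscheme and the factorization stays inside.\<close>
  have rp: "red_pt K ?X A x" if r: "red_pt K X A x" for A x
  proof -
    obtain Q \<psi> y where Q: "Q \<in> aff K" "reduced_ring Q" "\<psi> \<in> alg_hom K Q A" "y \<in> pts X Q"
        "x = pull X Q A \<psi> y"
      using r by (auto simp: red_pt_def)
    have "red_pt K X Q y" unfolding red_pt_def
        using Q(1,2,4) pull_id[OF PX Q(1,4)] alg_hom_id[OF Q(1)] by metis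
    then have "y \<in> pts ?X Q" using red_pt_imp_lred[OF inf PX Q(1,4)] Q(4) by simp
    then show ?thesis unfolding red_pt_def using Q by auto
  qed
  have l: "lred K ?X A x" if A: "A \<in> aff K" and x: "x \<in> pts ?X A" for A x
  proof -
    have "locally_on K A (\<lambda>B h. red_pt K X B (pull X A B h x))" using x by (simp add: lred_def)
    then have "locally_on K A (\<lambda>B h. red_pt K ?X B (pull ?X A B h x))"
      by (rule locally_on_mono[OF A]) (simp add: rp)
    then show ?thesis using x by (simp add: lred_def)
  qed
  have "zariski_sheaf K ?X"
    unfolding zariski_sheaf_iff
  proof (intro conjI P ballI allI impI)
    fix A T B h s assume A: "A \<in> aff K" and g: "gluing_data K ?X A T B h s"
    have g': "gluing_data K X A T B h s"
      using gluing_data_map[OF g sub_psh_incl[OF PX P]] by (simp add: psh_incl_def)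
    have T: "T \<subseteq> carrier A" "Idl\<^bsub>A\<^esub> T = carrier A" "\<And>a. a \<in> T \<Longrightarrow> B a \<in> aff K" "\<And>a. a \<in> T \<Longrightarrow>
        localization_map K A a (B a) (h a)"
      and s: "\<And>a. a \<in> T \<Longrightarrow> lred K X (B a) (s a)"
      using gluing_dataD[OF g] by simp_all
    have ex: "\<exists>!x. x \<in> pts X A \<and> (\<forall>a\<in>T. pull X A (B a) (h a) x = s a)"
      using X A g' unfolding scheme_def zariski_sheaf_iff by blast
    then obtain x where x: "x \<in> pts X A" "\<forall>a\<in>T. pull X A (B a) (h a) x = s a"
      and uniq: "\<And>x'. x' \<in> pts X A \<Longrightarrow> \<forall>a\<in>T. pull X A (B a) (h a) x' = s a \<Longrightarrow> x' = x" by auto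
    have "locally_on K A (\<lambda>B h. lred K X B (pull X A B h x))"
      by (rule locally_on_finiteI[where B = B and h = h, OF A T]) (use s x(2) in auto)
    then have "x \<in> pts ?X A" using lred_scheme_local[OF inf X A x(1)] x(1) by simp
    then show "\<exists>!x. x \<in> pts ?X A \<and> (\<forall>a\<in>T. pull ?X A (B a) (h a) x = s a)"
      using x by (intro ex1I[of _ x] uniq) simp_all
  qed
  moreover have "\<exists>Q\<in>aff K. \<exists>j. open_emb K (Spec K Q) ?X j \<and> x \<in> j L ` pts (Spec K Q) L"
    if L: "L \<in> aff K" "field L" "x \<in> pts ?X L" for L x
  proof -
    have x: "x \<in> pts X L" "lred K X L x" using L by auto
    then obtain R j where R: "R \<in> aff K" "open_emb K (Spec K R) X j" "x \<in> j L ` pts (Spec K R) L"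
      using X L(1,2) unfolding scheme_def by blast
    then obtain \<phi> where \<phi>: "\<phi> \<in> alg_hom K R L" "x = j L \<phi>" by auto
    have "\<phi> n = \<zero>\<^bsub>L\<^esub>" if "n \<in> nilradical R" for n
        using lred_chart_kills[OF inf X R(1,2) L(1) \<phi>(1) _ that] x(2) \<phi>(2) by simp
    then obtain Q q \<psi> where Q: "Q \<in> aff K" "quotient_map K R (nilradical R) Q q" "\<psi> \<in> alg_hom K Q L"
        "\<phi> = compose (carrier R) \<psi> q"
      using nilradical_factor[OF inf R(1) L(1) \<phi>(1)] by metis
    from reduced_chart[OF inf X R(1,2) Q(1,2)] Q(1,3,4) \<phi>(2) show ?thesis by auto
  qed
  ultimately have "scheme K ?X" by (simp add: scheme_def)
  moreover have "reduced_ring A" if "A \<in> aff K" "open_emb K (Spec K A) ?X j" for A j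
    by (rule reduced_of_open_emb[OF inf P that l[OF that(1)]])
  ultimately show ?thesis by (simp add: reduced_scheme_def)
qed

section \<open>Colimits along amalgamating index categories\<close>

lemma category_comp:
  "category C \<Longrightarrow> f \<in> Hom C a b \<Longrightarrow> g \<in> Hom C b c \<Longrightarrow> Cmp C g f \<in> Hom C a c"
  unfolding category_def Hom_def by auto

lemma category_ident: "category C \<Longrightarrow> a \<in> Ob C \<Longrightarrow> Ident C a \<in> Hom C a a"
  unfolding category_def by blast

lemma Hom_Ob: "category C \<Longrightarrow> f \<in> Hom C a b \<Longrightarrow> a \<in> Ob C \<and> b \<in> Ob C"
  unfolding category_def Hom_def by blast

lemma amalgamate:
  assumes "amalgamation C" "f \<in> Hom C a b" "g \<in> Hom C a c"
  obtains d f' g' where "f' \<in> Hom C b d" "g' \<in> Hom C c d" "Cmp C f' f = Cmp C g' g"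
proof -
  have "f \<in> Ar C" "g \<in> Ar C" "Dom C f = Dom C g" "Cod C f = b" "Cod C g = c" using assms(2,3)
      by (auto simp: Hom_def)
  then show thesis using assms(1) that unfolding amalgamation_def by blast
qed

text \<open>An upper bound of the two targets gives two parallel composites from the common source,
  which a further arrow equalizes.\<close>

lemma filtered_amalgamation:
  assumes "filtered C"
  shows "amalgamation C"
  unfolding amalgamation_def
proof (intro conjI ballI impI)
  show cat: "category C" using assms by (simp add: filtered_def)
  fix f g assume fg: "f \<in> Ar C" "g \<in> Ar C" "Dom C f = Dom C g"
  then have f: "f \<in> Hom C (Dom C f) (Cod C f)" and g: "g \<in> Hom C (Dom C f) (Cod C g)"
      by (auto simp: Hom_def)
  have ob: "Dom C f \<in> Ob C" "Cod C f \<in> Ob C" "Cod C g \<in> Ob C" using Hom_Ob[OF cat] f g by blast+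
  then obtain d u v where d: "u \<in> Hom C (Cod C f) d" "v \<in> Hom C (Cod C g) d"
    using assms unfolding filtered_def by blast
  then have uf: "Cmp C u f \<in> Hom C (Dom C f) d" "Cmp C v g \<in> Hom C (Dom C f) d" "d \<in> Ob C"
    using category_comp[OF cat f] category_comp[OF cat g] Hom_Ob[OF cat] by blast+
  then obtain e h where e: "e \<in> Ob C" "h \<in> Hom C d e" "Cmp C h (Cmp C u f) = Cmp C h (Cmp C v g)"
    using assms ob(1) unfolding filtered_def by blast
  have "Cmp C h (Cmp C u f) = Cmp C (Cmp C h u) f" "Cmp C h (Cmp C v g) = Cmp C (Cmp C h v) g"
    using cat f g d e(2) unfolding category_def Hom_def by auto
  then show "\<exists>c3\<in>Ob C. \<exists>g1\<in>Hom C (Cod C f) c3. \<exists>g2\<in>Hom C (Cod C g) c3. Cmp C g1 f = Cmp C g2 g"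
    using e category_comp[OF cat d(1) e(2)] category_comp[OF cat d(2) e(2)] by metis
qed

section \<open>Diagrams and the relation that defines their colimits\<close>

lemma diagram_category: "psh_diagram K C Y t \<Longrightarrow> category C"
  by (simp add: psh_diagram_def)

lemma diagram_presheaf: "psh_diagram K C Y t \<Longrightarrow> c \<in> Ob C \<Longrightarrow> presheaf K (Y c)"
  by (simp add: psh_diagram_def)

lemma diagram_map: "psh_diagram K C Y t \<Longrightarrow> f \<in> Hom C a b \<Longrightarrow> psh_map K (Y a) (Y b) (t f)"
  unfolding psh_diagram_def Hom_def by blast

lemma diagram_closed:
  "psh_diagram K C Y t \<Longrightarrow> f \<in> Hom C a b \<Longrightarrow> A \<in> aff K \<Longrightarrow> y \<in> pts (Y a) A \<Longrightarrow> t f A y \<in> pts (Y b) A"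
  by (rule psh_map_closed[OF diagram_map])

lemma diagram_ident:
  "psh_diagram K C Y t \<Longrightarrow> c \<in> Ob C \<Longrightarrow> A \<in> aff K \<Longrightarrow> y \<in> pts (Y c) A \<Longrightarrow> t (Ident C c) A y = y"
  unfolding psh_diagram_def psh_eq_on_def psh_incl_def by blast

lemma diagram_comp:
  "psh_diagram K C Y t \<Longrightarrow> f \<in> Hom C a b \<Longrightarrow> g \<in> Hom C b c \<Longrightarrow> A \<in> aff K \<Longrightarrow> y \<in> pts (Y a) A \<Longrightarrow>
   t (Cmp C g f) A y = t g A (t f A y)"
  unfolding psh_diagram_def psh_eq_on_def psh_comp_def Hom_def by auto

lemma colim_gen_iff:
  "(p, q) \<in> colim_gen C Y t A \<longleftrightarrow> (\<exists>a b f y. f \<in> Hom C a b \<and> y \<in> pts (Y a) A \<and> p = (a, y) \<and>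
      q = (b, t f A y))"
  unfolding colim_gen_def Hom_def by auto

lemma colim_sum_iff: "(c, y) \<in> colim_sum C Y A \<longleftrightarrow> c \<in> Ob C \<and> y \<in> pts (Y c) A"
  by (simp add: colim_sum_def)

lemma colim_rel_refl: "(p, p) \<in> colim_rel C Y t A"
  by (simp add: colim_rel_def)

lemma colim_rel_sym: "(p, q) \<in> colim_rel C Y t A \<Longrightarrow> (q, p) \<in> colim_rel C Y t A"
  unfolding colim_rel_def by (meson sym_Un_converse sym_rtrancl symD)

lemma colim_rel_trans: "(p, q) \<in> colim_rel C Y t A \<Longrightarrow> (q, r) \<in> colim_rel C Y t A \<Longrightarrow>
    (p, r) \<in> colim_rel C Y t A"
  unfolding colim_rel_def by (rule rtrancl_trans)

lemma colim_rel_step: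
  "f \<in> Hom C a b \<Longrightarrow> y \<in> pts (Y a) A \<Longrightarrow> ((a, y), (b, t f A y)) \<in> colim_rel C Y t A"
  unfolding colim_rel_def by (rule r_into_rtrancl) (auto simp: colim_gen_iff)

text \<open>Induction along a zigzag of arrows in either direction. It carries membership in
  \<open>colim_sum\<close> along, since the generated relation is also reflexive outside the
  disjoint union.\<close>

lemma colim_rel_induct [consumes 3, case_names refl forward backward]:
  assumes "psh_diagram K C Y t" "A \<in> aff K" "(p, (d, z)) \<in> colim_rel C Y t A"
      and sum: "p \<in> colim_sum C Y A"
    and refl: "\<And>c y. p = (c, y) \<Longrightarrow> P c y"
    and fwd: "\<And>a b f y. f \<in> Hom C a b \<Longrightarrow> y \<in> pts (Y a) A \<Longrightarrow> P a y \<Longrightarrow> P b (t f A y)"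
    and bwd: "\<And>a b f y. f \<in> Hom C a b \<Longrightarrow> y \<in> pts (Y a) A \<Longrightarrow> P b (t f A y) \<Longrightarrow> P a y"
  shows "P d z \<and> (d, z) \<in> colim_sum C Y A"
proof -
  have "P (fst q) (snd q) \<and> q \<in> colim_sum C Y A"
      if "(p, q) \<in> (colim_gen C Y t A \<union> (colim_gen C Y t A)\<inverse>)\<^sup>*" for q
    using that
  proof (induction rule: rtrancl_induct)
    case base
    then show ?case using sum refl by (cases p) auto
  next
    case (step q r)
    from step(2) consider "(q, r) \<in> colim_gen C Y t A" | "(r, q) \<in> colim_gen C Y t A" by blast
    then show ?case
    proof cases
      case 1
      then obtain a b f y where "f \<in> Hom C a b" "y \<in> pts (Y a) A" "q = (a, y)" "r = (b, t f A y)"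
        by (auto simp: colim_gen_iff)
      then show ?thesis
        using step.IH fwd[of f a b y] diagram_closed[OF assms(1) _ assms(2)]
            Hom_Ob[OF diagram_category[OF assms(1)]]
        by (auto simp: colim_sum_iff)
    next
      case 2
      then obtain a b f y where "f \<in> Hom C a b" "y \<in> pts (Y a) A" "r = (a, y)" "q = (b, t f A y)"
        by (auto simp: colim_gen_iff)
      then show ?thesis
        using step.IH bwd[of f a b y] Hom_Ob[OF diagram_category[OF assms(1)]]
        by (auto simp: colim_sum_iff)
    qed
  qed
  from this[of "(d, z)"] assms(3) show ?thesis unfolding colim_rel_def by simp
qed

text \<open>A zigzag that starts at \<open>(c, y)\<close> collapses to one cospan. Going along an
  arrow \<open>h\<close>, its amalgamation with the leg \<open>g\<close> extends the cospan; going
  back along \<open>h\<close>, it is enough to compose the leg with \<open>h\<close>.\<close>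

lemma colim_rel_amalgamated:
  assumes D: "psh_diagram K C Y t" and A: "A \<in> aff K" and AP: "amalgamation C"
    and "((c, y), (d, z)) \<in> colim_rel C Y t A" "c \<in> Ob C" "y \<in> pts (Y c) A"
  shows "\<exists>e f g. f \<in> Hom C c e \<and> g \<in> Hom C d e \<and> t f A y = t g A z"
proof -
  note cat = diagram_category[OF D]
  let ?P = "\<lambda>d z. \<exists>e f g. f \<in> Hom C c e \<and> g \<in> Hom C d e \<and> t f A y = t g A z"
  have "?P d z \<and> (d, z) \<in> colim_sum C Y A"
  proof (rule colim_rel_induct[OF D A assms(4)])
    show "(c, y) \<in> colim_sum C Y A" using assms(5,6) by (simp add: colim_sum_iff)
    show "?P c' y'" if "(c, y) = (c', y')" for c' y' using category_ident[OF cat assms(5)] that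
        by blast
  next
    fix a b h w assume h: "h \<in> Hom C a b" "w \<in> pts (Y a) A" and "?P a w"
    then obtain e f g where e: "f \<in> Hom C c e" "g \<in> Hom C a e" "t f A y = t g A w" by blast
    obtain e' g1 g2 where e': "g1 \<in> Hom C e e'" "g2 \<in> Hom C b e'" "Cmp C g1 g = Cmp C g2 h"
      using amalgamate[OF AP e(2) h(1)] .
    have "t (Cmp C g1 f) A y = t g2 A (t h A w)"
      using diagram_comp[OF D e(1) e'(1) A assms(6)] diagram_comp[OF D e(2) e'(1) A h(2)]
        diagram_comp[OF D h(1) e'(2) A h(2)] e(3) e'(3) by simp
    then show "?P b (t h A w)" using category_comp[OF cat e(1) e'(1)] e'(2) by blast
  next
    fix a b h w assume h: "h \<in> Hom C a b" "w \<in> pts (Y a) A" and "?P b (t h A w)"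
    then obtain e f g where e: "f \<in> Hom C c e" "g \<in> Hom C b e" "t f A y = t g A (t h A w)" by blast
    then have "t f A y = t (Cmp C g h) A w" using diagram_comp[OF D h(1) e(2) A h(2)] by simp
    then show "?P a w" using e(1) category_comp[OF cat h(1) e(2)] by blast
  qed
  then show ?thesis by blast
qed

lemma colim_relI:
  assumes "f \<in> Hom C c e" "g \<in> Hom C d e" "y \<in> pts (Y c) A" "z \<in> pts (Y d) A" "t f A y = t g A z"
  shows "((c, y), (d, z)) \<in> colim_rel C Y t A"
proof (rule colim_rel_trans)
  show "((c, y), (e, t f A y)) \<in> colim_rel C Y t A" by (rule colim_rel_step) (rule assms)+
  show "((e, t f A y), (d, z)) \<in> colim_rel C Y t A"
    unfolding assms(5) by (rule colim_rel_sym, rule colim_rel_step) (rule assms)+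
qed

abbreviation colim_class ::
    "('o, 'm) cat \<Rightarrow> ('o \<Rightarrow> ('k, 'u, 'v) psh) \<Rightarrow> ('m \<Rightarrow> ('k, 'u, 'v, 'v) psh_trans) \<Rightarrow> ('k, 'u) module \<Rightarrow>
        'o \<Rightarrow> 'v \<Rightarrow> ('o \<times> 'v) set" where
  "colim_class C Y t A c y \<equiv> colim_rel C Y t A `` {(c, y)}"

lemma colim_class_eq_iff:
  "colim_class C Y t A c y = colim_class C Y t A d z \<longleftrightarrow> ((c, y), (d, z)) \<in> colim_rel C Y t A"
proof
  assume "colim_class C Y t A c y = colim_class C Y t A d z"
  moreover have "(d, z) \<in> colim_class C Y t A d z" by (simp add: colim_rel_refl)
  ultimately show "((c, y), (d, z)) \<in> colim_rel C Y t A" by auto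
next
  assume "((c, y), (d, z)) \<in> colim_rel C Y t A"
  then show "colim_class C Y t A c y = colim_class C Y t A d z"
    by (auto intro: colim_rel_trans dest: colim_rel_sym)
qed

lemma pts_colim: "pts (psh_colim C Y t) A = {colim_class C Y t A c y | c y. c \<in> Ob C \<and>
    y \<in> pts (Y c) A}"
  unfolding psh_colim_def quotient_def by (auto simp: colim_sum_def)

lemma colim_rel_pull:
  assumes D: "psh_diagram K C Y t" and A: "A \<in> aff K" and B: "B \<in> aff K" and f: "f \<in> alg_hom K A B"
    and r: "((c, y), (d, z)) \<in> colim_rel C Y t A" "c \<in> Ob C" "y \<in> pts (Y c) A"
  shows "((c, pull (Y c) A B f y), (d, pull (Y d) A B f z)) \<in> colim_rel C Y t B"
proof -
  have "((c, pull (Y c) A B f y), (d, pull (Y d) A B f z)) \<in> colim_rel C Y t B \<and>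
      (d, z) \<in> colim_sum C Y A"
  proof (rule colim_rel_induct[OF D A r(1)])
    show "(c, y) \<in> colim_sum C Y A" using r(2,3) by (simp add: colim_sum_iff)
    show "((c, pull (Y c) A B f y), (c', pull (Y c') A B f y')) \<in> colim_rel C Y t B"
        if "(c, y) = (c', y')" for c' y'
      using that by (simp add: colim_rel_refl)
  next
    fix a b h w assume h: "h \<in> Hom C a b" "w \<in> pts (Y a) A"
    have s: "((a, pull (Y a) A B f w), (b, pull (Y b) A B f (t h A w))) \<in> colim_rel C Y t B"
      using colim_rel_step[where Y = Y
          and t = t, OF h(1) pull_closed[OF psh_map_presheaf(1)[OF diagram_map[OF D h(1)]] A B f
          h(2)]]
        psh_map_pull[OF diagram_map[OF D h(1)] A B f h(2)] by simp
    show "((c, pull (Y c) A B f y), (b, pull (Y b) A B f (t h A w))) \<in> colim_rel C Y t B"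
      if "((c, pull (Y c) A B f y), (a, pull (Y a) A B f w)) \<in> colim_rel C Y t B"
      by (rule colim_rel_trans[OF that s])
    show "((c, pull (Y c) A B f y), (a, pull (Y a) A B f w)) \<in> colim_rel C Y t B"
      if "((c, pull (Y c) A B f y), (b, pull (Y b) A B f (t h A w))) \<in> colim_rel C Y t B"
      by (rule colim_rel_trans[OF that colim_rel_sym[OF s]])
  qed
  then show ?thesis by blast
qed

text \<open>By definition the restriction moves a whole class and saturates the result; the moved
  elements are all related, so one representative determines it.\<close>

lemma pull_colim:
  assumes D: "psh_diagram K C Y t" and A: "A \<in> aff K" and B: "B \<in> aff K" and f: "f \<in> alg_hom K A B"
    and "c \<in> Ob C" "y \<in> pts (Y c) A"
  shows "pull (psh_colim C Y t) A B f (colim_class C Y t A c y) =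
      colim_class C Y t B c (pull (Y c) A B f y)"
proof -
  have "pull (psh_colim C Y t) A B f (colim_class C Y t A c y) =
      colim_rel C Y t B `` ((\<lambda>(c, y). (c, pull (Y c) A B f y)) ` colim_class C Y t A c y)"
    by (simp add: psh_colim_def)
  also have "\<dots> = colim_class C Y t B c (pull (Y c) A B f y)"
  proof
    show "colim_class C Y t B c (pull (Y c) A B f y) \<subseteq>
        colim_rel C Y t B `` ((\<lambda>(c, y). (c, pull (Y c) A B f y)) ` colim_class C Y t A c y)"
      using colim_rel_refl[of "(c, y)" C Y t A] by (intro Image_mono) auto
    show "colim_rel C Y t B `` ((\<lambda>(c, y). (c, pull (Y c) A B f y)) ` colim_class C Y t A c y) \<subseteq>
        colim_class C Y t B c (pull (Y c) A B f y)"
      using colim_rel_pull[OF D A B f _ assms(5,6)] by (auto intro: colim_rel_trans)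
  qed
  finally show ?thesis .
qed

lemma colimE:
  assumes "x \<in> pts (psh_colim C Y t) A"
  obtains c y where "c \<in> Ob C" "y \<in> pts (Y c) A" "x = colim_class C Y t A c y"
  using assms unfolding pts_colim by blast

lemma presheaf_colim:
  assumes D: "psh_diagram K C Y t"
  shows "presheaf K (psh_colim C Y t)"
proof (rule presheafI)
  fix A B f x assume A: "A \<in> aff K" "B \<in> aff K" "f \<in> alg_hom K A B" "x \<in> pts (psh_colim C Y t) A"
  from A(4) obtain c y where c: "c \<in> Ob C" "y \<in> pts (Y c) A" "x = colim_class C Y t A c y"
      by (rule colimE)
  show "pull (psh_colim C Y t) A B f x \<in> pts (psh_colim C Y t) B"
    using pull_colim[OF D A(1-3) c(1,2)] c pull_closed[OF diagram_presheaf[OF D c(1)] A(1-3) c(2)]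
        by (auto simp: pts_colim)
next
  fix A x assume A: "A \<in> aff K" "x \<in> pts (psh_colim C Y t) A"
  from A(2) obtain c y where c: "c \<in> Ob C" "y \<in> pts (Y c) A" "x = colim_class C Y t A c y"
      by (rule colimE)
  show "pull (psh_colim C Y t) A A (\<lambda>a\<in>carrier A. a) x = x"
    using pull_colim[OF D A(1,1) alg_hom_id[OF A(1)] c(1,2)] pull_id[OF diagram_presheaf[OF D c(1)]
        A(1) c(2)] c(3) by simp
next
  fix A B E f g x assume A: "A \<in> aff K" "B \<in> aff K" "E \<in> aff K" "f \<in> alg_hom K A B"
      "g \<in> alg_hom K B E" "x \<in> pts (psh_colim C Y t) A"
  from A(6) obtain c y where c: "c \<in> Ob C" "y \<in> pts (Y c) A" "x = colim_class C Y t A c y"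
      by (rule colimE)
  note P = diagram_presheaf[OF D c(1)]
  show "pull (psh_colim C Y t) A E (compose (carrier A) g f) x =
      pull (psh_colim C Y t) B E g (pull (psh_colim C Y t) A B f x)"
    using pull_colim[OF D A(1,3) alg_hom_comp[OF A(1,4,5)] c(1,2)] pull_colim[OF D A(1,2,4) c(1,2)]
      pull_colim[OF D A(2,3,5) c(1) pull_closed[OF P A(1,2,4) c(2)]] pull_comp[OF P A(1-5) c(2)]
          c(3) by simp
qed

section \<open>Cocones and presentations\<close>

lemma cocone_map: "cocone K C Y t X \<iota> \<Longrightarrow> c \<in> Ob C \<Longrightarrow> psh_map K (Y c) X (\<iota> c)"
  by (simp add: cocone_def)

lemma cocone_comm:
  "cocone K C Y t X \<iota> \<Longrightarrow> f \<in> Hom C a b \<Longrightarrow> A \<in> aff K \<Longrightarrow> y \<in> pts (Y a) A \<Longrightarrow> \<iota> b A (t f A y) = \<iota> a A y"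
  unfolding cocone_def psh_eq_on_def psh_comp_def Hom_def by auto

lemma cocone_rel:
  assumes D: "psh_diagram K C Y t" and X: "cocone K C Y t X \<iota>" and A: "A \<in> aff K"
    and r: "((c, y), (d, z)) \<in> colim_rel C Y t A" "c \<in> Ob C" "y \<in> pts (Y c) A"
  shows "\<iota> d A z = \<iota> c A y"
proof -
  have "\<iota> d A z = \<iota> c A y \<and> (d, z) \<in> colim_sum C Y A"
    by (rule colim_rel_induct[OF D A r(1)]) (use r(2,3) cocone_comm[OF X _ A] in \<open>auto simp:
        colim_sum_iff\<close>)
  then show ?thesis by blast
qed

lemma colim_desc_class:
  assumes D: "psh_diagram K C Y t" and X: "cocone K C Y t X \<iota>" and A: "A \<in> aff K" "c \<in> Ob C"
      "y \<in> pts (Y c) A"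
  shows "colim_desc \<iota> A (colim_class C Y t A c y) = \<iota> c A y"
proof -
  have "(\<lambda>(c, y). \<iota> c A y) ` colim_class C Y t A c y = {\<iota> c A y}"
  proof
    show "(\<lambda>(c, y). \<iota> c A y) ` colim_class C Y t A c y \<subseteq> {\<iota> c A y}"
      using cocone_rel[OF D X A(1) _ A(2,3)] by auto
    show "{\<iota> c A y} \<subseteq> (\<lambda>(c, y). \<iota> c A y) ` colim_class C Y t A c y"
      using colim_rel_refl[of "(c, y)" C Y t A] by force
  qed
  then show ?thesis by (simp add: colim_desc_def)
qed

text \<open>Surjectivity of the induced map is joint surjectivity of the cocone. For injectivity a
  cospan is demanded wherever two terms give the same point, the form that
  \<open>presentation_eq\<close> provides under amalgamation.\<close>

lemma presentationI:
  assumes D: "psh_diagram K C Y t" and X: "cocone K C Y t X \<iota>" and PX: "presheaf K X"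
    and surj: "\<And>A x. A \<in> aff K \<Longrightarrow> x \<in> pts X A \<Longrightarrow> \<exists>c\<in>Ob C. \<exists>y\<in>pts (Y c) A. x = \<iota> c A y"
    and inj: "\<And>A c d y z. A \<in> aff K \<Longrightarrow> c \<in> Ob C \<Longrightarrow> d \<in> Ob C \<Longrightarrow> y \<in> pts (Y c) A \<Longrightarrow> z \<in> pts (Y d) A \<Longrightarrow>
      \<iota> c A y = \<iota> d A z \<Longrightarrow> \<exists>e f g. f \<in> Hom C c e \<and> g \<in> Hom C d e \<and> t f A y = t g A z"
  shows "presentation K C Y t X \<iota>"
proof -
  note dc = colim_desc_class[OF D X]
  have "psh_map K (psh_colim C Y t) X (colim_desc \<iota>)"
  proof (rule psh_mapI[OF presheaf_colim[OF D] PX])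
    fix A x assume A: "A \<in> aff K" "x \<in> pts (psh_colim C Y t) A"
    from A(2) obtain c y where c: "c \<in> Ob C" "y \<in> pts (Y c) A" "x = colim_class C Y t A c y"
        by (rule colimE)
    then show "colim_desc \<iota> A x \<in> pts X A"
        using dc[OF A(1) c(1,2)] psh_map_closed[OF cocone_map[OF X c(1)] A(1) c(2)] by simp
  next
    fix A B f x assume A: "A \<in> aff K" "B \<in> aff K" "f \<in> alg_hom K A B" "x \<in> pts (psh_colim C Y t) A"
    from A(4) obtain c y where c: "c \<in> Ob C" "y \<in> pts (Y c) A" "x = colim_class C Y t A c y"
        by (rule colimE)
    show "colim_desc \<iota> B (pull (psh_colim C Y t) A B f x) = pull X A B f (colim_desc \<iota> A x)"
      using pull_colim[OF D A(1-3) c(1,2)] dc[OF A(1) c(1,2)] dc[OF A(2) c(1)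
          pull_closed[OF diagram_presheaf[OF D c(1)] A(1-3) c(2)]]
        psh_map_pull[OF cocone_map[OF X c(1)] A(1-3) c(2)] c(3) by simp
  qed
  moreover have "bij_betw (colim_desc \<iota> A) (pts (psh_colim C Y t) A) (pts X A)" if A: "A \<in> aff K"
      for A
  proof (rule bij_betw_imageI)
    show "inj_on (colim_desc \<iota> A) (pts (psh_colim C Y t) A)"
    proof (rule inj_onI)
      fix x x' assume x: "x \<in> pts (psh_colim C Y t) A" "x' \<in> pts (psh_colim C Y t) A"
          and e: "colim_desc \<iota> A x = colim_desc \<iota> A x'"
      from x(1) obtain c y where c: "c \<in> Ob C" "y \<in> pts (Y c) A" "x = colim_class C Y t A c y"
          by (rule colimE)
      from x(2) obtain d z where d: "d \<in> Ob C" "z \<in> pts (Y d) A" "x' = colim_class C Y t A d z"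
          by (rule colimE)
      have "\<iota> c A y = \<iota> d A z" using e c d dc[OF A] by simp
      then obtain e' f g where e': "f \<in> Hom C c e'" "g \<in> Hom C d e'" "t f A y = t g A z"
          using inj[OF A c(1) d(1) c(2) d(2)] by blast
      have "((c, y), (d, z)) \<in> colim_rel C Y t A" by (rule colim_relI[where Y = Y
          and t = t, OF e'(1,2) c(2) d(2) e'(3)])
      then show "x = x'" using c(3) d(3) colim_class_eq_iff by metis
    qed
    show "colim_desc \<iota> A ` pts (psh_colim C Y t) A = pts X A"
    proof
      show "colim_desc \<iota> A ` pts (psh_colim C Y t) A \<subseteq> pts X A"
        using dc[OF A] psh_map_closed[OF cocone_map[OF X] A] by (auto simp: pts_colim)
      show "pts X A \<subseteq> colim_desc \<iota> A ` pts (psh_colim C Y t) A"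
      proof
        fix x assume "x \<in> pts X A"
        then obtain c y where c: "c \<in> Ob C" "y \<in> pts (Y c) A" "x = \<iota> c A y" using surj[OF A]
            by blast
        then have "x = colim_desc \<iota> A (colim_class C Y t A c y)" using dc[OF A] by simp
        then show "x \<in> colim_desc \<iota> A ` pts (psh_colim C Y t) A" using c(1,2)
            by (auto simp: pts_colim)
      qed
    qed
  qed
  ultimately show ?thesis using D X by (simp add: presentation_def psh_iso_def)
qed

lemma presentationD:
  assumes "presentation K C Y t X \<iota>"
  shows "psh_diagram K C Y t" "cocone K C Y t X \<iota>" "psh_iso K (psh_colim C Y t) X (colim_desc \<iota>)"
  using assms by (auto simp: presentation_def)

lemma presentation_surj:
  assumes P: "presentation K C Y t X \<iota>" and A: "A \<in> aff K" and x: "x \<in> pts X A"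
  obtains c y where "c \<in> Ob C" "y \<in> pts (Y c) A" "x = \<iota> c A y"
proof -
  obtain u where u: "u \<in> pts (psh_colim C Y t) A" "x = colim_desc \<iota> A u"
    using psh_iso_image[OF presentationD(3)[OF P] A] x by blast
  from u(1) obtain c y where "c \<in> Ob C" "y \<in> pts (Y c) A" "u = colim_class C Y t A c y"
      by (rule colimE)
  then show thesis using that u(2) colim_desc_class[OF presentationD(1,2)[OF P] A] by simp
qed

lemma presentation_eq:
  assumes P: "presentation K C Y t X \<iota>" and AP: "amalgamation C" and A: "A \<in> aff K"
    and c: "c \<in> Ob C" "y \<in> pts (Y c) A" and d: "d \<in> Ob C" "z \<in> pts (Y d) A"
        and e: "\<iota> c A y = \<iota> d A z"
  obtains e f g where "f \<in> Hom C c e" "g \<in> Hom C d e" "t f A y = t g A z"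
proof -
  note D = presentationD(1,2)[OF P]
  have "colim_class C Y t A c y = colim_class C Y t A d z"
  proof (rule inj_onD[OF psh_iso_inj[OF presentationD(3)[OF P] A]])
    show "colim_desc \<iota> A (colim_class C Y t A c y) = colim_desc \<iota> A (colim_class C Y t A d z)"
      using colim_desc_class[OF D A c] colim_desc_class[OF D A d] e by simp
  qed (use c d in \<open>auto simp: pts_colim\<close>)
  then have "((c, y), (d, z)) \<in> colim_rel C Y t A" by (simp only: colim_class_eq_iff)
  then show thesis using colim_rel_amalgamated[OF D(1) A AP _ c] that by blast
qed

text \<open>The relation of the smaller diagram is contained in that of the larger one, so
  saturating a small class gives the large class of the same representative.\<close>

lemma colim_map_incl_class:
  assumes "\<And>c. c \<in> Ob C \<Longrightarrow> pts (Y' c) A \<subseteq> pts (Y c) A" "category C"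
  shows "colim_map C Y t (\<lambda>c. psh_incl) A (colim_class C Y' t A c y) = colim_class C Y t A c y"
proof -
  have "colim_gen C Y' t A \<subseteq> colim_gen C Y t A"
  proof (rule subrelI)
    fix p q assume "(p, q) \<in> colim_gen C Y' t A"
    then obtain a b f y where "f \<in> Hom C a b" "y \<in> pts (Y' a) A" "p = (a, y)" "q = (b, t f A y)"
        by (auto simp: colim_gen_iff)
    moreover from this have "y \<in> pts (Y a) A" using assms(1) Hom_Ob[OF assms(2)] by blast
    ultimately show "(p, q) \<in> colim_gen C Y t A" by (auto simp: colim_gen_iff)
  qed
  then have sub: "colim_rel C Y' t A \<subseteq> colim_rel C Y t A"
    unfolding colim_rel_def by (intro rtrancl_mono Un_mono) auto
  have "(\<lambda>(c, y). (c, psh_incl A y)) ` colim_class C Y' t A c y = colim_class C Y' t A c y"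
      by (auto simp: psh_incl_def)
  then have "colim_map C Y t (\<lambda>c. psh_incl) A (colim_class C Y' t A c y) =
      colim_rel C Y t A `` colim_class C Y' t A c y"
    by (simp add: colim_map_def)
  also have "\<dots> = colim_class C Y t A c y"
    using sub colim_rel_refl[of "(c, y)" C Y' t A] by (auto intro: colim_rel_trans)
  finally show ?thesis .
qed

section \<open>Closed and ind-closed subschemes of affine schemes\<close>

lemma localization_unique:
  assumes "A \<in> aff K" "T \<subseteq> carrier A" "Idl\<^bsub>A\<^esub> T = carrier A"
    "\<And>a. a \<in> T \<Longrightarrow> B a \<in> aff K" "\<And>a. a \<in> T \<Longrightarrow> localization_map K A a (B a) (h a)"
    and x: "x \<in> carrier A" "x' \<in> carrier A" "\<And>a. a \<in> T \<Longrightarrow> h a x = h a x'"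
  shows "x = x'"
proof -
  interpret A: algebra K A using assms(1) by (simp add: aff_def)
  have "x \<ominus>\<^bsub>A\<^esub> x' = \<zero>\<^bsub>A\<^esub>"
  proof (rule localization_separated[OF assms(1) _ assms(2,3)])
    fix a assume a: "a \<in> T"
    note h = localization_map_hom[OF assms(5)[OF a]]
    interpret ring_hom_cring A "B a" "h a"
        by (rule alg_hom_ring_hom_cring[OF assms(1) assms(4)[OF a] h])
    have "h a (x \<ominus>\<^bsub>A\<^esub> x') = \<zero>\<^bsub>B a\<^esub>"
      using alg_hom_minus[OF assms(1) assms(4)[OF a] h x(1,2)] x a
          by (simp add: S.minus_eq_zero_iff)
    then show "\<exists>B\<in>aff K. \<exists>h. localization_map K A a B h \<and> h (x \<ominus>\<^bsub>A\<^esub> x') = \<zero>\<^bsub>B\<^esub>"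
      using assms(4,5)[OF a] by blast
  qed (use x in simp)
  then show ?thesis using x by (simp add: A.minus_eq_zero_iff)
qed

text \<open>For each \<open>r\<close> the elements \<open>s a r\<close> agree on overlaps and
  descend to one element of \<open>A\<close>. This element is unique, so the map that sends
  \<open>r\<close> to it respects the algebra structure.\<close>

lemma zariski_sheaf_Spec:
  fixes R :: "('k, 'u) module"
  assumes inf: "infinite (UNIV :: 'u set)" and R: "R \<in> aff K"
  shows "zariski_sheaf K (Spec K R)"
  unfolding zariski_sheaf_iff
proof (intro conjI presheaf_Spec[OF R] ballI allI impI)
  interpret R: algebra K R using R by (simp add: aff_def)
  fix A T B h s assume A: "A \<in> aff K" and g: "gluing_data K (Spec K R) A T B h s"
  interpret A: algebra K A using A by (simp add: aff_def)
  note T = gluing_dataD(1-3)[OF g] and B = gluing_dataD(4)[OF g] and loc = gluing_dataD(5)[OF g]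
  have s: "s a \<in> alg_hom K R (B a)" if "a \<in> T" for a using gluing_dataD(6)[OF g that] by simp
  have h: "h a \<in> alg_hom K A (B a)" if "a \<in> T" for a by (rule localization_map_hom[OF loc[OF that]])
  note uniq = localization_unique[where B = B and h = h, OF A T(2,3) B loc]
  have "\<exists>x\<in>carrier A. \<forall>a\<in>T. h a x = s a r" if r: "r \<in> carrier R" for r
  proof -
    show ?thesis
    proof (rule localization_descent[where B = B and h = h and y = "\<lambda>a. s a r", OF inf A T B loc])
      show "s a r \<in> carrier (B a)" if "a \<in> T" for a using alg_hom_closed[OF s[OF that] r] .
      fix a b C p q assume a: "a \<in> T" "b \<in> T" "C \<in> aff K" "p \<in> alg_hom K (B a) C"
          "q \<in> alg_hom K (B b) C"
        "compose (carrier A) p (h a) = compose (carrier A) q (h b)"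
      have "pull (Spec K R) (B a) C p (s a) = pull (Spec K R) (B b) C q (s b)"
        by (rule g[unfolded gluing_data_def, THEN conjunct2, THEN conjunct2, THEN conjunct2, THEN
            conjunct2, rule_format, OF a])
      then have "compose (carrier R) p (s a) r = compose (carrier R) q (s b) r" by simp
      then show "p (s a r) = q (s b r)" using r by (simp add: compose_def)
    next
      fix x assume "x \<in> carrier A" "\<And>a. a \<in> T \<Longrightarrow> h a x = s a r"
      then show ?thesis by blast
    qed
  qed
  then have "\<forall>r\<in>carrier R. \<exists>x. x \<in> carrier A \<and> (\<forall>a\<in>T. h a x = s a r)" by blast
  from bchoice[OF this] obtain G where G: "\<forall>r\<in>carrier R. G r \<in> carrier A \<and>
      (\<forall>a\<in>T. h a (G r) = s a r)" by (rule exE)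
  define \<phi> where "\<phi> = restrict G (carrier R)"
  have \<phi>c: "\<phi> r \<in> carrier A" if "r \<in> carrier R" for r using G that by (simp add: \<phi>_def)
  have \<phi>s: "h a (\<phi> r) = s a r" if "r \<in> carrier R" "a \<in> T" for r a using G that by (simp add: \<phi>_def)
  have \<phi>: "\<phi> \<in> alg_hom K R A"
  proof (rule alg_homI)
    fix x y assume xy: "x \<in> carrier R" "y \<in> carrier R"
    show "\<phi> (x \<otimes>\<^bsub>R\<^esub> y) = \<phi> x \<otimes>\<^bsub>A\<^esub> \<phi> y"
    proof (rule uniq)
      fix a assume a: "a \<in> T"
      show "h a (\<phi> (x \<otimes>\<^bsub>R\<^esub> y)) = h a (\<phi> x \<otimes>\<^bsub>A\<^esub> \<phi> y)"
        using alg_hom_mult[OF h[OF a] \<phi>c[OF xy(1)] \<phi>c[OF xy(2)]] alg_hom_mult[OF s[OF a] xy] xy a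
            by (simp add: \<phi>s)
    qed (use xy \<phi>c in simp_all)
    show "\<phi> (x \<oplus>\<^bsub>R\<^esub> y) = \<phi> x \<oplus>\<^bsub>A\<^esub> \<phi> y"
    proof (rule uniq)
      fix a assume a: "a \<in> T"
      show "h a (\<phi> (x \<oplus>\<^bsub>R\<^esub> y)) = h a (\<phi> x \<oplus>\<^bsub>A\<^esub> \<phi> y)"
        using alg_hom_add[OF h[OF a] \<phi>c[OF xy(1)] \<phi>c[OF xy(2)]] alg_hom_add[OF s[OF a] xy] xy a
            by (simp add: \<phi>s)
    qed (use xy \<phi>c in simp_all)
  next
    show "\<phi> \<one>\<^bsub>R\<^esub> = \<one>\<^bsub>A\<^esub>"
    proof (rule uniq)
      fix a assume a: "a \<in> T"
      show "h a (\<phi> \<one>\<^bsub>R\<^esub>) = h a \<one>\<^bsub>A\<^esub>" using alg_hom_one[OF h[OF a]] alg_hom_one[OF s[OF a]] a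
          by (simp add: \<phi>s)
    qed (use \<phi>c in simp_all)
  next
    fix k x assume kx: "k \<in> carrier K" "x \<in> carrier R"
    show "\<phi> (k \<odot>\<^bsub>R\<^esub> x) = k \<odot>\<^bsub>A\<^esub> \<phi> x"
    proof (rule uniq)
      fix a assume a: "a \<in> T"
      show "h a (\<phi> (k \<odot>\<^bsub>R\<^esub> x)) = h a (k \<odot>\<^bsub>A\<^esub> \<phi> x)"
        using alg_hom_smult[OF h[OF a] kx(1) \<phi>c[OF kx(2)]] alg_hom_smult[OF s[OF a] kx] kx a
            by (simp add: \<phi>s)
    qed (use kx \<phi>c in simp_all)
  next
    show "\<phi> \<in> extensional (carrier R)" by (simp add: \<phi>_def)
  qed (rule \<phi>c)
  have comp: "compose (carrier R) (h a) \<phi>' = s a \<longleftrightarrow> (\<forall>r\<in>carrier R. h a (\<phi>' r) = s a r)"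
    if "a \<in> T" for a \<phi>'
    using alg_hom_extensional[OF s[OF that]] by (auto simp: compose_def fun_eq_iff extensional_def)
  show "\<exists>!x. x \<in> pts (Spec K R) A \<and> (\<forall>a\<in>T. pull (Spec K R) A (B a) (h a) x = s a)"
  proof (rule ex1I[of _ \<phi>])
    show "\<phi> \<in> pts (Spec K R) A \<and> (\<forall>a\<in>T. pull (Spec K R) A (B a) (h a) \<phi> = s a)"
      using \<phi> \<phi>s comp by simp
    fix \<phi>' assume "\<phi>' \<in> pts (Spec K R) A \<and> (\<forall>a\<in>T. pull (Spec K R) A (B a) (h a) \<phi>' = s a)"
    then have \<phi>': "\<phi>' \<in> alg_hom K R A" "\<And>a r. a \<in> T \<Longrightarrow> r \<in> carrier R \<Longrightarrow> h a (\<phi>' r) = s a r" using comp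
        by auto
    show "\<phi>' = \<phi>"
    proof (rule alg_hom_eqI[OF \<phi>'(1) \<phi>])
      fix r assume r: "r \<in> carrier R"
      show "\<phi>' r = \<phi> r" by (rule uniq) (use r \<phi>' \<phi>s \<phi>c alg_hom_closed[OF \<phi>'(1)] in simp_all)
    qed
  qed
qed

lemma scheme_Spec:
  fixes R :: "('k, 'u) module"
  assumes inf: "infinite (UNIV :: 'u set)" and R: "R \<in> aff K"
  shows "scheme K (Spec K R)"
proof -
  have "open_emb K (Spec K R) (Spec K R) psh_incl"
    unfolding open_emb_def
  proof (intro conjI ballI)
    show "psh_map K (Spec K R) (Spec K R) psh_incl"
      by (rule psh_mapI) (auto simp: presheaf_Spec[OF R] psh_incl_def)
    show "inj_on (psh_incl A) (pts (Spec K R) A)" for A by (simp add: psh_incl_def inj_on_def)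
    fix A x assume A: "A \<in> aff K" and x: "x \<in> pts (Spec K R) A"
    interpret A: algebra K A using A by (simp add: aff_def)
    \<comment> \<open>The chart is the identity, so its preimage in \<open>Spec A\<close> is
      everything and the unit ideal describes it.\<close>
    have "Idl\<^bsub>B\<^esub> (f ` carrier A) = carrier B" if B: "B \<in> aff K" and f: "f \<in> alg_hom K A B" for B f
    proof -
      interpret B: algebra K B using B by (simp add: aff_def)
      have "\<one>\<^bsub>B\<^esub> \<in> f ` carrier A" using alg_hom_one[OF f] A.one_closed by (metis imageI)
      moreover have "f ` carrier A \<subseteq> carrier B" using alg_hom_closed[OF f] by blast
      ultimately show ?thesis using Idl_unit[OF B] B.Units_one_closed by blast
    qed
    moreover have "pull (Spec K R) A B f x \<in> psh_incl B ` pts (Spec K R) B"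
        if "B \<in> aff K" "f \<in> alg_hom K A B" for B f
      using alg_hom_comp[OF R, of x A f B] x that by (simp add: psh_incl_def)
    ultimately show "\<exists>I. ideal I A \<and> (\<forall>B\<in>aff K. \<forall>f\<in>alg_hom K A B.
      pull (Spec K R) A B f x \<in> psh_incl B ` pts (Spec K R) B \<longleftrightarrow> Idl\<^bsub>B\<^esub> (f ` I) = carrier B)"
      by (intro exI[of _ "carrier A"] conjI ballI A.oneideal) simp
  qed
  then have "\<exists>A\<in>aff K. \<exists>j. open_emb K (Spec K A) (Spec K R) j \<and> x \<in> j L ` pts (Spec K A) L"
      if "x \<in> pts (Spec K R) L" for x L
    using R that by (intro bexI[of _ R] exI[of _ psh_incl]) (simp_all add: psh_incl_def)
  then show ?thesis using zariski_sheaf_Spec[OF assms] by (simp add: scheme_def)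
qed

text \<open>An injective \<open>f\<close> whose image consists of the maps killing \<open>I\<close>
  makes \<open>F\<close> represented by the quotient \<open>Q\<close> of \<open>A\<close> by
  \<open>I\<close>, as these are the maps that factor through \<open>q\<close>;
  \<open>\<alpha>\<close> inverts \<open>f\<close> after composition with \<open>q\<close>.\<close>

lemma closed_subfunctor_affine:
  fixes A :: "('k, 'u) module" and F :: "('k, 'u, 'v) psh"
  assumes inf: "infinite (UNIV :: 'u set)" and A: "A \<in> aff K" and f: "psh_map K F (Spec K A) f"
    and inj: "\<And>B. B \<in> aff K \<Longrightarrow> inj_on (f B) (pts F B)" and I: "ideal I A"
    and img: "\<And>B \<phi>. B \<in> aff K \<Longrightarrow> \<phi> \<in> alg_hom K A B \<Longrightarrow> \<phi> \<in> f B ` pts F B \<longleftrightarrow> (\<forall>i\<in>I. \<phi> i = \<zero>\<^bsub>B\<^esub>)"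
  obtains Q q \<alpha> where "Q \<in> aff K" "quotient_map K A I Q q" "psh_iso K (Spec K Q) F \<alpha>"
    "\<And>B \<chi>. B \<in> aff K \<Longrightarrow> \<chi> \<in> alg_hom K Q B \<Longrightarrow> f B (\<alpha> B \<chi>) = compose (carrier A) \<chi> q"
proof -
  obtain Q q where Q: "Q \<in> aff K" "quotient_map K A I Q q" using quotient_exists[OF inf A I] .
  note q = quotient_map_hom[OF Q(2)]
  define \<alpha> where "\<alpha> B \<chi> = inv_into (pts F B) (f B) (compose (carrier A) \<chi> q)" for B \<chi>
  have c: "compose (carrier A) \<chi> q \<in> alg_hom K A B" if "\<chi> \<in> alg_hom K Q B" for \<chi> B
      by (rule alg_hom_comp[OF A q that])
  have mem: "compose (carrier A) \<chi> q \<in> f B ` pts F B" if B: "B \<in> aff K" and \<chi>: "\<chi> \<in> alg_hom K Q B"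
      for \<chi> B
  proof -
    have "compose (carrier A) \<chi> q i = \<zero>\<^bsub>B\<^esub>" if "i \<in> I" for i
      using that ideal_sub[OF I] quotient_map_zero[OF Q(2), of i] alg_hom_zero[OF Q(1) B \<chi>]
          by (auto simp: compose_def)
    then show ?thesis using img[OF B c[OF \<chi>]] by blast
  qed
  have \<alpha>c: "\<alpha> B \<chi> \<in> pts F B" and f\<alpha>: "f B (\<alpha> B \<chi>) = compose (carrier A) \<chi> q"
    if "B \<in> aff K" "\<chi> \<in> alg_hom K Q B" for B \<chi>
    unfolding \<alpha>_def using inv_into_into[OF mem[OF that]] f_inv_into_f[OF mem[OF that]] by auto
  have "psh_map K (Spec K Q) F \<alpha>"
  proof (rule psh_mapI[OF presheaf_Spec[OF Q(1)] psh_map_presheaf(1)[OF f]])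
    show "\<alpha> B \<chi> \<in> pts F B" if "B \<in> aff K" "\<chi> \<in> pts (Spec K Q) B" for B \<chi> using \<alpha>c that by simp
    fix B C g \<chi> assume B: "B \<in> aff K" "C \<in> aff K" "g \<in> alg_hom K B C" "\<chi> \<in> pts (Spec K Q) B"
    then have \<chi>: "\<chi> \<in> alg_hom K Q B" "compose (carrier Q) g \<chi> \<in> alg_hom K Q C"
        using alg_hom_comp[OF Q(1)] by auto
    have "f C (\<alpha> C (pull (Spec K Q) B C g \<chi>)) = f C (pull F B C g (\<alpha> B \<chi>))"
      using f\<alpha>[OF B(2) \<chi>(2)] f\<alpha>[OF B(1) \<chi>(1)] psh_map_pull[OF f B(1-3) \<alpha>c[OF B(1) \<chi>(1)]]
      by (simp add: alg_hom_comp_assoc[OF q])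
    then show "\<alpha> C (pull (Spec K Q) B C g \<chi>) = pull F B C g (\<alpha> B \<chi>)"
      using inj_onD[OF inj[OF B(2)]] \<alpha>c[OF B(2) \<chi>(2)] pull_closed[OF psh_map_presheaf(1)[OF f]
          B(1-3) \<alpha>c[OF B(1) \<chi>(1)]] by simp
  qed
  moreover have "bij_betw (\<alpha> B) (pts (Spec K Q) B) (pts F B)" if B: "B \<in> aff K" for B
  proof (rule bij_betw_imageI)
    show "inj_on (\<alpha> B) (pts (Spec K Q) B)"
    proof (rule inj_onI)
      fix \<chi> \<chi>' assume "\<chi> \<in> pts (Spec K Q) B" "\<chi>' \<in> pts (Spec K Q) B" and e: "\<alpha> B \<chi> = \<alpha> B \<chi>'"
      then have \<chi>: "\<chi> \<in> alg_hom K Q B" "\<chi>' \<in> alg_hom K Q B" by simp_all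
      have "compose (carrier A) \<chi> q = compose (carrier A) \<chi>' q" using f\<alpha>[OF B \<chi>(1)] f\<alpha>[OF B \<chi>(2)] e
          by simp
      then show "\<chi> = \<chi>'" by (rule quotient_epi[OF A Q(1) B Q(2) \<chi>])
    qed
    show "\<alpha> B ` pts (Spec K Q) B = pts F B"
    proof
      show "\<alpha> B ` pts (Spec K Q) B \<subseteq> pts F B" using \<alpha>c[OF B] by auto
      show "pts F B \<subseteq> \<alpha> B ` pts (Spec K Q) B"
      proof
        fix x assume x: "x \<in> pts F B"
        have fx: "f B x \<in> alg_hom K A B" using psh_map_closed[OF f B x] by simp
        then have "f B x i = \<zero>\<^bsub>B\<^esub>" if "i \<in> I" for i using img[OF B fx] x that by blast
        then obtain \<chi> where \<chi>: "\<chi> \<in> alg_hom K Q B" "compose (carrier A) \<chi> q = f B x"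
          using quotient_factor[OF A Q(1) B Q(2) fx] by metis
        then have "x = \<alpha> B \<chi>" using inj_onD[OF inj[OF B] _ x \<alpha>c[OF B \<chi>(1)]] f\<alpha>[OF B \<chi>(1)] by simp
        then show "x \<in> \<alpha> B ` pts (Spec K Q) B" using \<chi>(1) by simp
      qed
    qed
  qed
  ultimately have "psh_iso K (Spec K Q) F \<alpha>" by (simp add: psh_iso_def)
  with Q f\<alpha> that show thesis by blast
qed

section \<open>Fibre products and a criterion for closed embeddings\<close>

lemma pts_fibre_prod: "pts (fibre_prod F G \<alpha> \<beta>) A = {(x, y). x \<in> pts F A \<and> y \<in> pts G A \<and>
    \<alpha> A x = \<beta> A y}"
  and pull_fibre_prod: "pull (fibre_prod F G \<alpha> \<beta>) A B f = map_prod (pull F A B f) (pull G A B f)"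
  by (simp_all add: fibre_prod_def)

lemma presheaf_fibre_prod:
  assumes "psh_map K F X \<alpha>" "psh_map K G X \<beta>"
  shows "presheaf K (fibre_prod F G \<alpha> \<beta>)"
proof (rule presheafI)
  note P = psh_map_presheaf(1)[OF assms(1)] psh_map_presheaf(1)[OF assms(2)]
  fix A B f z assume A: "A \<in> aff K" "B \<in> aff K" "f \<in> alg_hom K A B" "z \<in> pts (fibre_prod F G \<alpha> \<beta>) A"
  then show "pull (fibre_prod F G \<alpha> \<beta>) A B f z \<in> pts (fibre_prod F G \<alpha> \<beta>) B"
    using pull_closed[OF P(1) A(1-3)] pull_closed[OF P(2) A(1-3)] psh_map_pull[OF assms(1) A(1-3)]
        psh_map_pull[OF assms(2) A(1-3)]
    by (auto simp: pts_fibre_prod pull_fibre_prod)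
next
  note P = psh_map_presheaf(1)[OF assms(1)] psh_map_presheaf(1)[OF assms(2)]
  fix A z assume "A \<in> aff K" "z \<in> pts (fibre_prod F G \<alpha> \<beta>) A"
  then show "pull (fibre_prod F G \<alpha> \<beta>) A A (\<lambda>a\<in>carrier A. a) z = z"
    using pull_id[OF P(1)] pull_id[OF P(2)] by (auto simp: pts_fibre_prod pull_fibre_prod)
next
  note P = psh_map_presheaf(1)[OF assms(1)] psh_map_presheaf(1)[OF assms(2)]
  fix A B C f g z assume A: "A \<in> aff K" "B \<in> aff K" "C \<in> aff K" "f \<in> alg_hom K A B"
      "g \<in> alg_hom K B C" "z \<in> pts (fibre_prod F G \<alpha> \<beta>) A"
  then show "pull (fibre_prod F G \<alpha> \<beta>) A C (compose (carrier A) g f) z =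
      pull (fibre_prod F G \<alpha> \<beta>) B C g (pull (fibre_prod F G \<alpha> \<beta>) A B f z)"
    using pull_comp[OF P(1) A(1-5)] pull_comp[OF P(2) A(1-5)]
        by (auto simp: pts_fibre_prod pull_fibre_prod)
qed

lemma fibre_fst_map:
  assumes "psh_map K F X \<alpha>" "psh_map K G X \<beta>"
  shows "psh_map K (fibre_prod F G \<alpha> \<beta>) F fibre_fst"
  by (rule psh_mapI[OF presheaf_fibre_prod[OF assms] psh_map_presheaf(1)[OF assms(1)]])
    (auto simp: pts_fibre_prod pull_fibre_prod)

text \<open>By the Yoneda lemma a map \<open>s\<close> from \<open>Spec A\<close> is a point
  \<open>x\<close> of \<open>S\<close>, and the base change of \<open>Z\<close> along it consists of
  the \<open>\<phi>\<close> for which the restriction of \<open>x\<close> lies in \<open>Z\<close>.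
  The condition \<open>closed\<close> thus makes it a closed subfunctor of
  \<open>Spec A\<close>.\<close>

lemma closed_embI:
  fixes Z :: "('k, 'u, 'v) psh" and S :: "('k, 'u, 'w) psh"
  assumes inf: "infinite (UNIV :: 'u set)" and Z: "scheme K Z" and S: "scheme K S"
      and f: "psh_map K Z S f"
    and inj: "\<And>A. A \<in> aff K \<Longrightarrow> inj_on (f A) (pts Z A)"
    and closed: "\<And>A x. A \<in> aff K \<Longrightarrow> x \<in> pts S A \<Longrightarrow> \<exists>I. ideal I A \<and> (\<forall>B\<in>aff K. \<forall>\<phi>\<in>alg_hom K A B.
      pull S A B \<phi> x \<in> f B ` pts Z B \<longleftrightarrow> (\<forall>i\<in>I. \<phi> i = \<zero>\<^bsub>B\<^esub>))"
  shows "closed_emb K Z S f"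
  unfolding closed_emb_def
proof (intro conjI Z S f ballI allI impI)
  fix A s assume A: "A \<in> aff K" and s: "psh_map K (Spec K A) S s"
  let ?x = "s A (\<lambda>a\<in>carrier A. a)"
  let ?F = "fibre_prod (Spec K A) Z s f"
  obtain I where I: "ideal I A" "\<forall>B\<in>aff K. \<forall>\<phi>\<in>alg_hom K A B. pull S A B \<phi> ?x \<in> f B ` pts Z B \<longleftrightarrow>
      (\<forall>i\<in>I. \<phi> i = \<zero>\<^bsub>B\<^esub>)"
    using closed[OF A yoneda_pt[OF s A]] by blast
  have "inj_on (fibre_fst B) (pts ?F B)" if B: "B \<in> aff K" for B
    using inj[OF B] by (auto simp: inj_on_def pts_fibre_prod)
  moreover have "\<phi> \<in> fibre_fst B ` pts ?F B \<longleftrightarrow> (\<forall>i\<in>I. \<phi> i = \<zero>\<^bsub>B\<^esub>)" if B: "B \<in> aff K"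
      and \<phi>: "\<phi> \<in> alg_hom K A B" for B \<phi>
  proof -
    have "\<phi> \<in> fibre_fst B ` pts ?F B \<longleftrightarrow> s B \<phi> \<in> f B ` pts Z B" using \<phi>
        by (force simp: pts_fibre_prod image_iff)
    also have "\<dots> \<longleftrightarrow> (\<forall>i\<in>I. \<phi> i = \<zero>\<^bsub>B\<^esub>)" using I(2) B \<phi> yoneda_eq[OF s A B \<phi>] by simp
    finally show ?thesis .
  qed
  ultimately obtain Q q \<alpha> where Q: "Q \<in> aff K" "quotient_map K A I Q q" "psh_iso K (Spec K Q) ?F \<alpha>"
    "\<And>B \<chi>. B \<in> aff K \<Longrightarrow> \<chi> \<in> alg_hom K Q B \<Longrightarrow> fibre_fst B (\<alpha> B \<chi>) = compose (carrier A) \<chi> q"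
    using closed_subfunctor_affine[OF inf A fibre_fst_map[OF s f] _ I(1)] by blast
  then show "\<exists>B\<in>aff K. \<exists>\<phi>\<in>alg_hom K A B. \<exists>\<theta>. \<phi> ` carrier A = carrier B \<and> psh_iso K (Spec K B) ?F \<theta> \<and>
      psh_eq_on K (Spec K B) (psh_comp fibre_fst \<theta>) (Spec_map A \<phi>)"
    using quotient_map_hom[OF Q(2)] quotient_map_surj[OF Q(2)]
    by (intro bexI[of _ Q] bexI[of _ q] exI[of _ \<alpha>]) (auto simp: psh_eq_on_def psh_comp_def
        Spec_map_def)
qed

subsection \<open>The index category of the natural numbers\<close>

text \<open>The arrow from \<open>i\<close> to \<open>j\<close> is the code of the pair, because
  presentations of ind-schemes are indexed by categories whose objects and arrows are in
  \<open>nat\<close>.\<close>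

definition omega_cat :: "(nat, nat) cat" where
  "omega_cat = \<lparr>Ob = UNIV, Ar = {m. fst (prod_decode m) \<le> snd (prod_decode m)},
     Dom = (\<lambda>m. fst (prod_decode m)), Cod = (\<lambda>m. snd (prod_decode m)), Ident = (\<lambda>n. prod_encode
         (n, n)),
     Cmp = (\<lambda>g f. prod_encode (fst (prod_decode f), snd (prod_decode g)))\<rparr>"

lemma Ob_omega: "Ob omega_cat = UNIV"
  by (simp add: omega_cat_def)

lemma Hom_omega: "m \<in> Hom omega_cat i j \<longleftrightarrow> m = prod_encode (i, j) \<and> i \<le> j"
proof -
  have "m = prod_encode (i, j) \<longleftrightarrow> prod_decode m = (i, j)"
      by (metis prod_encode_inverse prod_decode_inverse)
  then show ?thesis by (cases "prod_decode m") (auto simp: Hom_def omega_cat_def)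
qed

lemma category_omega: "category omega_cat"
  unfolding category_def Hom_def by (auto simp: omega_cat_def)

lemma filtered_omega: "filtered omega_cat"
  unfolding filtered_def
proof (intro conjI category_omega ballI)
  show "Ob omega_cat \<noteq> {}" by (simp add: Ob_omega)
  fix a b :: nat
  have "prod_encode (a, max a b) \<in> Hom omega_cat a (max a b)"
      "prod_encode (b, max a b) \<in> Hom omega_cat b (max a b)"
    by (simp_all add: Hom_omega)
  then show "\<exists>c\<in>Ob omega_cat. Hom omega_cat a c \<noteq> {} \<and> Hom omega_cat b c \<noteq> {}" unfolding Ob_omega
      by blast
  fix f g assume "f \<in> Hom omega_cat a b" "g \<in> Hom omega_cat a b"
  then have "f = g" by (simp add: Hom_omega)
  then show "\<exists>c\<in>Ob omega_cat. \<exists>h\<in>Hom omega_cat b c. Cmp omega_cat h f = Cmp omega_cat h g"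
    unfolding Ob_omega using category_ident[OF category_omega, of b] Ob_omega by blast
qed

lemma ess_countable_omega: "ess_countable omega_cat"
proof -
  have "cat_functor omega_cat omega_cat id id"
    using category_omega by (auto simp: cat_functor_def Hom_def category_def)
  moreover have "cat_isomorphic omega_cat a a" for a
  proof -
    have i: "prod_encode (a, a) \<in> Hom omega_cat a a" by (simp add: Hom_omega)
    then show ?thesis unfolding cat_isomorphic_def by (intro bexI[OF _ i]) (simp add: omega_cat_def)
  qed
  ultimately have "cat_equivalence omega_cat omega_cat id id"
    by (auto simp: cat_equivalence_def bij_betw_def)
  then show ?thesis unfolding ess_countable_def using category_omega by blast
qed

text \<open>Base change of a closed subscheme along \<open>x\<close>: the ideal \<open>I\<close> is
  replaced by the ideal its image generates.\<close>

lemma compose_kills: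
  assumes A: "A \<in> aff K" "A' \<in> aff K" "B \<in> aff K" and x: "x \<in> alg_hom K A A'"
      and \<phi>: "\<phi> \<in> alg_hom K A' B" and I: "ideal I A"
  shows "(\<forall>i\<in>I. compose (carrier A) \<phi> x i = \<zero>\<^bsub>B\<^esub>) \<longleftrightarrow> (\<forall>i\<in>Idl\<^bsub>A'\<^esub> (x ` I). \<phi> i = \<zero>\<^bsub>B\<^esub>)"
proof -
  have sub: "x ` I \<subseteq> carrier A'" using alg_hom_closed[OF x] ideal_sub[OF I] by blast
  show ?thesis unfolding Idl_kernel[OF A(2,3) \<phi> sub] using ideal_sub[OF I]
      by (auto simp: compose_def)
qed

text \<open>The terms of the presentation are the parts of \<open>X\<close> lying over the zero loci
  of the ideals \<open>I n\<close>. They are affine, they grow as the ideals shrink, and all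
  structure maps are inclusions, so the closedness of each is a case of
  \<open>compose_kills\<close>.\<close>

lemma ind_closed_emb_schemeI:
  fixes A :: "('k, 'u) module" and X :: "('k, 'u, 'v) psh"
  assumes inf: "infinite (UNIV :: 'u set)" and A: "A \<in> aff K" and f: "psh_map K X (Spec K A) f"
    and inj: "\<And>B. B \<in> aff K \<Longrightarrow> inj_on (f B) (pts X B)"
    and I: "\<And>n::nat. ideal (I n) A" and dec: "\<And>n. I (Suc n) \<subseteq> I n"
    and img: "\<And>B \<phi>. B \<in> aff K \<Longrightarrow> \<phi> \<in> alg_hom K A B \<Longrightarrow> \<phi> \<in> f B ` pts X B \<longleftrightarrow> (\<exists>n. \<forall>i\<in>I n. \<phi> i = \<zero>\<^bsub>B\<^esub>)"
  shows "ind_closed_emb_scheme K X (Spec K A) f"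
proof -
  define Y where "Y n = sub_psh X (\<lambda>B x. \<forall>i\<in>I n. f B x i = \<zero>\<^bsub>B\<^esub>)" for n
  have PX: "presheaf K X" by (rule psh_map_presheaf(1)[OF f])
  have Yp: "pts (Y n) B = {x \<in> pts X B. \<forall>i\<in>I n. f B x i = \<zero>\<^bsub>B\<^esub>}" and Ypull: "pull (Y n) = pull X"
      for n B
    by (simp_all add: Y_def)
  have fc: "f B x \<in> alg_hom K A B" if "B \<in> aff K" "x \<in> pts X B" for B x
      using psh_map_closed[OF f that] by simp
  have fp: "f C (pull X B C g x) = compose (carrier A) g (f B x)"
    if "B \<in> aff K" "C \<in> aff K" "g \<in> alg_hom K B C" "x \<in> pts X B" for B C g x
    using psh_map_pull[OF f that] by simp
  have mono: "I n \<subseteq> I m" if "m \<le> n" for m n by (rule lift_Suc_antimono_le[of I, OF dec that])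
  have Ysub: "pts (Y m) B \<subseteq> pts (Y n) B" if "m \<le> n" for m n B using mono[OF that] by (auto simp: Yp)
  have PY: "presheaf K (Y n)" for n
    unfolding Y_def
  proof (rule presheaf_sub_psh[OF PX])
    fix B C g x assume B: "B \<in> aff K" "C \<in> aff K" "g \<in> alg_hom K B C" "x \<in> pts X B"
        "\<forall>i\<in>I n. f B x i = \<zero>\<^bsub>B\<^esub>"
    then show "\<forall>i\<in>I n. f C (pull X B C g x) i = \<zero>\<^bsub>C\<^esub>"
      using fp[OF B(1-4)] ideal_sub[OF I] alg_hom_zero[OF B(1-3)] by (auto simp: compose_def)
  qed
  have incl: "psh_map K (Y n) X psh_incl" for n
    using sub_psh_incl[OF PX PY[unfolded Y_def]] by (simp add: Y_def)
  have fY: "psh_map K (Y n) (Spec K A) f" for n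
    using psh_map_comp[OF incl f] by (simp add: psh_comp_def psh_incl_def)
  have injY: "inj_on (f B) (pts (Y n) B)" if "B \<in> aff K" for n B
    by (rule inj_on_subset[OF inj[OF that]]) (auto simp: Yp)
  have imgY: "\<phi> \<in> f B ` pts (Y n) B \<longleftrightarrow> (\<forall>i\<in>I n. \<phi> i = \<zero>\<^bsub>B\<^esub>)" if "B \<in> aff K" "\<phi> \<in> alg_hom K A B"
      for n B \<phi>
    using img[OF that] by (auto simp: Yp)
  have sch: "scheme K (Y n)" for n
  proof (rule closed_subfunctor_affine[OF inf A fY[of n] injY[of _ n] I[of n] imgY[of _ _ n]])
    fix Q q \<alpha> assume Q: "Q \<in> aff K" "psh_iso K (Spec K Q) (Y n) \<alpha>"
    show ?thesis by (rule scheme_iso[OF scheme_Spec[OF inf Q(1)] Q(2)])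
  qed
  have closed_A: "closed_emb K (Y n) (Spec K A) f" for n
  proof (rule closed_embI[OF inf sch scheme_Spec[OF inf A] fY injY])
    fix A' x assume A': "A' \<in> aff K" and "x \<in> pts (Spec K A) A'"
    then have x: "x \<in> alg_hom K A A'" by simp
    have sub: "x ` I n \<subseteq> carrier A'" using alg_hom_closed[OF x] ideal_sub[OF I] by blast
    show "\<exists>J. ideal J A' \<and> (\<forall>B\<in>aff K. \<forall>\<phi>\<in>alg_hom K A' B.
      pull (Spec K A) A' B \<phi> x \<in> f B ` pts (Y n) B \<longleftrightarrow> (\<forall>i\<in>J. \<phi> i = \<zero>\<^bsub>B\<^esub>))"
    proof (intro exI[of _ "Idl\<^bsub>A'\<^esub> (x ` I n)"] conjI ballI)
      show "ideal (Idl\<^bsub>A'\<^esub> (x ` I n)) A'" by (rule ring.genideal_ideal[OF aff_ring[OF A'] sub])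
      fix B \<phi> assume B: "B \<in> aff K" and \<phi>: "\<phi> \<in> alg_hom K A' B"
      show "pull (Spec K A) A' B \<phi> x \<in> f B ` pts (Y n) B \<longleftrightarrow> (\<forall>i\<in>Idl\<^bsub>A'\<^esub> (x ` I n). \<phi> i = \<zero>\<^bsub>B\<^esub>)"
        using imgY[OF B alg_hom_comp[OF A x \<phi>]] compose_kills[OF A A' B x \<phi> I] by simp
    qed
  qed
  have closed_Y: "closed_emb K (Y m) (Y n) psh_incl" if mn: "m \<le> n" for m n
  proof (rule closed_embI[OF inf sch sch])
    show "psh_map K (Y m) (Y n) psh_incl"
      by (rule psh_mapI[OF PY PY]) (use Ysub[OF mn] in \<open>auto simp: psh_incl_def Ypull\<close>)
    show "inj_on (psh_incl B) (pts (Y m) B)" for B by (simp add: psh_incl_def inj_on_def)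
    fix A' z assume A': "A' \<in> aff K" and z: "z \<in> pts (Y n) A'"
    then have zX: "z \<in> pts X A'" by (simp add: Yp)
    note x = fc[OF A' zX]
    have sub: "f A' z ` I m \<subseteq> carrier A'" using alg_hom_closed[OF x] ideal_sub[OF I] by blast
    show "\<exists>J. ideal J A' \<and> (\<forall>B\<in>aff K. \<forall>\<phi>\<in>alg_hom K A' B.
      pull (Y n) A' B \<phi> z \<in> psh_incl B ` pts (Y m) B \<longleftrightarrow> (\<forall>i\<in>J. \<phi> i = \<zero>\<^bsub>B\<^esub>))"
    proof (intro exI[of _ "Idl\<^bsub>A'\<^esub> (f A' z ` I m)"] conjI ballI)
      show "ideal (Idl\<^bsub>A'\<^esub> (f A' z ` I m)) A'" by (rule ring.genideal_ideal[OF aff_ring[OF A'] sub])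
      fix B \<phi> assume B: "B \<in> aff K" and \<phi>: "\<phi> \<in> alg_hom K A' B"
      show "pull (Y n) A' B \<phi> z \<in> psh_incl B ` pts (Y m) B \<longleftrightarrow>
          (\<forall>i\<in>Idl\<^bsub>A'\<^esub> (f A' z ` I m). \<phi> i = \<zero>\<^bsub>B\<^esub>)"
        using compose_kills[OF A A' B x \<phi> I] fp[OF A' B \<phi> zX] pull_closed[OF PX A' B \<phi> zX]
        by (simp add: psh_incl_def Yp Ypull)
    qed
  qed
  let ?t = "\<lambda>m::nat. psh_incl"
  have D: "psh_diagram K omega_cat Y ?t"
    unfolding psh_diagram_def
  proof (intro conjI category_omega ballI impI PY)
    fix m assume "m \<in> Ar omega_cat"
    then have "Dom omega_cat m \<le> Cod omega_cat m" by (simp add: omega_cat_def)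
    from closed_Y[OF this] show "psh_map K (Y (Dom omega_cat m)) (Y (Cod omega_cat m)) psh_incl"
        by (simp add: closed_emb_def)
  qed (simp_all add: psh_eq_on_def psh_incl_def psh_comp_def)
  have "presentation K omega_cat Y ?t X ?t"
  proof (rule presentationI[OF D _ PX])
    show "cocone K omega_cat Y ?t X ?t"
      unfolding cocone_def using incl by (simp add: psh_eq_on_def psh_incl_def psh_comp_def)
    fix B x assume B: "B \<in> aff K" and x: "x \<in> pts X B"
    then obtain n where "\<forall>i\<in>I n. f B x i = \<zero>\<^bsub>B\<^esub>" using img[OF B fc[OF B x]] by blast
    then show "\<exists>c\<in>Ob omega_cat. \<exists>y\<in>pts (Y c) B. x = psh_incl B y"
      using x by (auto simp: Ob_omega psh_incl_def Yp)
  next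
    fix B and c d :: nat and y z assume "psh_incl B y = psh_incl B z"
    moreover have "prod_encode (c, max c d) \<in> Hom omega_cat c (max c d)"
        "prod_encode (d, max c d) \<in> Hom omega_cat d (max c d)"
      by (simp_all add: Hom_omega)
    ultimately show "\<exists>e f g. f \<in> Hom omega_cat c e \<and> g \<in> Hom omega_cat d e \<and>
        psh_incl B y = psh_incl B z" by blast
  qed
  moreover have "closed_emb K (Y (Dom omega_cat m)) (Y (Cod omega_cat m)) (?t m)"
      if "m \<in> Ar omega_cat" for m
    using that by (intro closed_Y) (simp add: omega_cat_def)
  ultimately have "ind_presentation K omega_cat Y ?t X ?t"
    unfolding ind_presentation_def using ess_countable_omega filtered_omega sch by blast
  moreover have "closed_emb K (Y c) (Spec K A) (psh_comp f (?t c))" for c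
    using closed_A by (simp add: psh_comp_def psh_incl_def)
  ultimately show ?thesis
    unfolding ind_closed_emb_scheme_def using scheme_Spec[OF inf A] f by blast
qed


subsection \<open>Ind-closed conditions on maps out of an algebra\<close>

text \<open>The maps satisfying \<open>P\<close> form the union of an increasing sequence of closed
  subschemes of \<open>Spec A\<close>; this is the input of
  \<open>ind_closed_emb_schemeI\<close>.\<close>

definition ind_closed_cond ::
    "'k ring \<Rightarrow> ('k, 'u) module \<Rightarrow> (('k, 'u) module \<Rightarrow> ('u \<Rightarrow> 'u) \<Rightarrow> bool) \<Rightarrow> bool" where
  "ind_closed_cond K A P \<longleftrightarrow> (\<exists>I :: nat \<Rightarrow> 'u set. (\<forall>n. ideal (I n) A) \<and> (\<forall>n. I (Suc n) \<subseteq> I n) \<and>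
     (\<forall>B\<in>aff K. \<forall>\<phi>\<in>alg_hom K A B. P B \<phi> \<longleftrightarrow> (\<exists>n. \<forall>i\<in>I n. \<phi> i = \<zero>\<^bsub>B\<^esub>)))"

lemma ind_closed_condI:
  fixes J :: "nat \<Rightarrow> 'u set"
  assumes "\<And>n. ideal (J n) A" and dir: "\<And>m n. \<exists>l. J l \<subseteq> J m \<inter> J n"
    and P: "\<And>B \<phi>. B \<in> aff K \<Longrightarrow> \<phi> \<in> alg_hom K A B \<Longrightarrow> P B \<phi> \<longleftrightarrow> (\<exists>n. \<forall>i\<in>J n. \<phi> i = \<zero>\<^bsub>B\<^esub>)"
  shows "ind_closed_cond K A P"
proof -
  obtain l where l: "\<And>m n. J (l m n) \<subseteq> J m \<inter> J n" using dir by metis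
  \<comment> \<open>The index \<open>c (Suc n)\<close> dominates \<open>c n\<close> and
    \<open>n\<close>; the sequence is thereby monotone and cofinal.\<close>
  define c where "c = rec_nat 0 (\<lambda>n m. l m n)"
  have c: "c (Suc n) = l (c n) n" for n by (simp add: c_def)
  have sub: "J (c (Suc n)) \<subseteq> J (c n)" "J (c (Suc n)) \<subseteq> J n" for n using l[of "c n" n]
      by (auto simp: c)
  have eq: "(\<exists>n. \<forall>i\<in>J n. \<phi> i = z) \<longleftrightarrow> (\<exists>n. \<forall>i\<in>J (c n). \<phi> i = z)" for \<phi> :: "'u \<Rightarrow> 'u" and z
    using sub(2) by blast
  show ?thesis
    unfolding ind_closed_cond_def
    by (intro exI[of _ "\<lambda>n. J (c n)"] conjI allI ballI assms(1) sub(1)) (simp add: P eq)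
qed

text \<open>A directed union of countably many such conditions is a union over pairs of indices,
  coded by \<open>prod_encode\<close>. What needs proof is that the doubly indexed family of ideals
  is directed.\<close>

lemma ind_closed_cond_union:
  fixes A :: "('k, 'u) module"
  assumes inf: "infinite (UNIV :: 'u set)" and A: "A \<in> aff K"
      and p: "\<And>n::nat. ind_closed_cond K A (p n)"
    and dir: "\<And>m n. \<exists>l. \<forall>B\<in>aff K. \<forall>\<phi>\<in>alg_hom K A B. p m B \<phi> \<or> p n B \<phi> \<longrightarrow> p l B \<phi>"
    and P: "\<And>B \<phi>. B \<in> aff K \<Longrightarrow> \<phi> \<in> alg_hom K A B \<Longrightarrow> P B \<phi> \<longleftrightarrow> (\<exists>n. p n B \<phi>)"
  shows "ind_closed_cond K A P"
proof -
  have "\<forall>n. \<exists>I. (\<forall>k. ideal (I k) A) \<and> (\<forall>k. I (Suc k) \<subseteq> I k) \<and>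
     (\<forall>B\<in>aff K. \<forall>\<phi>\<in>alg_hom K A B. p n B \<phi> \<longleftrightarrow> (\<exists>k. \<forall>i\<in>I k. \<phi> i = \<zero>\<^bsub>B\<^esub>))"
    using p unfolding ind_closed_cond_def by blast
  from choice[OF this] obtain I :: "nat \<Rightarrow> nat \<Rightarrow> 'u set"
    where I: "\<forall>n. (\<forall>k. ideal (I n k) A) \<and> (\<forall>k. I n (Suc k) \<subseteq> I n k) \<and>
     (\<forall>B\<in>aff K. \<forall>\<phi>\<in>alg_hom K A B. p n B \<phi> \<longleftrightarrow> (\<exists>k. \<forall>i\<in>I n k. \<phi> i = \<zero>\<^bsub>B\<^esub>))" by (rule exE)
  have id: "ideal (I n k) A" and dec: "I n (Suc k) \<subseteq> I n k" for n k using I by blast+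
  have pI: "p n B \<phi> \<longleftrightarrow> (\<exists>k. \<forall>i\<in>I n k. \<phi> i = \<zero>\<^bsub>B\<^esub>)" if "B \<in> aff K" "\<phi> \<in> alg_hom K A B" for n B \<phi>
    using I that by simp
  have mono: "I n k \<subseteq> I n j" if "j \<le> k" for n j k
      by (rule lift_Suc_antimono_le[of "I n", OF dec that])
  define J where "J m = I (fst (prod_decode m)) (snd (prod_decode m))" for m
  \<comment> \<open>The implication is tested on the universal map killing \<open>I n j\<close>, the
    quotient map: it satisfies \<open>p l\<close>, so it kills some \<open>I l k\<close>, which is
    then contained in its kernel.\<close>
  have sub: "\<exists>k. I l k \<subseteq> I n j" if pl: "\<forall>B\<in>aff K. \<forall>\<phi>\<in>alg_hom K A B. p n B \<phi> \<longrightarrow> p l B \<phi>" for n l j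
  proof -
    obtain Q q where Q: "Q \<in> aff K" "quotient_map K A (I n j) Q q"
        using quotient_exists[OF inf A id] .
    note q = quotient_map_hom[OF Q(2)]
    have "\<forall>i\<in>I n j. q i = \<zero>\<^bsub>Q\<^esub>" using quotient_map_zero[OF Q(2)] ideal_sub[OF id] by blast
    then have "p n Q q" using pI[OF Q(1) q] by blast
    then have "p l Q q" using pl Q(1) q by blast
    then obtain k where "\<forall>i\<in>I l k. q i = \<zero>\<^bsub>Q\<^esub>" using pI[OF Q(1) q] by blast
    then have "I l k \<subseteq> I n j" using quotient_map_zero[OF Q(2)] ideal_sub[OF id] by blast
    then show ?thesis by blast
  qed
  show ?thesis
  proof (rule ind_closed_condI[of J])
    show "ideal (J m) A" for m unfolding J_def by (rule id)
    fix m n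
    obtain l where l: "\<forall>B\<in>aff K. \<forall>\<phi>\<in>alg_hom K A B. p (fst (prod_decode m)) B \<phi> \<or>
        p (fst (prod_decode n)) B \<phi> \<longrightarrow> p l B \<phi>"
      using dir by blast
    obtain k1 where k1: "I l k1 \<subseteq> J m" unfolding J_def using sub[of "fst (prod_decode m)" l] l
        by blast
    obtain k2 where k2: "I l k2 \<subseteq> J n" unfolding J_def using sub[of "fst (prod_decode n)" l] l
        by blast
    have "J (prod_encode (l, max k1 k2)) \<subseteq> J m \<inter> J n"
      using k1 k2 mono[of k1 "max k1 k2" l] mono[of k2 "max k1 k2" l]
          unfolding J_def[of "prod_encode _"] by auto
    then show "\<exists>l. J l \<subseteq> J m \<inter> J n" by blast
  next
    fix B \<phi> assume B: "B \<in> aff K" "\<phi> \<in> alg_hom K A B"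
    have "(\<exists>n k. \<forall>i\<in>I n k. \<phi> i = \<zero>\<^bsub>B\<^esub>) \<longleftrightarrow> (\<exists>m. \<forall>i\<in>J m. \<phi> i = \<zero>\<^bsub>B\<^esub>)"
    proof
      assume "\<exists>n k. \<forall>i\<in>I n k. \<phi> i = \<zero>\<^bsub>B\<^esub>"
      then obtain n k where "\<forall>i\<in>I n k. \<phi> i = \<zero>\<^bsub>B\<^esub>" by blast
      then have "\<forall>i\<in>J (prod_encode (n, k)). \<phi> i = \<zero>\<^bsub>B\<^esub>" by (simp add: J_def)
      then show "\<exists>m. \<forall>i\<in>J m. \<phi> i = \<zero>\<^bsub>B\<^esub>" by blast
    qed (auto simp: J_def)
    then show "P B \<phi> \<longleftrightarrow> (\<exists>m. \<forall>i\<in>J m. \<phi> i = \<zero>\<^bsub>B\<^esub>)" using P[OF B] pI[OF B] by simp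
  qed
qed

text \<open>Every arrow out of \<open>c\<close> can be continued to a member of a sequence of
  arrows. Up to isomorphisms at both ends, an arrow out of \<open>c\<close> comes from the countable
  category \<open>D\<close>; the isomorphism at the target is absorbed into
  \<open>u\<close>.\<close>

lemma countable_cofinal:
  assumes "ess_countable C" "c \<in> Ob C"
  obtains h :: "nat \<Rightarrow> 'm" where "\<And>n. h n \<in> Hom (C :: ('o, 'm) cat) c (Cod C (h n))"
    "\<And>e f. f \<in> Hom C c e \<Longrightarrow> \<exists>n u. u \<in> Hom C e (Cod C (h n)) \<and> Cmp C u f = h n"
proof -
  obtain D :: "(nat, nat) cat" and Fo Fa where E: "cat_equivalence D C Fo Fa"
    using assms(1) unfolding ess_countable_def by blast
  have cat: "category C" using assms(1) by (simp add: ess_countable_def)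
  have D: "category D" using E by (simp add: cat_equivalence_def cat_functor_def)
  have iso: "\<exists>d\<in>Ob D. cat_isomorphic C (Fo d) e" if "e \<in> Ob C" for e using E that
      unfolding cat_equivalence_def by blast
  have "bij_betw Fa (Hom D a b) (Hom C (Fo a) (Fo b))" if "a \<in> Ob D" "b \<in> Ob D" for a b
    using E that unfolding cat_equivalence_def by blast
  then have "Fa ` Hom D a b = Hom C (Fo a) (Fo b)" if "a \<in> Ob D" "b \<in> Ob D" for a b
    using that by (simp add: bij_betw_def)
  then have full: "\<exists>n\<in>Hom D a b. Fa n = f" if "a \<in> Ob D" "b \<in> Ob D" "f \<in> Hom C (Fo a) (Fo b)"
      for a b f
    using that by (metis imageE)
  have Fa: "Fa n \<in> Hom C (Fo (Dom D n)) (Fo (Cod D n))" if "n \<in> Ar D" for n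
    using E that unfolding cat_equivalence_def cat_functor_def by blast
  have assoc: "Cmp C h (Cmp C g f) = Cmp C (Cmp C h g) f" if "f \<in> Hom C a b" "g \<in> Hom C b d"
      "h \<in> Hom C d e" for a b d e f g h
    using cat that unfolding category_def Hom_def by auto
  have idr: "Cmp C f (Ident C a) = f" if "f \<in> Hom C a b" for a b f
    using cat that unfolding category_def Hom_def by blast
  obtain d0 v w where d0: "d0 \<in> Ob D" and v: "v \<in> Hom C (Fo d0) c" and w: "w \<in> Hom C c (Fo d0)"
      and vw: "Cmp C v w = Ident C c"
    using iso[OF assms(2)] unfolding cat_isomorphic_def by blast
  \<comment> \<open>A code \<open>n\<close> that is not an arrow of \<open>D\<close> out of
    \<open>d0\<close> receives the identity as default value.\<close>
  define h where "h n = (if n \<in> Ar D \<and> Dom D n = d0 then Cmp C (Fa n) w else Ident C c)" for n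
  have h: "\<exists>e. h n \<in> Hom C c e" for n
    using category_comp[OF cat w, of "Fa n" "Fo (Cod D n)"] Fa[of n] category_ident[OF cat assms(2)]
        by (auto simp: h_def)
  show thesis
  proof (rule that)
    show "h n \<in> Hom C c (Cod C (h n))" for n using h[of n] by (auto simp: Hom_def)
    fix e f assume f: "f \<in> Hom C c e"
    then have "e \<in> Ob C" using Hom_Ob[OF cat] by blast
    then obtain d u where d: "d \<in> Ob D" and u: "u \<in> Hom C e (Fo d)" using iso
        unfolding cat_isomorphic_def by blast
    have uf: "Cmp C u f \<in> Hom C c (Fo d)" by (rule category_comp[OF cat f u])
    obtain n where n: "n \<in> Hom D d0 d" "Fa n = Cmp C (Cmp C u f) v"
        using full[OF d0 d category_comp[OF cat v uf]] by blast
    then have "h n = Cmp C (Cmp C (Cmp C u f) v) w" by (simp add: h_def Hom_def)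
    also have "\<dots> = Cmp C u f" using assoc[OF w v uf] idr[OF uf] vw by simp
    finally have "h n = Cmp C u f" .
    moreover have "Cod C (Cmp C u f) = Fo d" using uf by (simp add: Hom_def)
    ultimately show "\<exists>n u. u \<in> Hom C e (Cod C (h n)) \<and> Cmp C u f = h n" using u by metis
  qed
qed

section \<open>Reducedness in colimits\<close>

text \<open>Each element of \<open>T\<close> gets its own arrow out of \<open>c\<close>; as the
  properties persist under further composition, amalgamating the arrows one by one yields an arrow
  good for all.\<close>

lemma finite_amalgamation:
  assumes AP: "amalgamation C" and cat: "category C" and c: "c \<in> Ob C" and fin: "finite T"
    and ex: "\<And>a. a \<in> T \<Longrightarrow> \<exists>e f. f \<in> Hom C c e \<and> P a f"
    and push: "\<And>a e d f u. a \<in> T \<Longrightarrow> f \<in> Hom C c e \<Longrightarrow> u \<in> Hom C e d \<Longrightarrow> P a f \<Longrightarrow> P a (Cmp C u f)"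
  shows "\<exists>e f. f \<in> Hom C c e \<and> (\<forall>a\<in>T. P a f)"
  using fin ex push
proof (induction T)
  case empty
  then show ?case using category_ident[OF cat c] by blast
next
  case (insert b T)
  have "\<exists>e f. f \<in> Hom C c e \<and> (\<forall>a\<in>T. P a f)"
    by (rule insert.IH) (use insert.prems in blast)+
  then obtain e f where f: "f \<in> Hom C c e" "\<forall>a\<in>T. P a f" by blast
  obtain e' f' where f': "f' \<in> Hom C c e'" "P b f'" using insert.prems(1)[of b] by blast
  obtain d u v where uv: "u \<in> Hom C e d" "v \<in> Hom C e' d" "Cmp C u f = Cmp C v f'"
    using amalgamate[OF AP f(1) f'(1)] .
  have "P a (Cmp C u f)" if "a \<in> T" for a using insert.prems(2)[OF _ f(1) uv(1)] f(2) that by blast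
  moreover have "P b (Cmp C u f)" using insert.prems(2)[OF _ f'(1) uv(2) f'(2)] uv(3) by simp
  ultimately show ?case using category_comp[OF cat f(1) uv(1)] by blast
qed

text \<open>Colimits are objectwise, so the point of \<open>Z\<close> over the reduced
  \<open>Q\<close> comes from some \<open>Y d\<close>. Over \<open>A\<close> it agrees in
  \<open>Z\<close> with \<open>y\<close>, and the presentation makes the two equal in some
  \<open>Y e\<close>.\<close>

lemma red_pt_colim:
  assumes P: "presentation K C Y t Z \<iota>" and AP: "amalgamation C" and A: "A \<in> aff K"
    and c: "c \<in> Ob C" "y \<in> pts (Y c) A" and r: "red_pt K Z A (\<iota> c A y)"
  shows "\<exists>e f. f \<in> Hom C c e \<and> red_pt K (Y e) A (t f A y)"
proof -
  note D = presentationD(1)[OF P] and X = presentationD(2)[OF P]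
  obtain Q \<psi> z where Q: "Q \<in> aff K" "reduced_ring Q" "\<psi> \<in> alg_hom K Q A" "z \<in> pts Z Q"
      "\<iota> c A y = pull Z Q A \<psi> z"
    using r by (auto simp: red_pt_def)
  obtain d w where d: "d \<in> Ob C" "w \<in> pts (Y d) Q" "z = \<iota> d Q w"
      using presentation_surj[OF P Q(1,4)] .
  have pw: "pull (Y d) Q A \<psi> w \<in> pts (Y d) A"
      by (rule pull_closed[OF diagram_presheaf[OF D d(1)] Q(1) A Q(3) d(2)])
  have "\<iota> c A y = \<iota> d A (pull (Y d) Q A \<psi> w)"
    using psh_map_pull[OF cocone_map[OF X d(1)] Q(1) A Q(3) d(2)] Q(5) d(3) by simp
  then obtain e f g where e: "f \<in> Hom C c e" "g \<in> Hom C d e" "t f A y = t g A (pull (Y d) Q A \<psi> w)"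
    using presentation_eq[OF P AP A c d(1) pw] by blast
  have "t f A y = pull (Y e) Q A \<psi> (t g Q w)"
    using psh_map_pull[OF diagram_map[OF D e(2)] Q(1) A Q(3) d(2)] e(3) by simp
  then have "red_pt K (Y e) A (t f A y)"
    unfolding red_pt_def using Q(1-3) diagram_closed[OF D e(2) Q(1) d(2)] by blast
  then show ?thesis using e(1) by blast
qed

lemma lred_colim_iff:
  fixes A :: "('k, 'u) module" and Z :: "('k, 'u, 'w) psh"
  assumes P: "presentation K C Y t Z \<iota>" and AP: "amalgamation C" and A: "A \<in> aff K"
    and c: "c \<in> Ob C" "y \<in> pts (Y c) A"
  shows "lred K Z A (\<iota> c A y) \<longleftrightarrow> (\<exists>e f. f \<in> Hom C c e \<and> lred K (Y e) A (t f A y))"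
proof
  note D = presentationD(1)[OF P] and X = presentationD(2)[OF P]
  note cat = diagram_category[OF D]
  assume "lred K Z A (\<iota> c A y)"
  then have "locally_on K A (\<lambda>B h. red_pt K Z B (pull Z A B h (\<iota> c A y)))" by (simp add: lred_def)
  then obtain T B h where T: "finite T" "T \<subseteq> carrier A" "Idl\<^bsub>A\<^esub> T = carrier A"
    and B: "\<And>a. a \<in> T \<Longrightarrow> B a \<in> aff K" "\<And>a. a \<in> T \<Longrightarrow> localization_map K A a (B a) (h a)"
    and r: "\<And>a. a \<in> T \<Longrightarrow> red_pt K Z (B a) (pull Z A (B a) (h a) (\<iota> c A y))"
    by (rule locally_on_finite[OF A]) blast
  note h = localization_map_hom[OF B(2)]
  \<comment> \<open>The target is written \<open>Cod C f\<close>, so that the property depends on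
    \<open>a\<close> and the arrow alone, as \<open>finite_amalgamation\<close> requires.\<close>
  have "\<exists>e f. f \<in> Hom C c e \<and>
      (\<forall>a\<in>T. red_pt K (Y (Cod C f)) (B a) (pull (Y (Cod C f)) A (B a) (h a) (t f A y)))"
  proof (rule finite_amalgamation[OF AP cat c(1) T(1)])
    fix a assume a: "a \<in> T"
    let ?y = "pull (Y c) A (B a) (h a) y"
    have y': "?y \<in> pts (Y c) (B a)"
        by (rule pull_closed[OF diagram_presheaf[OF D c(1)] A B(1)[OF a] h[OF a] c(2)])
    have "red_pt K Z (B a) (\<iota> c (B a) ?y)"
      using r[OF a] psh_map_pull[OF cocone_map[OF X c(1)] A B(1)[OF a] h[OF a] c(2)] by simp
    then obtain e f where "f \<in> Hom C c e" "red_pt K (Y e) (B a) (t f (B a) ?y)"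
      using red_pt_colim[OF P AP B(1)[OF a] c(1) y'] by blast
    moreover from this have "t f (B a) ?y = pull (Y e) A (B a) (h a) (t f A y)" "Cod C f = e"
      using psh_map_pull[OF diagram_map[OF D] A B(1)[OF a] h[OF a] c(2)] by (auto simp: Hom_def)
    ultimately show "\<exists>e f. f \<in> Hom C c e \<and>
        red_pt K (Y (Cod C f)) (B a) (pull (Y (Cod C f)) A (B a) (h a) (t f A y))"
      by auto
  next
    fix a e d f u assume a: "a \<in> T" and f: "f \<in> Hom C c e" and u: "u \<in> Hom C e d"
      and r: "red_pt K (Y (Cod C f)) (B a) (pull (Y (Cod C f)) A (B a) (h a) (t f A y))"
    have cod: "Cod C f = e" "Cod C (Cmp C u f) = d" using f category_comp[OF cat f u]
        by (auto simp: Hom_def)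
    have "red_pt K (Y d) (B a) (t u (B a) (pull (Y e) A (B a) (h a) (t f A y)))"
      using red_pt_map[OF diagram_map[OF D u] B(1)[OF a]] r cod by simp
    then show
        "red_pt K (Y (Cod C (Cmp C u f))) (B a) (pull (Y (Cod C (Cmp C u f))) A (B a) (h a)
        (t (Cmp C u f) A y))"
      using psh_map_pull[OF diagram_map[OF D u] A B(1)[OF a] h[OF a] diagram_closed[OF D f A c(2)]]
        diagram_comp[OF D f u A c(2)] cod by simp
  qed
  then obtain e f where f: "f \<in> Hom C c e"
    "\<forall>a\<in>T. red_pt K (Y (Cod C f)) (B a) (pull (Y (Cod C f)) A (B a) (h a) (t f A y))" by blast
  have "Cod C f = e" using f(1) by (simp add: Hom_def)
  then have "\<forall>a\<in>T. red_pt K (Y e) (B a) (pull (Y e) A (B a) (h a) (t f A y))" using f(2) by simp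
  then have "locally_on K A (\<lambda>B h. red_pt K (Y e) B (pull (Y e) A B h (t f A y)))"
    by (intro locally_on_finiteI[where T = T and B = B and h = h, OF A T(2,3) B]) auto
  then have "lred K (Y e) A (t f A y)" using diagram_closed[OF D f(1) A c(2)]
      by (simp add: lred_def)
  with f(1) show "\<exists>e f. f \<in> Hom C c e \<and> lred K (Y e) A (t f A y)" by blast
next
  note D = presentationD(1)[OF P] and X = presentationD(2)[OF P]
  assume "\<exists>e f. f \<in> Hom C c e \<and> lred K (Y e) A (t f A y)"
  then obtain e f where f: "f \<in> Hom C c e" "lred K (Y e) A (t f A y)" by blast
  then have "e \<in> Ob C" using Hom_Ob[OF diagram_category[OF D]] by blast
  then have "lred K Z A (\<iota> e A (t f A y))" using lred_map[OF cocone_map[OF X] A f(2)] by blast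
  then show "lred K Z A (\<iota> c A y)" using cocone_comm[OF X f(1) A c(2)] by simp
qed

section \<open>Ind-closedness of the reduced locus in schemes and in colimits\<close>

lemma ind_closed_cond_scheme:
  fixes X :: "('k, 'u, 'v) psh"
  assumes "infinite (UNIV :: 'u set)" "scheme K X" "A \<in> aff K" "z \<in> pts X A"
  shows "ind_closed_cond K A (\<lambda>B \<phi>. lred K X B (pull X A B \<phi> z))"
proof -
  obtain I where "ideal I A" "\<forall>B\<in>aff K. \<forall>\<phi>\<in>alg_hom K A B. lred K X B (pull X A B \<phi> z) \<longleftrightarrow>
      (\<forall>x\<in>I. \<phi> x = \<zero>\<^bsub>B\<^esub>)"
    using reduced_locus_ideal[OF assms] .
  then show ?thesis unfolding ind_closed_cond_def by (intro exI[of _ "\<lambda>_. I"]) auto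
qed

text \<open>The hypothesis \<open>icl\<close> on the terms is what the lemma concludes about
  \<open>Z\<close>, so it applies twice: to ind-schemes presented by schemes, then to the colimit of
  ind-schemes. The conditions united are the reducedness of \<open>t (h n) A y\<close> along the
  cofinal sequence \<open>h\<close>.\<close>

lemma ind_closed_cond_colim:
  fixes A :: "('k, 'u) module" and Z :: "('k, 'u, 'w) psh"
  assumes inf: "infinite (UNIV :: 'u set)" and P: "presentation K C Y t Z \<iota>"
      and AP: "amalgamation C" and EC: "ess_countable C"
    and icl: "\<And>e u. e \<in> Ob C \<Longrightarrow> u \<in> pts (Y e) A \<Longrightarrow>
        ind_closed_cond K A (\<lambda>B \<phi>. lred K (Y e) B (pull (Y e) A B \<phi> u))"
    and A: "A \<in> aff K" and z: "z \<in> pts Z A"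
  shows "ind_closed_cond K A (\<lambda>B \<phi>. lred K Z B (pull Z A B \<phi> z))"
proof -
  note D = presentationD(1)[OF P] and X = presentationD(2)[OF P]
  note cat = diagram_category[OF D]
  obtain c y where c: "c \<in> Ob C" "y \<in> pts (Y c) A" "z = \<iota> c A y" using presentation_surj[OF P A z] .
  obtain h where h: "\<forall>n::nat. h n \<in> Hom C c (Cod C (h n))"
    and cof: "\<forall>e. \<forall>f\<in>Hom C c e. \<exists>n u. u \<in> Hom C e (Cod C (h n)) \<and> Cmp C u f = h n"
    using countable_cofinal[OF EC c(1)] by metis
  define p where "p n B \<phi> \<longleftrightarrow> lred K (Y (Cod C (h n))) B (pull (Y (Cod C (h n))) A B \<phi> (t (h n) A y))"
      for n B \<phi>
  have push: "lred K (Y d) B (pull (Y d) A B \<phi> (t (Cmp C u f) A y))"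
    if "f \<in> Hom C c e" "u \<in> Hom C e d" "B \<in> aff K" "\<phi> \<in> alg_hom K A B"
        "lred K (Y e) B (pull (Y e) A B \<phi> (t f A y))" for f e u d B \<phi>
    using lred_map[OF diagram_map[OF D that(2)] that(3,5)] diagram_comp[OF D that(1,2) A c(2)]
      psh_map_pull[OF diagram_map[OF D that(2)] A that(3,4) diagram_closed[OF D that(1) A c(2)]]
          by simp
  show ?thesis
  proof (rule ind_closed_cond_union[OF inf A, of p])
    show "ind_closed_cond K A (p n)" for n
    proof -
      have ob: "Cod C (h n) \<in> Ob C" using Hom_Ob[OF cat] h by blast
      show ?thesis unfolding p_def using icl[OF ob diagram_closed[OF D _ A c(2)]] h by simp
    qed
    fix m n
    \<comment> \<open>Directedness: the two arrows are amalgamated, the composite is continued to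
      some \<open>h l\<close>, and reducedness persists along arrows.\<close>
    obtain e f' g' where e: "f' \<in> Hom C (Cod C (h m)) e" "g' \<in> Hom C (Cod C (h n)) e"
        "Cmp C f' (h m) = Cmp C g' (h n)"
      using amalgamate[OF AP h[rule_format, of m] h[rule_format, of n]] .
    have f'h: "Cmp C f' (h m) \<in> Hom C c e" using category_comp[OF cat h[rule_format] e(1)] .
    then obtain l u where u: "u \<in> Hom C e (Cod C (h l))" "Cmp C u (Cmp C f' (h m)) = h l" using cof
        by blast
    have "p l B \<phi>" if B: "B \<in> aff K" "\<phi> \<in> alg_hom K A B" and "p m B \<phi> \<or> p n B \<phi>" for B \<phi>
      using that(3)
    proof
      assume "p m B \<phi>"
      then show "p l B \<phi>"
        using push[OF f'h u(1) B] push[OF h[rule_format] e(1) B] u(2) by (simp add: p_def)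
    next
      assume "p n B \<phi>"
      then show "p l B \<phi>"
        using push[OF f'h u(1) B] push[OF h[rule_format] e(2) B] u(2) e(3) by (simp add: p_def)
    qed
    then show "\<exists>l. \<forall>B\<in>aff K. \<forall>\<phi>\<in>alg_hom K A B. p m B \<phi> \<or> p n B \<phi> \<longrightarrow> p l B \<phi>" by blast
  next
    fix B \<phi> assume B: "B \<in> aff K" "\<phi> \<in> alg_hom K A B"
    let ?y = "pull (Y c) A B \<phi> y"
    have y': "?y \<in> pts (Y c) B" by (rule pull_closed[OF diagram_presheaf[OF D c(1)] A B c(2)])
    have ty: "t f B ?y = pull (Y e) A B \<phi> (t f A y)" if "f \<in> Hom C c e" for f e
      by (rule psh_map_pull[OF diagram_map[OF D that] A B c(2)])
    have "lred K Z B (pull Z A B \<phi> z) \<longleftrightarrow> lred K Z B (\<iota> c B ?y)"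
      using psh_map_pull[OF cocone_map[OF X c(1)] A B c(2)] c(3) by simp
    also have "\<dots> \<longleftrightarrow> (\<exists>e f. f \<in> Hom C c e \<and> lred K (Y e) B (t f B ?y))"
        by (rule lred_colim_iff[OF P AP B(1) c(1) y'])
    also have "\<dots> \<longleftrightarrow> (\<exists>n. p n B \<phi>)"
    proof
      assume "\<exists>e f. f \<in> Hom C c e \<and> lred K (Y e) B (t f B ?y)"
      then obtain e f where f: "f \<in> Hom C c e" "lred K (Y e) B (t f B ?y)" by blast
      obtain n u where "u \<in> Hom C e (Cod C (h n))" "Cmp C u f = h n" using cof f(1) by blast
      then have "p n B \<phi>" using push[OF f(1) _ B] f(2) ty[OF f(1)] unfolding p_def by metis
      then show "\<exists>n. p n B \<phi>" by blast
    next
      assume "\<exists>n. p n B \<phi>"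
      then obtain n where "p n B \<phi>" by blast
      then have "lred K (Y (Cod C (h n))) B (t (h n) B ?y)" using ty[OF h[rule_format]]
          by (simp add: p_def)
      then show "\<exists>e f. f \<in> Hom C c e \<and> lred K (Y e) B (t f B ?y)" using h by blast
    qed
    finally show "lred K Z B (pull Z A B \<phi> z) \<longleftrightarrow> (\<exists>n. p n B \<phi>)" .
  qed
qed


section \<open>Reduction\<close>

lemma reduction_iff:
  "x \<in> pts (reduction K (X :: ('k, 'u, 'v) psh)) A \<longleftrightarrow> x \<in> pts X A \<and>
    (\<exists>(T :: ('k, 'u, 'v + ('u \<Rightarrow> 'u)) psh) g. reduced_scheme K T \<and> psh_map K T X g \<and> x \<in> g A ` pts T
        A)"
  by (simp add: reduction_def)

lemma pull_reduction [simp]: "pull (reduction K X) = pull X"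
  by (simp add: reduction_def)

lemma reduction_sub: "x \<in> pts (reduction K X) A \<Longrightarrow> x \<in> pts X A"
  by (simp add: reduction_def)

lemma reduction_imp_lred:
  fixes X :: "('k, 'u, 'v) psh"
  assumes inf: "infinite (UNIV :: 'u set)" and A: "A \<in> aff K" and x: "x \<in> pts (reduction K X) A"
  shows "lred K X A x"
proof -
  obtain T :: "('k, 'u, 'v + ('u \<Rightarrow> 'u)) psh" and g \<tau>
    where T: "reduced_scheme K T" "psh_map K T X g" "\<tau> \<in> pts T A" "x = g A \<tau>" using x
        by (auto simp: reduction_iff)
  show ?thesis unfolding T(4) by (rule lred_map[OF T(2) A reduced_scheme_lred[OF inf T(1) A T(3)]])
qed

text \<open>The map \<open>T \<rightarrow> X\<close> is composed with \<open>f\<close>. Both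
  presheaves take values in the same type, so the same \<open>T\<close> is admissible for
  \<open>X'\<close>.\<close>

lemma reduction_map:
  fixes X X' :: "('k, 'u, 'v) psh"
  assumes f: "psh_map K X X' f" and A: "A \<in> aff K" and x: "x \<in> pts (reduction K X) A"
  shows "f A x \<in> pts (reduction K X') A"
proof -
  obtain T :: "('k, 'u, 'v + ('u \<Rightarrow> 'u)) psh" and g \<tau>
    where T: "x \<in> pts X A" "reduced_scheme K T" "psh_map K T X g" "\<tau> \<in> pts T A" "x = g A \<tau>" using x
        by (auto simp: reduction_iff)
  have "psh_map K T X' (psh_comp f g)" by (rule psh_map_comp[OF T(3) f])
  moreover have "f A x \<in> psh_comp f g A ` pts T A" using T(4,5) by (auto simp: psh_comp_def)
  ultimately show ?thesis unfolding reduction_iff using psh_map_closed[OF f A T(1)] T(2) by blast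
qed

lemma presheaf_reduction:
  fixes X :: "('k, 'u, 'v) psh"
  assumes X: "presheaf K X"
  shows "presheaf K (reduction K X)"
proof -
  have "reduction K X = sub_psh X (\<lambda>A x. \<exists>(T :: ('k, 'u, 'v + ('u \<Rightarrow> 'u)) psh) g.
      reduced_scheme K T \<and> psh_map K T X g \<and> x \<in> g A ` pts T A)"
    by (simp add: reduction_def sub_psh_def)
  moreover have "presheaf K \<dots>"
  proof (rule presheaf_sub_psh[OF X])
    fix A B f x assume A: "A \<in> aff K" "B \<in> aff K" "f \<in> alg_hom K A B" "x \<in> pts X A"
      and "\<exists>(T :: ('k, 'u, 'v + ('u \<Rightarrow> 'u)) psh) g. reduced_scheme K T \<and> psh_map K T X g \<and>
          x \<in> g A ` pts T A"
    then obtain T :: "('k, 'u, 'v + ('u \<Rightarrow> 'u)) psh" and g \<tau>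
      where T: "reduced_scheme K T" "psh_map K T X g" "\<tau> \<in> pts T A" "x = g A \<tau>" by blast
    have "pull X A B f x = g B (pull T A B f \<tau>)" using psh_map_pull[OF T(2) A(1-3) T(3)] T(4)
        by simp
    then show "\<exists>(T :: ('k, 'u, 'v + ('u \<Rightarrow> 'u)) psh) g. reduced_scheme K T \<and> psh_map K T X g \<and>
        pull X A B f x \<in> g B ` pts T B"
      using T(1,2) pull_closed[OF psh_map_presheaf(1)[OF T(2)] A(1-3) T(3)] by blast
  qed
  ultimately show ?thesis by simp
qed

text \<open>The reduced subscheme has values in \<open>'v\<close>, while \<open>reduction\<close>
  ranges over schemes with values in a sum type; tagging the values by \<open>Inl\<close> bridges
  the two.\<close>

lemma lred_scheme_reduced_scheme:
  fixes X :: "('k, 'u, 'v) psh"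
  assumes inf: "infinite (UNIV :: 'u set)" and X: "scheme K X"
  shows "\<exists>(T :: ('k, 'u, 'v + 'w) psh) g. reduced_scheme K T \<and> psh_map K T X g \<and>
    (\<forall>A\<in>aff K. g A ` pts T A = {x. lred K X A x})"
proof -
  let ?X = "sub_psh X (lred K X)"
  define T :: "('k, 'u, 'v + 'w) psh"
    where "T = \<lparr>pts = (\<lambda>A. Inl ` pts ?X A), pull = (\<lambda>A B f u. Inl (pull X A B f (projl u)))\<rparr>"
  have Tp: "pts T A = Inl ` pts ?X A" "pull T A B f u = Inl (pull X A B f (projl u))" for A B f u
      by (simp_all add: T_def)
  note red = reduced_subscheme[OF inf X]
  have PX: "presheaf K ?X" using red by (simp add: reduced_scheme_def scheme_presheaf)
  have PT: "presheaf K T"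
  proof (rule presheafI)
    show "pull T A B f x \<in> pts T B" if "A \<in> aff K" "B \<in> aff K" "f \<in> alg_hom K A B" "x \<in> pts T A"
        for A B f x
      using that pull_closed[OF PX that(1-3)] by (auto simp: Tp)
    show "pull T A A (\<lambda>a\<in>carrier A. a) x = x" if "A \<in> aff K" "x \<in> pts T A" for A x
      using that pull_id[OF PX that(1)] by (auto simp: Tp)
    show "pull T A C (compose (carrier A) g f) x = pull T B C g (pull T A B f x)"
      if "A \<in> aff K" "B \<in> aff K" "C \<in> aff K" "f \<in> alg_hom K A B" "g \<in> alg_hom K B C" "x \<in> pts T A"
          for A B C f g x
      using that pull_comp[OF PX that(1-5)] by (auto simp: Tp)
  qed
  have "psh_map K ?X T (\<lambda>A. Inl)" by (rule psh_mapI[OF PX PT]) (auto simp: Tp)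
  then have "psh_iso K ?X T (\<lambda>A. Inl)" by (simp add: psh_iso_def Tp bij_betw_def)
  then have "reduced_scheme K T" by (rule reduced_scheme_iso[OF red])
  moreover have "psh_map K T X (\<lambda>A. projl)"
    by (rule psh_mapI[OF PT scheme_presheaf[OF X]]) (auto simp: Tp)
  moreover have "projl ` pts T A = {x. lred K X A x}" for A by (auto simp: Tp image_image lred_def)
  ultimately show ?thesis by blast
qed

text \<open>By \<open>lred_colim_iff\<close> the point is locally reduced already in one scheme
  \<open>Y e\<close>, and the reduced subscheme of \<open>Y e\<close> serves as the \<open>T\<close>
  through which it factors.\<close>

lemma lred_imp_reduction_ind_scheme:
  fixes X :: "('k, 'u, 'v) psh"
  assumes inf: "infinite (UNIV :: 'u set)" and X: "ind_scheme K X" and A: "A \<in> aff K"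
      and x: "lred K X A x"
  shows "x \<in> pts (reduction K X) A"
proof -
  obtain C :: "(nat, nat) cat" and Y :: "nat \<Rightarrow> ('k, 'u, 'v) psh" and t \<iota>
      where I: "ind_presentation K C Y t X \<iota>"
    using X unfolding ind_scheme_def by blast
  have P: "presentation K C Y t X \<iota>" and AP: "amalgamation C" and sch: "\<And>c. c \<in> Ob C \<Longrightarrow>
      scheme K (Y c)"
    using I filtered_amalgamation by (auto simp: ind_presentation_def)
  note D = presentationD(1)[OF P] and cc = presentationD(2)[OF P]
  have xX: "x \<in> pts X A" using x by (simp add: lred_def)
  obtain c y where c: "c \<in> Ob C" "y \<in> pts (Y c) A" "x = \<iota> c A y"
      using presentation_surj[OF P A xX] .
  obtain e f where f: "f \<in> Hom C c e" "lred K (Y e) A (t f A y)"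
      using lred_colim_iff[OF P AP A c(1,2)] x c(3) by blast
  have e: "e \<in> Ob C" using Hom_Ob[OF diagram_category[OF D] f(1)] by blast
  obtain T :: "('k, 'u, 'v + ('u \<Rightarrow> 'u)) psh" and g where T: "reduced_scheme K T"
      "psh_map K T (Y e) g"
    "\<forall>A\<in>aff K. g A ` pts T A = {x. lred K (Y e) A x}"
        using lred_scheme_reduced_scheme[OF inf sch[OF e]] by blast
  have "t f A y \<in> g A ` pts T A" using T(3) A f(2) by blast
  then have "\<iota> e A (t f A y) \<in> psh_comp (\<iota> e) g A ` pts T A" by (auto simp: psh_comp_def)
  then have "x \<in> psh_comp (\<iota> e) g A ` pts T A" using cocone_comm[OF cc f(1) A c(2)] c(3) by simp
  then show ?thesis unfolding reduction_iff using xX T(1) psh_map_comp[OF T(2) cocone_map[OF cc e]]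
      by blast
qed

lemma ind_closed_cond_ind_scheme:
  fixes X :: "('k, 'u, 'v) psh"
  assumes inf: "infinite (UNIV :: 'u set)" and X: "ind_scheme K X" and A: "A \<in> aff K"
      and z: "z \<in> pts X A"
  shows "ind_closed_cond K A (\<lambda>B \<phi>. lred K X B (pull X A B \<phi> z))"
proof -
  obtain C :: "(nat, nat) cat" and Y :: "nat \<Rightarrow> ('k, 'u, 'v) psh" and t \<iota>
      where I: "ind_presentation K C Y t X \<iota>"
    using X unfolding ind_scheme_def by blast
  have P: "presentation K C Y t X \<iota>" and AP: "amalgamation C" and sch: "\<And>c. c \<in> Ob C \<Longrightarrow>
      scheme K (Y c)" and EC: "ess_countable C"
    using I filtered_amalgamation by (auto simp: ind_presentation_def)
  show ?thesis
    by (rule ind_closed_cond_colim[OF inf P AP EC _ A z]) (rule ind_closed_cond_scheme[OF inf sch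
        A])
qed

lemma psh_map_cong:
  assumes "psh_map K F G \<alpha>" "psh_eq_on K F \<alpha> \<beta>"
  shows "psh_map K F G \<beta>"
proof (rule psh_mapI[OF psh_map_presheaf[OF assms(1)]])
  have e: "\<beta> A x = \<alpha> A x" if "A \<in> aff K" "x \<in> pts F A" for A x using assms(2) that
      by (simp add: psh_eq_on_def)
  show "\<beta> A x \<in> pts G A" if "A \<in> aff K" "x \<in> pts F A" for A x
      using e[OF that] psh_map_closed[OF assms(1) that] by simp
  show "\<beta> B (pull F A B f x) = pull G A B f (\<beta> A x)" if "A \<in> aff K" "B \<in> aff K" "f \<in> alg_hom K A B"
      "x \<in> pts F A" for A B f x
    using e[OF that(1,4)] e[OF that(2) pull_closed[OF psh_map_presheaf(1)[OF assms(1)] that]]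
        psh_map_pull[OF assms(1) that] by simp
qed

section \<open>The reduction of an AP pseudo-ind-scheme\<close>

context
  fixes K :: "'k ring" and C :: "('o, 'm) cat" and Y :: "'o \<Rightarrow> ('k, 'u, 'v) psh" and t Z \<iota>
  assumes inf: "infinite (UNIV :: 'u set)"
      and ap: "ap_pseudo_ind_scheme K C Y t (Z :: ('k, 'u, 'v) psh) \<iota>"
begin

lemma ap_presentation: "presentation K C Y t Z \<iota>" "amalgamation C" "ess_countable C"
  and ap_ind_scheme: "\<And>c. c \<in> Ob C \<Longrightarrow> ind_scheme K (Y c)"
  using ap by (auto simp: ap_pseudo_ind_scheme_def)

lemma reduction_term_iff:
  assumes "A \<in> aff K" "c \<in> Ob C"
  shows "y \<in> pts (reduction K (Y c)) A \<longleftrightarrow> lred K (Y c) A y"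
proof
  show "lred K (Y c) A y" if "y \<in> pts (reduction K (Y c)) A"
      by (rule reduction_imp_lred[OF inf assms(1) that])
  show "y \<in> pts (reduction K (Y c)) A" if "lred K (Y c) A y"
    by (rule lred_imp_reduction_ind_scheme[OF inf ap_ind_scheme[OF assms(2)] assms(1) that])
qed

text \<open>The conditions imply one another in a cycle: a point of the reduction is locally
  reduced, such a point comes from a point of some term that is locally reduced there and so lies in
  the reduction of the term, and reductions map to reductions.\<close>

lemma reduction_colim_iff:
  assumes A: "A \<in> aff K"
  shows "z \<in> pts (reduction K Z) A \<longleftrightarrow> lred K Z A z"
    and "z \<in> pts (reduction K Z) A \<longleftrightarrow> (\<exists>c\<in>Ob C. \<exists>y\<in>pts (reduction K (Y c)) A. z = \<iota> c A y)"
proof -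
  note P = ap_presentation(1)
  note D = presentationD(1)[OF P] and cc = presentationD(2)[OF P]
  have 1: "lred K Z A z" if "z \<in> pts (reduction K Z) A" using that
      by (rule reduction_imp_lred[OF inf A])
  have 2: "\<exists>c\<in>Ob C. \<exists>y\<in>pts (reduction K (Y c)) A. z = \<iota> c A y" if l: "lred K Z A z"
  proof -
    have zZ: "z \<in> pts Z A" using l by (simp add: lred_def)
    obtain c y where c: "c \<in> Ob C" "y \<in> pts (Y c) A" "z = \<iota> c A y"
        using presentation_surj[OF P A zZ] .
    obtain e f where f: "f \<in> Hom C c e" "lred K (Y e) A (t f A y)"
      using lred_colim_iff[OF P ap_presentation(2) A c(1,2)] l c(3) by blast
    have e: "e \<in> Ob C" using Hom_Ob[OF diagram_category[OF D] f(1)] by blast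
    have "t f A y \<in> pts (reduction K (Y e)) A" using reduction_term_iff[OF A e] f(2) by blast
    moreover have "z = \<iota> e A (t f A y)" using cocone_comm[OF cc f(1) A c(2)] c(3) by simp
    ultimately show ?thesis using e by blast
  qed
  have 3: "z \<in> pts (reduction K Z) A" if "\<exists>c\<in>Ob C. \<exists>y\<in>pts (reduction K (Y c)) A. z = \<iota> c A y"
    using that reduction_map[OF cocone_map[OF cc] A] by blast
  show "z \<in> pts (reduction K Z) A \<longleftrightarrow> lred K Z A z" using 1 2 3 by blast
  show "z \<in> pts (reduction K Z) A \<longleftrightarrow> (\<exists>c\<in>Ob C. \<exists>y\<in>pts (reduction K (Y c)) A. z = \<iota> c A y)"
      using 1 2 3 by blast
qed

text \<open>Surjectivity is \<open>reduction_colim_iff\<close>. For injectivity the cospan found in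
  the original diagram serves unchanged, as the transition maps and the cocone are the same on
  elements.\<close>

lemma reduced_presentation: "presentation K C (\<lambda>c. reduction K (Y c)) t (reduction K Z) \<iota>"
proof -
  let ?Y = "\<lambda>c. reduction K (Y c)"
  note P = ap_presentation(1)
  note D = presentationD(1)[OF P] and cc = presentationD(2)[OF P]
  note cat = diagram_category[OF D]
  have PZ: "presheaf K Z"
      by (rule psh_map_presheaf(2)[OF psh_iso_psh_map[OF presentationD(3)[OF P]]])
  have PY: "presheaf K (?Y c)" if "c \<in> Ob C" for c
      by (rule presheaf_reduction[OF diagram_presheaf[OF D that]])
  have "psh_diagram K C ?Y t"
    unfolding psh_diagram_def
  proof (intro conjI cat ballI impI)
    show "presheaf K (?Y c)" if "c \<in> Ob C" for c by (rule PY[OF that])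
    fix f assume "f \<in> Ar C"
    then have f: "f \<in> Hom C (Dom C f) (Cod C f)" by (simp add: Hom_def)
    have ob: "Dom C f \<in> Ob C" "Cod C f \<in> Ob C" using Hom_Ob[OF cat f] by auto
    show "psh_map K (?Y (Dom C f)) (?Y (Cod C f)) (t f)"
    proof (rule psh_mapI[OF PY[OF ob(1)] PY[OF ob(2)]])
      show "t f A x \<in> pts (?Y (Cod C f)) A" if "A \<in> aff K" "x \<in> pts (?Y (Dom C f)) A" for A x
        by (rule reduction_map[OF diagram_map[OF D f] that])
      show "t f B (pull (?Y (Dom C f)) A B g x) = pull (?Y (Cod C f)) A B g (t f A x)"
        if "A \<in> aff K" "B \<in> aff K" "g \<in> alg_hom K A B" "x \<in> pts (?Y (Dom C f)) A" for A B g x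
        using psh_map_pull[OF diagram_map[OF D f] that(1-3) reduction_sub[OF that(4)]] by simp
    qed
    fix g assume "g \<in> Ar C" "Dom C g = Cod C f"
    then have g: "g \<in> Hom C (Cod C f) (Cod C g)" by (simp add: Hom_def)
    show "psh_eq_on K (?Y (Dom C f)) (t (Cmp C g f)) (psh_comp (t g) (t f))"
      unfolding psh_eq_on_def psh_comp_def
          by (intro ballI, rule diagram_comp[OF D f g]) (assumption, erule reduction_sub)
  next
    fix c assume c: "c \<in> Ob C"
    show "psh_eq_on K (?Y c) (t (Ident C c)) psh_incl"
      unfolding psh_eq_on_def psh_incl_def
          by (intro ballI, rule diagram_ident[OF D c]) (assumption, erule reduction_sub)
  qed
  moreover have "cocone K C ?Y t (reduction K Z) \<iota>"
    unfolding cocone_def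
  proof (intro conjI ballI)
    fix c assume c: "c \<in> Ob C"
    show "psh_map K (?Y c) (reduction K Z) (\<iota> c)"
    proof (rule psh_mapI[OF PY[OF c] presheaf_reduction[OF PZ]])
      show "\<iota> c A x \<in> pts (reduction K Z) A" if "A \<in> aff K" "x \<in> pts (?Y c) A" for A x
        by (rule reduction_map[OF cocone_map[OF cc c] that])
      show "\<iota> c B (pull (?Y c) A B g x) = pull (reduction K Z) A B g (\<iota> c A x)"
        if "A \<in> aff K" "B \<in> aff K" "g \<in> alg_hom K A B" "x \<in> pts (?Y c) A" for A B g x
        using psh_map_pull[OF cocone_map[OF cc c] that(1-3) reduction_sub[OF that(4)]] by simp
    qed
  next
    fix f assume "f \<in> Ar C"
    then have f: "f \<in> Hom C (Dom C f) (Cod C f)" by (simp add: Hom_def)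
    show "psh_eq_on K (?Y (Dom C f)) (psh_comp (\<iota> (Cod C f)) (t f)) (\<iota> (Dom C f))"
      unfolding psh_eq_on_def psh_comp_def
          by (intro ballI, rule cocone_comm[OF cc f]) (assumption, erule reduction_sub)
  qed
  ultimately show ?thesis
  proof (rule presentationI[OF _ _ presheaf_reduction[OF PZ]])
    fix A x assume "A \<in> aff K" "x \<in> pts (reduction K Z) A"
    then show "\<exists>c\<in>Ob C. \<exists>y\<in>pts (?Y c) A. x = \<iota> c A y" using reduction_colim_iff(2) by blast
  next
    fix A c d y z assume A: "A \<in> aff K" "c \<in> Ob C" "d \<in> Ob C" "y \<in> pts (?Y c) A" "z \<in> pts (?Y d) A"
        "\<iota> c A y = \<iota> d A z"
    obtain e f g where "f \<in> Hom C c e" "g \<in> Hom C d e" "t f A y = t g A z"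
      using presentation_eq[OF P ap_presentation(2) A(1,2) reduction_sub[OF A(4)] A(3)
          reduction_sub[OF A(5)] A(6)] .
    then show "\<exists>e f g. f \<in> Hom C c e \<and> g \<in> Hom C d e \<and> t f A y = t g A z" by blast
  qed
qed

text \<open>The canonical map of colimits thereby becomes an isomorphism onto the reduction followed
  by the inclusion, which reveals its injectivity and its image.\<close>

lemma reduced_colim_eq:
  "psh_eq_on K (psh_colim C (\<lambda>c. reduction K (Y c)) t) (colim_desc \<iota>)
     (psh_comp (colim_desc \<iota>) (colim_map C Y t (\<lambda>c. psh_incl)))"
  unfolding psh_eq_on_def
proof (intro ballI)
  note P = ap_presentation(1)
  fix A x assume A: "A \<in> aff K" and x: "x \<in> pts (psh_colim C (\<lambda>c. reduction K (Y c)) t) A"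
  from x obtain c y where c: "c \<in> Ob C" "y \<in> pts (reduction K (Y c)) A"
      "x = colim_class C (\<lambda>c. reduction K (Y c)) t A c y"
    by (rule colimE)
  have "colim_map C Y t (\<lambda>c. psh_incl) A x = colim_class C Y t A c y"
    unfolding c(3)
        by (rule colim_map_incl_class) (use reduction_sub diagram_category[OF presentationD(1)[OF
        P]] in auto)
  then show "colim_desc \<iota> A x = psh_comp (colim_desc \<iota>) (colim_map C Y t (\<lambda>c. psh_incl)) A x"
    using colim_desc_class[OF presentationD(1,2)[OF P] A c(1) reduction_sub[OF c(2)]]
      colim_desc_class[OF presentationD(1,2)[OF reduced_presentation] A c(1,2)] c(3)
          by (simp add: psh_comp_def)
qed

text \<open>Since \<open>?m\<close> is injective with image the reduction, its base change along
  \<open>s\<close> consists of the \<open>\<phi>\<close> at which the point \<open>?x\<close>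
  becomes locally reduced, an ind-closed condition by \<open>ind_closed_cond_colim\<close>.\<close>

lemma reduced_colim_ind_closed:
  "ind_closed_emb K (psh_colim C (\<lambda>c. reduction K (Y c)) t) Z
     (psh_comp (colim_desc \<iota>) (colim_map C Y t (\<lambda>c. psh_incl)))" (is "ind_closed_emb K ?F Z ?m")
proof -
  note P = ap_presentation(1)
  note D = presentationD(1)[OF P]
  note iso = presentationD(3)[OF reduced_presentation]
  have PZ: "presheaf K Z"
      by (rule psh_map_presheaf(2)[OF psh_iso_psh_map[OF presentationD(3)[OF P]]])
  have incl: "psh_map K (reduction K Z) Z psh_incl"
    by (rule psh_mapI[OF presheaf_reduction[OF PZ] PZ]) (auto simp: psh_incl_def reduction_sub)
  have "psh_map K ?F Z (colim_desc \<iota>)"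
    using psh_map_comp[OF psh_iso_psh_map[OF iso] incl] by (simp add: psh_comp_def psh_incl_def)
  then have m: "psh_map K ?F Z ?m" by (rule psh_map_cong[OF _ reduced_colim_eq])
  have meq: "?m A x = colim_desc \<iota> A x" if "A \<in> aff K" "x \<in> pts ?F A" for A x
    using reduced_colim_eq that unfolding psh_eq_on_def by simp
  have minj: "inj_on (?m A) (pts ?F A)" if "A \<in> aff K" for A
    using psh_iso_inj[OF iso that] meq[OF that] by (auto simp: inj_on_def)
  have mimg: "?m A ` pts ?F A = pts (reduction K Z) A" if "A \<in> aff K" for A
    using psh_iso_image[OF iso that] meq[OF that] by auto
  have "ind_closed_emb_scheme K (fibre_prod (Spec K A) ?F s ?m) (Spec K A) fibre_fst"
    if A: "A \<in> aff K" and s: "psh_map K (Spec K A) Z s" for A s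
  proof -
    let ?G = "fibre_prod (Spec K A) ?F s ?m" and ?x = "s A (\<lambda>a\<in>carrier A. a)"
    have x: "?x \<in> pts Z A" by (rule yoneda_pt[OF s A])
    have "ind_closed_cond K A (\<lambda>B \<phi>. lred K Z B (pull Z A B \<phi> ?x))"
      by (rule ind_closed_cond_colim[OF inf ap_presentation _ A x])
          (rule ind_closed_cond_ind_scheme[OF inf ap_ind_scheme A])
    then obtain I :: "nat \<Rightarrow> 'u set" where I: "\<And>n. ideal (I n) A" "\<And>n. I (Suc n) \<subseteq> I n"
      and l: "\<forall>B\<in>aff K. \<forall>\<phi>\<in>alg_hom K A B. lred K Z B (pull Z A B \<phi> ?x) \<longleftrightarrow> (\<exists>n. \<forall>i\<in>I n. \<phi> i = \<zero>\<^bsub>B\<^esub>)"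
      unfolding ind_closed_cond_def by blast
    show ?thesis
    proof (rule ind_closed_emb_schemeI[where I = I, OF inf A fibre_fst_map[OF s m] _ I])
      fix B :: "('k, 'u) module" assume B: "B \<in> aff K"
      show "inj_on (fibre_fst B) (pts ?G B)"
      proof (rule inj_onI)
        fix u v assume "u \<in> pts ?G B" "v \<in> pts ?G B" "fibre_fst B u = fibre_fst B v"
        then show "u = v" using inj_onD[OF minj[OF B], of "snd u" "snd v"]
            by (auto simp: pts_fibre_prod)
      qed
      fix \<phi> assume \<phi>: "\<phi> \<in> alg_hom K A B"
      have "\<phi> \<in> fibre_fst B ` pts ?G B \<longleftrightarrow> s B \<phi> \<in> ?m B ` pts ?F B" using \<phi>
          by (force simp: pts_fibre_prod image_iff)
      also have "\<dots> \<longleftrightarrow> lred K Z B (pull Z A B \<phi> ?x)"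
        unfolding mimg[OF B] yoneda_eq[OF s A B \<phi>] by (rule reduction_colim_iff(1)[OF B])
      also have "\<dots> \<longleftrightarrow> (\<exists>n. \<forall>i\<in>I n. \<phi> i = \<zero>\<^bsub>B\<^esub>)" using l B \<phi> by simp
      finally show "\<phi> \<in> fibre_fst B ` pts ?G B \<longleftrightarrow> (\<exists>n. \<forall>i\<in>I n. \<phi> i = \<zero>\<^bsub>B\<^esub>)" .
    qed
  qed
  with m show ?thesis by (simp add: ind_closed_emb_def)
qed

end

theorem corollary2p3p7:
  fixes K :: "'k ring"
    and C :: "('o, 'm) cat"
    and Y :: "'o \<Rightarrow> ('k, 'u, 'v) psh"
    and t :: "'m \<Rightarrow> ('k, 'u, 'v, 'v) psh_trans"
    and Z :: "('k, 'u, 'v) psh"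
    and \<iota> :: "'o \<Rightarrow> ('k, 'u, 'v, 'v) psh_trans"
    and e :: "'k \<Rightarrow> 'u"
  assumes "field K"
    and "infinite (UNIV :: 'u set)" and "inj_on e (carrier K)"
    and "ap_pseudo_ind_scheme K C Y t Z \<iota>"
  shows "let Yred = (\<lambda>c. reduction K (Y c));
             m = psh_comp (colim_desc \<iota>) (colim_map C Y t (\<lambda>c. psh_incl))
         in ind_closed_emb K (psh_colim C Yred t) Z m \<and>
            (\<exists>\<theta>. psh_iso K (psh_colim C Yred t) (reduction K Z) \<theta> \<and>
                 psh_eq_on K (psh_colim C Yred t) (psh_comp psh_incl \<theta>) m)"
proof -
  \<comment> \<open>The isomorphism \<open>\<theta>\<close> is \<open>colim_desc \<iota>\<close>,
    read as a map to the reduction.\<close>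
  have "psh_eq_on K (psh_colim C (\<lambda>c. reduction K (Y c)) t) (psh_comp psh_incl (colim_desc \<iota>))
      (psh_comp (colim_desc \<iota>) (colim_map C Y t (\<lambda>c. psh_incl)))"
    using reduced_colim_eq[OF assms(2,4)] by (simp add: psh_eq_on_def psh_comp_def psh_incl_def)
  then show ?thesis
    unfolding Let_def
    using reduced_colim_ind_closed[OF assms(2,4)] presentationD(3)[OF reduced_presentation[OF
        assms(2,4)]] by blast
qed

end
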